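(* Let $f\in C^\infty(\mathcal S)$, let $\mathcal K\subset M(m\times n,\mathbb R)$ be a linear constraint set (an affine, e.g. linear, subspace), let $\widetilde{\mathcal S}=\mathcal S\cap\mathcal K$, and let $h=f|_{\widetilde{\mathcal S}}$. Suppose $K^*$ is a nondegenerate local minimum of $h$ over $\widetilde{\mathcal S}$. Then there exists a neighborhood $\mathcal U^*\subset\widetilde{\mathcal S}$ of $K^*$ with the following property: whenever $K_0\in\mathcal U^*$, the sequence $\{K_t\}$ generated by the QRNPO algorithm started at $K_0$ remains in $\mathcal U^*$ (therefore it is stabilizing), and it converges to $K^*$ at least at a linear rate, and eventually with a quadratic rate.
   Context: $M(p\times q,\mathbb R)$ is the space of real $p\times q$ matrices; $\rho$ is the spectral radius; $\overline\lambda,\underline\lambda$ are the largest and smallest eigenvalues of a symmetric matrix; $\|\cdot\|_2$ is the spectral norm; $\succ,\succeq$ denote positive (semi-)definiteness of symmetric matrices. Fix a stabilizable pair $(A,B)$, $A\in M(n\times n,\mathbb R)$, $B\in M(n\times m,\mathbb R)$. Let $\mathcal S=\{K\in M(m\times n,\mathbb R): \rho(A+BK)<1\}$, an open subset of $M(m\times n,\mathbb R)$, and write $A_{\mathrm{cl}}=A+BK$. Identify $T_K\mathcal S\cong M(m\times n,\mathbb R)$. For $\rho(M)<1$, $\mathbb L(M,Z)$ denotes the unique solution $X$ of $X=MXM^\top+Z$. Metric: fix $\Sigma_1,\Sigma_2\succeq0$ and set $\Sigma_K=\Sigma_1+K^\top\Sigma_2K$ and $Y_K=\mathbb L(A_{\mathrm{cl}},\Sigma_K)$.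 It is assumed that $(A_{\mathrm{cl}},\Sigma_K^{1/2})$ is controllable for all $K\in\mathcal S$, so that $g_K(V,W)=\langle V,W\rangle|_K=\mathrm{tr}[V^\top W Y_K]$ is a Riemannian metric on $\mathcal S$. $\widetilde{\mathcal S}$ carries the induced metric. For $h\in C^\infty(\widetilde{\mathcal S})$, $\mathrm{grad}\,h$ is the gradient with respect to the induced metric, and $\mathrm{Hess}\,h[U]=\widetilde\nabla_U\,\mathrm{grad}\,h$ with $\widetilde\nabla$ the Levi-Civita connection of $\widetilde{\mathcal S}$. The Euclidean Hessian is $\overline{\mathrm{Hess}}\,h[U]=\widetilde{\overline\nabla}_U\,\mathrm{grad}\,h$, where $\overline\nabla$ is the connection on $\mathcal S$ whose Christoffel symbols in the global matrix-entry coordinates all vanish, and $\widetilde{\overline\nabla}$ is the connection it induces on $T\widetilde{\mathcal S}$ ($g$-orthogonal projection of $\overline\nabla_UV$ onto $T\widetilde{\mathcal S}$). A point $K^*\in\widetilde{\mathcal S}$ is a critical point of $h$ if $\mathrm{grad}\,h_{K^*}=0$; it is nondegenerate if $\langle \mathrm{Hess}\,h_{K^*}[G_1],G_2\rangle|_{K^*}=0$ for all $G_2\in T_{K^*}\widetilde{\mathcal S}$ implies $G_1=0$. QRNPO algorithm: choose a smooth map $\mathcal Q:\mathcal S\to M(n\times n,\mathbb R)$ with each $\mathcal Q_K\succ0$ symmetric. Starting from $K_0\in\widetilde{\mathcal S}$, for $t=0,1,2,\dots$: (1) find the Newton direction $G_t\in T_{K_t}\widetilde{\mathcal S}$ solving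 $\mathrm{Hess}\,h_{K_t}[G_t]=-\mathrm{grad}\,h_{K_t}$ (in a variant of the algorithm, to which the theorem also applies, $\mathrm{Hess}\,h$ is replaced by $\overline{\mathrm{Hess}}\,h$); (2) compute the stability certificate $s_{K_t}=\dfrac{\underline\lambda(\mathcal Q_{K_t})}{2\,\overline\lambda\big(\mathbb L((A+BK_t)^\top,\mathcal Q_{K_t})\big)\,\|BG_t\|_2}$ (with $s_{K_t}=+\infty$ if $BG_t=0$); (3) set $\eta_t=\min\{s_{K_t},1\}$ and $K_{t+1}=K_t+\eta_tG_t$. Rates: with $\mathrm{dist}$ the Riemannian distance on $\widetilde{\mathcal S}$, a linear rate means there is $r\in(0,1)$ with $\mathrm{dist}(K_{t+1},K^* )\le r\,\mathrm{dist}(K_t,K^* )$ for all $t$, and an eventual quadratic rate means there is $C>0$ with $\mathrm{dist}(K_{t+1},K^* )\le C\,\mathrm{dist}(K_t,K^* )^2$ for all sufficiently large $t$. *)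

theory Defs
  imports "HOL-Analysis.Analysis"
begin

section \<open>Matrices and linear systems\<close>

definition eigvals :: "'a::field^'n^'n \<Rightarrow> 'a set" where
  "eigvals M = {c. \<exists>v. v \<noteq> 0 \<and> M *v v = c *s v}"

definition spec_radius :: "real^'n^'n \<Rightarrow> real" where
  "spec_radius M = Max (cmod ` eigvals (\<chi> i j. complex_of_real (M $ i $ j)))"

text \<open>Only used for symmetric matrices, whose eigenvalues are all real.\<close>

definition max_eigval :: "real^'n^'n \<Rightarrow> real" where
  "max_eigval M = Max (eigvals M)"

definition min_eigval :: "real^'n^'n \<Rightarrow> real" where
  "min_eigval M = Min (eigvals M)"

definition spec_norm :: "real^'n^'m \<Rightarrow> real" where
  "spec_norm M = onorm (\<lambda>v. M *v v)"

definition pos_semidef :: "real^'n^'n \<Rightarrow> bool" where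
  "pos_semidef M \<longleftrightarrow> transpose M = M \<and> (\<forall>v. 0 \<le> v \<bullet> (M *v v))"

definition pos_def :: "real^'n^'n \<Rightarrow> bool" where
  "pos_def M \<longleftrightarrow> transpose M = M \<and> (\<forall>v. v \<noteq> 0 \<longrightarrow> 0 < v \<bullet> (M *v v))"

definition is_psd_sqrt :: "real^'n^'n \<Rightarrow> real^'n^'n \<Rightarrow> bool" where
  "is_psd_sqrt R M \<longleftrightarrow> pos_semidef R \<and> R ** R = M"

text \<open>Kalman's condition: the columns of \<open>[C, M C, \<dots>, M^(n-1) C]\<close> span the state space.\<close>

definition controllable :: "real^'n^'n \<Rightarrow> real^'k^'n \<Rightarrow> bool" where
  "controllable M C \<longleftrightarrow>
     span {((\<lambda>x. M *v x) ^^ i) (C *v u) |i u. i < CARD('n)} = (UNIV :: (real^'n) set)"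

definition lyap :: "real^'n^'n \<Rightarrow> real^'n^'n \<Rightarrow> real^'n^'n" where
  "lyap M Z = (THE X. X = M ** X ** transpose M + Z)"

definition stabilizing :: "real^'n^'n \<Rightarrow> real^'m^'n \<Rightarrow> (real^'n^'m) set" where
  "stabilizing A B = {K. spec_radius (A + B ** K) < 1}"

definition stabilizable :: "real^'n^'n \<Rightarrow> real^'m^'n \<Rightarrow> bool" where
  "stabilizable A B \<longleftrightarrow> (\<exists>K :: real^'n^'m. spec_radius (A + B ** K) < 1)"

definition cost_weight :: "real^'n^'n \<Rightarrow> real^'m^'m \<Rightarrow> real^'n^'m \<Rightarrow> real^'n^'n" where
  "cost_weight \<Sigma>1 \<Sigma>2 K = \<Sigma>1 + transpose K ** \<Sigma>2 ** K"

definition lyap_metric ::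
  "real^'n^'n \<Rightarrow> real^'m^'n \<Rightarrow> real^'n^'n \<Rightarrow> real^'m^'m \<Rightarrow>
   real^'n^'m \<Rightarrow> real^'n^'m \<Rightarrow> real^'n^'m \<Rightarrow> real" where
  "lyap_metric A B \<Sigma>1 \<Sigma>2 K V W =
     trace (transpose V ** W ** lyap (A + B ** K) (cost_weight \<Sigma>1 \<Sigma>2 K))"

section \<open>Smoothness\<close>

fun Ck_on :: "nat \<Rightarrow> ('a::euclidean_space \<Rightarrow> 'b::real_normed_vector) \<Rightarrow> 'a set \<Rightarrow> bool" where
  "Ck_on 0 f U \<longleftrightarrow> continuous_on U f"
| "Ck_on (Suc k) f U \<longleftrightarrow> (\<forall>x\<in>U. f differentiable at x) \<and>
     (\<forall>v. Ck_on k (\<lambda>x. frechet_derivative f (at x) v) U)"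

definition smooth_on :: "'a set \<Rightarrow> ('a::euclidean_space \<Rightarrow> 'b::real_normed_vector) \<Rightarrow> bool" where
  "smooth_on U f \<longleftrightarrow> (\<forall>k. Ck_on k f U)"

text \<open>For a subset that need not be open: local smooth extendability.\<close>

definition smooth_rel :: "'a set \<Rightarrow> ('a::euclidean_space \<Rightarrow> 'b::real_normed_vector) \<Rightarrow> bool" where
  "smooth_rel M f \<longleftrightarrow>
     (\<forall>x\<in>M. \<exists>U F. open U \<and> x \<in> U \<and> smooth_on U F \<and> (\<forall>y\<in>M \<inter> U. F y = f y))"

definition dird ::
  "('a::euclidean_space \<Rightarrow> 'b::real_normed_vector) \<Rightarrow> 'a \<Rightarrow> 'a \<Rightarrow> 'b" where
  "dird f p v = vector_derivative (\<lambda>t. f (p + t *\<^sub>R v)) (at 0)"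

section \<open>Riemannian geometry of a relatively open subset of an affine subspace\<close>

text \<open>Throughout, \<open>M\<close> is a relatively open subset of an affine subspace with direction space
  \<open>T\<close>, so that every tangent space of \<open>M\<close> is identified with \<open>T\<close>; a tangent vector \<open>v\<close> at \<open>p\<close>
  is represented by the line \<open>p + t v\<close>, which stays in \<open>M\<close> for small \<open>t\<close>.  The argument \<open>g\<close> is
  the metric, \<open>g p u v\<close> being the inner product at \<open>p\<close>.\<close>

definition direction_space :: "'a::real_vector set \<Rightarrow> 'a set" where
  "direction_space L = {x - y |x y. x \<in> L \<and> y \<in> L}"

definition vector_field :: "'a::euclidean_space set \<Rightarrow> 'a set \<Rightarrow> ('a \<Rightarrow> 'a) \<Rightarrow> bool" where
  "vector_field M T X \<longleftrightarrow> smooth_rel M X \<and> (\<forall>p\<in>M. X p \<in> T)"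

text \<open>The Lie bracket in affine coordinates.\<close>

definition lie_bracket :: "('a::euclidean_space \<Rightarrow> 'a) \<Rightarrow> ('a \<Rightarrow> 'a) \<Rightarrow> 'a \<Rightarrow> 'a" where
  "lie_bracket X Y p = dird Y p (X p) - dird X p (Y p)"

text \<open>\<open>D Y p u\<close> is the covariant derivative at \<open>p\<close> of the vector field \<open>Y\<close> in the direction of
  the tangent vector \<open>u\<close>; the conditions constrain it only for smooth \<open>Y\<close>, \<open>p \<in> M\<close>, \<open>u \<in> T\<close>.\<close>

definition affine_connection ::
  "'a::euclidean_space set \<Rightarrow> 'a set \<Rightarrow> (('a \<Rightarrow> 'a) \<Rightarrow> 'a \<Rightarrow> 'a \<Rightarrow> 'a) \<Rightarrow> bool" where
  "affine_connection M T D \<longleftrightarrow>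
     (\<forall>X Y. vector_field M T X \<longrightarrow> vector_field M T Y \<longrightarrow>
        vector_field M T (\<lambda>p. D Y p (X p))) \<and>
     (\<forall>Y p u v a b. vector_field M T Y \<longrightarrow> p \<in> M \<longrightarrow> u \<in> T \<longrightarrow> v \<in> T \<longrightarrow>
        D Y p (a *\<^sub>R u + b *\<^sub>R v) = a *\<^sub>R D Y p u + b *\<^sub>R D Y p v) \<and>
     (\<forall>Y Z p u. vector_field M T Y \<longrightarrow> vector_field M T Z \<longrightarrow> p \<in> M \<longrightarrow> u \<in> T \<longrightarrow>
        D (\<lambda>q. Y q + Z q) p u = D Y p u + D Z p u) \<and>
     (\<forall>\<phi> Y p u. smooth_rel M \<phi> \<longrightarrow> vector_field M T Y \<longrightarrow> p \<in> M \<longrightarrow> u \<in> T \<longrightarrow>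
        D (\<lambda>q. \<phi> q *\<^sub>R Y q) p u = dird \<phi> p u *\<^sub>R Y p + \<phi> p *\<^sub>R D Y p u)"

definition torsion_free ::
  "'a::euclidean_space set \<Rightarrow> 'a set \<Rightarrow> (('a \<Rightarrow> 'a) \<Rightarrow> 'a \<Rightarrow> 'a \<Rightarrow> 'a) \<Rightarrow> bool" where
  "torsion_free M T D \<longleftrightarrow>
     (\<forall>X Y. vector_field M T X \<longrightarrow> vector_field M T Y \<longrightarrow>
        (\<forall>p\<in>M. D Y p (X p) - D X p (Y p) = lie_bracket X Y p))"

definition metric_compatible ::
  "'a::euclidean_space set \<Rightarrow> 'a set \<Rightarrow> ('a \<Rightarrow> 'a \<Rightarrow> 'a \<Rightarrow> real) \<Rightarrow>
   (('a \<Rightarrow> 'a) \<Rightarrow> 'a \<Rightarrow> 'a \<Rightarrow> 'a) \<Rightarrow> bool" where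
  "metric_compatible M T g D \<longleftrightarrow>
     (\<forall>Y Z. vector_field M T Y \<longrightarrow> vector_field M T Z \<longrightarrow>
        (\<forall>p\<in>M. \<forall>u\<in>T. dird (\<lambda>q. g q (Y q) (Z q)) p u = g p (D Y p u) (Z p) + g p (Y p) (D Z p u)))"

definition levi_civita ::
  "'a::euclidean_space set \<Rightarrow> 'a set \<Rightarrow> ('a \<Rightarrow> 'a \<Rightarrow> 'a \<Rightarrow> real) \<Rightarrow>
   (('a \<Rightarrow> 'a) \<Rightarrow> 'a \<Rightarrow> 'a \<Rightarrow> 'a) \<Rightarrow> bool" where
  "levi_civita M T g D \<longleftrightarrow>
     affine_connection M T D \<and> torsion_free M T D \<and> metric_compatible M T g D"

definition riem_grad ::
  "'a::euclidean_space set \<Rightarrow> ('a \<Rightarrow> 'a \<Rightarrow> 'a \<Rightarrow> real) \<Rightarrow> ('a \<Rightarrow> real) \<Rightarrow> 'a \<Rightarrow> 'a" where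
  "riem_grad T g h p = (THE w. w \<in> T \<and> (\<forall>u\<in>T. g p w u = dird h p u))"

definition riem_hess ::
  "(('a \<Rightarrow> 'a) \<Rightarrow> 'a \<Rightarrow> 'a \<Rightarrow> 'a) \<Rightarrow> 'a::euclidean_space set \<Rightarrow> ('a \<Rightarrow> 'a \<Rightarrow> 'a \<Rightarrow> real) \<Rightarrow>
   ('a \<Rightarrow> real) \<Rightarrow> 'a \<Rightarrow> 'a \<Rightarrow> 'a" where
  "riem_hess D T g h p u = D (riem_grad T g h) p u"

definition tangent_proj ::
  "'a::euclidean_space set \<Rightarrow> ('a \<Rightarrow> 'a \<Rightarrow> 'a \<Rightarrow> real) \<Rightarrow> 'a \<Rightarrow> 'a \<Rightarrow> 'a" where
  "tangent_proj T g p w = (THE v. v \<in> T \<and> (\<forall>u\<in>T. g p (w - v) u = 0))"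

text \<open>The connection with vanishing Christoffel symbols in the global linear coordinates is the
  directional derivative; the induced one is its \<open>g\<close>-orthogonal projection.\<close>

definition eucl_hess ::
  "'a::euclidean_space set \<Rightarrow> ('a \<Rightarrow> 'a \<Rightarrow> 'a \<Rightarrow> real) \<Rightarrow> ('a \<Rightarrow> real) \<Rightarrow> 'a \<Rightarrow> 'a \<Rightarrow> 'a" where
  "eucl_hess T g h p u = tangent_proj T g p (dird (riem_grad T g h) p u)"

definition nondegenerate ::
  "'a::real_vector set \<Rightarrow> ('a \<Rightarrow> 'a \<Rightarrow> 'a \<Rightarrow> real) \<Rightarrow> ('a \<Rightarrow> 'a \<Rightarrow> 'a) \<Rightarrow> 'a \<Rightarrow> bool" where
  "nondegenerate T g H p \<longleftrightarrow>
     (\<forall>u\<in>T. (\<forall>v\<in>T. g p (H p u) v = 0) \<longrightarrow> u = 0)"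

definition local_min_on :: "'a::topological_space set \<Rightarrow> ('a \<Rightarrow> real) \<Rightarrow> 'a \<Rightarrow> bool" where
  "local_min_on M h p \<longleftrightarrow> p \<in> M \<and> (\<exists>N. open N \<and> p \<in> N \<and> (\<forall>q\<in>M \<inter> N. h p \<le> h q))"

text \<open>Curves may have unbounded velocity at their finitely many break points, so the length is a
  nonnegative integral with values in \<^typ>\<open>ennreal\<close>; two points that no curve joins are at
  distance \<open>\<infinity>\<close>.\<close>

definition riem_length ::
  "('a \<Rightarrow> 'a \<Rightarrow> 'a \<Rightarrow> real) \<Rightarrow> (real \<Rightarrow> 'a::euclidean_space) \<Rightarrow> ennreal" where
  "riem_length g \<gamma> =
     (\<integral>\<^sup>+t\<in>{0..1}. ennreal (sqrt (g (\<gamma> t) (vector_derivative \<gamma> (at t)) (vector_derivative \<gamma> (at t))))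
        \<partial>lborel)"

definition riem_dist ::
  "'a::euclidean_space set \<Rightarrow> ('a \<Rightarrow> 'a \<Rightarrow> 'a \<Rightarrow> real) \<Rightarrow> 'a \<Rightarrow> 'a \<Rightarrow> ennreal" where
  "riem_dist M g p q =
     Inf {riem_length g \<gamma> |\<gamma>. \<gamma> piecewise_C1_differentiable_on {0..1} \<and>
        \<gamma> ` {0..1} \<subseteq> M \<and> \<gamma> 0 = p \<and> \<gamma> 1 = q}"

text \<open>Finiteness is required because \<open>\<infinity> \<le> r * \<infinity>\<close> would make the inequality void.\<close>

definition linear_rate :: "('a \<Rightarrow> 'a \<Rightarrow> ennreal) \<Rightarrow> (nat \<Rightarrow> 'a) \<Rightarrow> 'a \<Rightarrow> bool" where
  "linear_rate d x l \<longleftrightarrow> (\<forall>t. d (x t) l < \<infinity>) \<and>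
     (\<exists>r::real. 0 < r \<and> r < 1 \<and> (\<forall>t. d (x (Suc t)) l \<le> ennreal r * d (x t) l))"

definition eventual_quadratic_rate :: "('a \<Rightarrow> 'a \<Rightarrow> ennreal) \<Rightarrow> (nat \<Rightarrow> 'a) \<Rightarrow> 'a \<Rightarrow> bool" where
  "eventual_quadratic_rate d x l \<longleftrightarrow>
     (\<exists>C::real. 0 < C \<and> (\<forall>\<^sub>F t in sequentially. d (x (Suc t)) l \<le> ennreal C * (d (x t) l)\<^sup>2))"

section \<open>The QRNPO iteration\<close>

definition stability_certificate ::
  "real^'n^'n \<Rightarrow> real^'m^'n \<Rightarrow> (real^'n^'m \<Rightarrow> real^'n^'n) \<Rightarrow> real^'n^'m \<Rightarrow> real^'n^'m \<Rightarrow> ereal" where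
  "stability_certificate A B Q K G =
     (if B ** G = 0 then \<infinity>
      else ereal (min_eigval (Q K) /
        (2 * max_eigval (lyap (transpose (A + B ** K)) (Q K)) * spec_norm (B ** G))))"

definition qrnpo_step_size ::
  "real^'n^'n \<Rightarrow> real^'m^'n \<Rightarrow> (real^'n^'m \<Rightarrow> real^'n^'n) \<Rightarrow> real^'n^'m \<Rightarrow> real^'n^'m \<Rightarrow> real" where
  "qrnpo_step_size A B Q K G = real_of_ereal (min (stability_certificate A B Q K G) 1)"

text \<open>\<open>H\<close> is the Hessian in use (Riemannian or Euclidean) and \<open>w\<close> the gradient field.\<close>

definition newton_direction ::
  "'a::real_vector set \<Rightarrow> ('a \<Rightarrow> 'a) \<Rightarrow> ('a \<Rightarrow> 'a \<Rightarrow> 'a) \<Rightarrow> 'a \<Rightarrow> 'a \<Rightarrow> bool" where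
  "newton_direction T w H p G \<longleftrightarrow> G \<in> T \<and> H p G = - w p"

definition qrnpo_sequence ::
  "real^'n^'n \<Rightarrow> real^'m^'n \<Rightarrow> (real^'n^'m \<Rightarrow> real^'n^'n) \<Rightarrow> (real^'n^'m) set \<Rightarrow>
   (real^'n^'m \<Rightarrow> real^'n^'m) \<Rightarrow> (real^'n^'m \<Rightarrow> real^'n^'m \<Rightarrow> real^'n^'m) \<Rightarrow>
   real^'n^'m \<Rightarrow> (nat \<Rightarrow> real^'n^'m) \<Rightarrow> bool" where
  "qrnpo_sequence A B Q T w H K0 K \<longleftrightarrow> K 0 = K0 \<and>
     (\<forall>t. \<exists>G. newton_direction T w H (K t) G \<and>
        K (Suc t) = K t + qrnpo_step_size A B Q (K t) G *\<^sub>R G)"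

end

theory Submission
  imports Defs "HOL-Computational_Algebra.Fundamental_Theorem_Algebra"
begin

text \<open>
  Near \<open>K\<^sup>*\<close> the method is a full Newton step.  Expanding a field in a constant orthonormal frame of
  \<open>T\<close>, any affine connection is the directional derivative plus a zeroth-order term that is linear
  in the field, with locally bounded coefficients because the covariant derivative of a constant
  field is a smooth field.  Since \<open>w = grad h\<close> vanishes at \<open>K\<^sup>*\<close>, both Hessians satisfy
  \<open>H\<^sub>p = w'(K\<^sup>*) + O(|p - K\<^sup>*|)\<close> on \<open>T\<close>, and \<open>w'(K\<^sup>*)\<close> is injective on \<open>T\<close> by nondegeneracy.  Hence
  the Newton direction \<open>G\<close> exists, is unique, and \<open>|p + G - K\<^sup>*| \<le> C |p - K\<^sup>*|\<^sup>2\<close>.  The step size is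
  \<open>1\<close> there, since \<open>G\<close> tends to \<open>0\<close> while the other factors of the certificate stay bounded and
  positive.  Finally the Riemannian distance to \<open>K\<^sup>*\<close> is comparable to the Euclidean one.\<close>

section \<open>Differentiability classes\<close>

text \<open>Several objects come without a formula that could be differentiated or estimated
  directly. The gradient and the Lyapunov solution are definite descriptions, so each is identified
  as the solution of a linear system with smooth invertible coefficients, and one induction on the
  order of differentiability serves both. The connection is known only through its axioms and acts
  on functions defined on the whole matrix space, so values off the constraint set must be shown
  harmless before a frame expansion can be used. The spectral radius is a maximum over complex
  eigenvalues; it is reached through decaying powers (an annihilating polynomial split into linear
  factors) in one direction and through Lyapunov functions in the other. The gradient field lives on
  the open set \<open>S\<close> and not only on \<open>S'\<close>, so it has an ordinary Frechet
  derivative. Finally, passing between the Euclidean and the Riemannian distance costs a factor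
  \<open>c2 / c1\<close>, which must be absorbed by shrinking the neighbourhood, since the linear
  rate is demanded from the first step on.\<close>

lemma Ck_on_cong:
  assumes "open U" "Ck_on k f U" "\<And>x. x \<in> U \<Longrightarrow> f x = g x"
  shows "Ck_on k g U"
  using assms(2,3)
proof (induction k arbitrary: f g)
  case 0
  then show ?case by (simp cong: continuous_on_cong)
next
  case (Suc k)
  have d: "(g has_derivative frechet_derivative f (at x)) (at x)" if "x \<in> U" for x
    using Suc.prems that has_derivative_transform_within_open[OF _ assms(1) that, of f _ UNIV g]
    by (auto simp: frechet_derivative_works)
  then have "frechet_derivative f (at x) = frechet_derivative g (at x)" if "x \<in> U" for x
    using frechet_derivative_at that by blast
  then have "Ck_on k (\<lambda>x. frechet_derivative g (at x) v) U" for v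
    using Suc.IH[of "\<lambda>x. frechet_derivative f (at x) v"] Suc.prems(1) by simp
  then show ?case using d by (auto simp: differentiable_def)
qed

text \<open>\<open>Ck_on\<close> is phrased with the chosen \<open>frechet_derivative\<close>;
  uniqueness of derivatives lets any explicit derivative take its place.\<close>

lemma Ck_on_SucI:
  assumes "\<And>x. x \<in> U \<Longrightarrow> (f has_derivative f' x) (at x)"
    and "\<And>v. Ck_on k (\<lambda>x. f' x v) U" and "open U"
  shows "Ck_on (Suc k) f U"
proof -
  have "f' x = frechet_derivative f (at x)" if "x \<in> U" for x
    using assms(1)[OF that] by (metis frechet_derivative_at)
  then have "Ck_on k (\<lambda>x. frechet_derivative f (at x) v) U" for v
    by (intro Ck_on_cong[OF assms(3) assms(2)[of v]]) simp
  then show ?thesis using assms(1) by (auto simp: differentiable_def)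
qed

lemma Ck_on_Suc_has_derivative:
  "Ck_on (Suc k) f U \<Longrightarrow> x \<in> U \<Longrightarrow> (f has_derivative frechet_derivative f (at x)) (at x)"
  by (simp add: frechet_derivative_works)

lemma Ck_on_continuous: "Ck_on k f U \<Longrightarrow> continuous_on U f"
  by (cases k) (auto intro!: continuous_at_imp_continuous_on differentiable_imp_continuous_within)

lemma Ck_on_SucD: "Ck_on (Suc k) f U \<Longrightarrow> Ck_on k f U"
proof (induction k arbitrary: f)
  case 0
  then show ?case using Ck_on_continuous[OF 0] by simp
next
  case (Suc k)
  then show ?case by (metis Ck_on.simps(2))
qed

lemma Ck_on_const: "open U \<Longrightarrow> Ck_on k (\<lambda>x. c) U"
  by (induction k arbitrary: c) auto

lemma Ck_on_linear:
  assumes "open U" "Ck_on k f U" "bounded_linear h"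
  shows "Ck_on k (\<lambda>x. h (f x)) U"
  using assms(2)
proof (induction k arbitrary: f)
  case 0
  then show ?case using bounded_linear.continuous_on[OF assms(3)] by simp
next
  case (Suc k)
  show ?case
    by (rule Ck_on_SucI[where f' = "\<lambda>x v. h (frechet_derivative f (at x) v)"])
      (use Suc assms in \<open>auto intro!: bounded_linear.has_derivative[OF assms(3)]
        simp: frechet_derivative_works\<close>)
qed

lemma Ck_on_add:
  assumes "open U" "Ck_on k f U" "Ck_on k g U"
  shows "Ck_on k (\<lambda>x. f x + g x) U"
  using assms(2,3)
proof (induction k arbitrary: f g)
  case 0
  then show ?case by (simp add: continuous_on_add)
next
  case (Suc k)
  show ?case
    by (rule Ck_on_SucI[where f' = "\<lambda>x v. frechet_derivative f (at x) v + frechet_derivative g (at x) v"])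
      (use Suc assms in \<open>auto intro!: has_derivative_add simp: frechet_derivative_works\<close>)
qed

lemma Ck_on_diff:
  assumes "open U" "Ck_on k f U" "Ck_on k g U"
  shows "Ck_on k (\<lambda>x. f x - g x) U"
  using Ck_on_add[OF assms(1,2) Ck_on_linear[OF assms(1,3) bounded_linear_minus[OF bounded_linear_ident]]]
  by simp

lemma Ck_on_sum:
  assumes "open U" "\<And>i. i \<in> I \<Longrightarrow> Ck_on k (f i) U"
  shows "Ck_on k (\<lambda>x. \<Sum>i\<in>I. f i x) U"
  using assms(2) by (induction I rule: infinite_finite_induct) (auto intro: Ck_on_const Ck_on_add assms(1))

lemma Ck_on_bilinear:
  assumes "open U" "bounded_bilinear h" "Ck_on k f U" "Ck_on k g U"
  shows "Ck_on k (\<lambda>x. h (f x) (g x)) U"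
  using assms(3,4)
proof (induction k arbitrary: f g)
  case 0
  then show ?case by (simp add: bounded_bilinear.continuous_on[OF assms(2)])
next
  case (Suc k)
  note D = Ck_on_SucD[OF Suc.prems(1)] Ck_on_SucD[OF Suc.prems(2)]
  show ?case
  proof (rule Ck_on_SucI[where f' = "\<lambda>x v. h (f x) (frechet_derivative g (at x) v)
        + h (frechet_derivative f (at x) v) (g x)"])
    show "((\<lambda>x. h (f x) (g x)) has_derivative (\<lambda>v. h (f x) (frechet_derivative g (at x) v)
        + h (frechet_derivative f (at x) v) (g x))) (at x)" if "x \<in> U" for x
      using Suc.prems that by (auto intro!: bounded_bilinear.FDERIV[OF assms(2)] simp: frechet_derivative_works)
    show "Ck_on k (\<lambda>x. h (f x) (frechet_derivative g (at x) v) + h (frechet_derivative f (at x) v) (g x)) U"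
      for v
      using Suc.prems D by (intro Ck_on_add Suc.IH assms(1)) auto
  qed fact
qed

lemma Ck_on_ident: "open U \<Longrightarrow> Ck_on k (\<lambda>x. x) U"
proof (cases k)
  case (Suc j)
  assume "open U"
  then show ?thesis unfolding Suc
    by (intro Ck_on_SucI[where f' = "\<lambda>x v. v"] Ck_on_const) (auto intro: derivative_eq_intros)
qed auto

section \<open>Linear systems with differentiable coefficients\<close>

lemma linear_expand:
  fixes f :: "'b::euclidean_space \<Rightarrow> 'c::real_vector"
  assumes "linear f" shows "f x = (\<Sum>e\<in>Basis. (x \<bullet> e) *\<^sub>R f e)"
  by (subst euclidean_representation[symmetric, of x])
    (simp only: linear_sum[OF assms] linear_scale[OF assms])

text \<open>Pointwise convergence on the finitely many basis vectors is already convergence in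
  operator norm, so a lower bound \<open>c\<close> of the injective limit leaves the bound
  \<open>c / 2\<close> nearby.\<close>

lemma linear_lower_bound_perturb:
  fixes A :: "'a::topological_space \<Rightarrow> 'b::euclidean_space \<Rightarrow> 'c::euclidean_space"
  assumes lin: "\<forall>\<^sub>F p in F. linear (A p)" and l0: "linear a" and inj: "inj a"
    and lim: "\<And>x. ((\<lambda>p. A p x) \<longlongrightarrow> a x) F"
  shows "\<exists>c>0. \<forall>\<^sub>F p in F. \<forall>x. c * norm x \<le> norm (A p x)"
proof -
  obtain c where c: "c > 0" "\<And>x. c * norm x \<le> norm (a x)"
    using linear_inj_bounded_below_pos[OF l0 inj] by blast
  have "((\<lambda>p. \<Sum>e\<in>Basis. norm (A p e - a e)) \<longlongrightarrow> (\<Sum>e\<in>Basis. norm (a e - a e))) F"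
    by (intro tendsto_sum tendsto_norm tendsto_diff lim tendsto_const)
  then have "\<forall>\<^sub>F p in F. (\<Sum>e\<in>Basis. norm (A p e - a e)) < c / 2"
    using c(1) by (intro order_tendstoD(2)[where a = "c / 2"]) auto
  with lin have "\<forall>\<^sub>F p in F. \<forall>x. (c / 2) * norm x \<le> norm (A p x)"
  proof eventually_elim
    case (elim p)
    show ?case
    proof
      fix x
      have "A p x - a x = (\<Sum>e\<in>Basis. (x \<bullet> e) *\<^sub>R (A p e - a e))"
        by (simp add: linear_expand[OF elim(1), of x] linear_expand[OF l0, of x]
            scaleR_diff_right sum_subtractf)
      also have "norm \<dots> \<le> (\<Sum>e\<in>Basis. norm x * norm (A p e - a e))"
        by (rule sum_norm_le) (auto intro!: mult_right_mono Basis_le_norm)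
      also have "\<dots> \<le> norm x * (c / 2)"
        unfolding sum_distrib_left[symmetric] using elim(2) by (intro mult_left_mono) auto
      finally have "norm (A p x - a x) \<le> norm x * (c / 2)" .
      moreover have "norm (a x) \<le> norm (A p x) + norm (A p x - a x)"
        by (metis norm_minus_commute norm_triangle_sub)
      ultimately show "(c / 2) * norm x \<le> norm (A p x)" using c(2)[of x]
        by (simp add: mult.commute)
    qed
  qed
  then show ?thesis using c(1) by (intro exI[of _ "c / 2"]) simp
qed

text \<open>Only continuity of \<open>\<phi>\<close> is needed because the other factor vanishes at the base point.\<close>

lemma has_derivative_scaleR_vanishing:
  fixes \<phi> :: "'a::real_normed_vector \<Rightarrow> real"
  assumes c: "isCont \<phi> x" and h: "(h has_derivative h') (at x)" and z: "h x = 0"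
  shows "((\<lambda>y. \<phi> y *\<^sub>R h y) has_derivative (\<lambda>v. \<phi> x *\<^sub>R h' v)) (at x)"
  unfolding has_derivative_iff_norm
proof
  have bl: "bounded_linear h'" and lim: "((\<lambda>y. norm (h y - h' (y - x)) / norm (y - x)) \<longlongrightarrow> 0) (at x)"
    using h z by (auto simp: has_derivative_iff_norm)
  show "bounded_linear (\<lambda>v. \<phi> x *\<^sub>R h' v)" by (rule bounded_linear_const_scaleR[OF bl])
  obtain K where K: "\<And>v. norm (h' v) \<le> norm v * K" using bounded_linear.bounded[OF bl] by blast
  have c': "(\<phi> \<longlongrightarrow> \<phi> x) (at x)" using c by (simp add: isCont_def)
  have "((\<lambda>y. \<bar>\<phi> y\<bar> * (norm (h y - h' (y - x)) / norm (y - x)) + \<bar>\<phi> y - \<phi> x\<bar> * K)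
      \<longlongrightarrow> \<bar>\<phi> x\<bar> * 0 + \<bar>\<phi> x - \<phi> x\<bar> * K) (at x)"
    by (intro tendsto_intros lim c')
  then have lim0: "((\<lambda>y. \<bar>\<phi> y\<bar> * (norm (h y - h' (y - x)) / norm (y - x)) + \<bar>\<phi> y - \<phi> x\<bar> * K)
      \<longlongrightarrow> 0) (at x)" by simp
  show "((\<lambda>y. norm (\<phi> y *\<^sub>R h y - \<phi> x *\<^sub>R h x - \<phi> x *\<^sub>R h' (y - x)) / norm (y - x)) \<longlongrightarrow> 0) (at x)"
  proof (rule Lim_null_comparison[OF _ lim0], unfold eventually_at, intro exI conjI ballI impI)
    fix y assume "y \<noteq> x \<and> dist y x < 1"
    then have n: "norm (y - x) > 0" by simp
    have "\<phi> y *\<^sub>R h y - \<phi> x *\<^sub>R h x - \<phi> x *\<^sub>R h' (y - x)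
        = \<phi> y *\<^sub>R (h y - h' (y - x)) + (\<phi> y - \<phi> x) *\<^sub>R h' (y - x)"
      by (simp add: z algebra_simps)
    then have "norm (\<phi> y *\<^sub>R h y - \<phi> x *\<^sub>R h x - \<phi> x *\<^sub>R h' (y - x))
        \<le> \<bar>\<phi> y\<bar> * norm (h y - h' (y - x)) + \<bar>\<phi> y - \<phi> x\<bar> * (norm (y - x) * K)"
      using norm_triangle_ineq[of "\<phi> y *\<^sub>R (h y - h' (y - x))" "(\<phi> y - \<phi> x) *\<^sub>R h' (y - x)"]
        mult_left_mono[OF K[of "y - x"], of "\<bar>\<phi> y - \<phi> x\<bar>"] by simp
    then show "norm (norm (\<phi> y *\<^sub>R h y - \<phi> x *\<^sub>R h x - \<phi> x *\<^sub>R h' (y - x)) / norm (y - x))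
        \<le> \<bar>\<phi> y\<bar> * (norm (h y - h' (y - x)) / norm (y - x)) + \<bar>\<phi> y - \<phi> x\<bar> * K"
      using n by (simp add: field_simps)
  qed simp
qed

text \<open>The error is bounded by a residual: \<open>A q (F q - F p) = b q - A q (F p)\<close>,
  and the lower bound of \<open>A q\<close>, uniform near \<open>p\<close>, divides it out.\<close>

lemma linear_system_isCont:
  fixes A :: "'a::euclidean_space \<Rightarrow> 'b::euclidean_space \<Rightarrow> 'b"
  assumes U: "open U" and p: "p \<in> U"
    and lin: "\<And>p. p \<in> U \<Longrightarrow> linear (A p)" and inj: "inj (A p)"
    and A: "\<And>x. continuous_on U (\<lambda>p. A p x)" and b: "continuous_on U b"
    and eq: "\<And>p. p \<in> U \<Longrightarrow> A p (F p) = b p"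
  shows "isCont F p"
proof -
  have evU: "\<forall>\<^sub>F q in at p. q \<in> U" using U p by (rule eventually_at_in_open')
  have Ac: "((\<lambda>q. A q x) \<longlongrightarrow> A p x) (at p)" and bc: "(b \<longlongrightarrow> b p) (at p)" for x
    using A[of x] b p by (auto simp: continuous_on_eq_continuous_at[OF U] isCont_def)
  obtain c where c: "c > 0" "\<forall>\<^sub>F q in at p. \<forall>x. c * norm x \<le> norm (A q x)"
    using linear_lower_bound_perturb[OF eventually_mono[OF evU lin] lin[OF p] inj Ac] by blast
  have "((\<lambda>q. norm (b q - A q (F p)) / c) \<longlongrightarrow> norm (b p - A p (F p)) / c) (at p)"
    by (intro tendsto_intros Ac bc) (use c in auto)
  then have l0: "((\<lambda>q. norm (b q - A q (F p)) / c) \<longlongrightarrow> 0) (at p)" by (simp add: eq[OF p])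
  have "((\<lambda>q. F q - F p) \<longlongrightarrow> 0) (at p)"
  proof (rule Lim_null_comparison[OF _ l0])
    show "\<forall>\<^sub>F q in at p. norm (F q - F p) \<le> norm (b q - A q (F p)) / c"
      using evU c(2)
    proof eventually_elim
      case (elim q)
      have "c * norm (F q - F p) \<le> norm (A q (F q - F p))" using elim by blast
      also have "A q (F q - F p) = b q - A q (F p)"
        using linear_diff[OF lin[OF elim(1)]] eq[OF elim(1)] by simp
      finally show ?case using c(1) by (simp add: field_simps)
    qed
  qed
  then show ?thesis by (simp add: isCont_def LIM_zero_iff)
qed

text \<open>Differentiating \<open>A p (F p) = b p\<close> gives a system for the derivative of
  \<open>F\<close> with the same \<open>A\<close>, whose right-hand side loses one order of
  differentiability and contains \<open>F\<close> only undifferentiated. Induction on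
  \<open>k\<close> thus treats \<open>F\<close> and its derivatives alike.\<close>

lemma Ck_on_linear_system:
  fixes A :: "'a::euclidean_space \<Rightarrow> 'b::euclidean_space \<Rightarrow> 'b"
  assumes U: "open U"
    and lin: "\<And>p. p \<in> U \<Longrightarrow> linear (A p)" and inj: "\<And>p. p \<in> U \<Longrightarrow> inj (A p)"
    and A: "\<And>x. Ck_on k (\<lambda>p. A p x) U" and b: "Ck_on k b U"
    and eq: "\<And>p. p \<in> U \<Longrightarrow> A p (F p) = b p"
  shows "Ck_on k F U"
  using A b eq
proof (induction k arbitrary: b F)
  case 0
  have "isCont F p" if "p \<in> U" for p
  proof (rule linear_system_isCont[where U = U and A = A and b = b and F = F and p = p])
    show "open U" "p \<in> U" "inj (A p)" by (fact U that inj[OF that])+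
    show "linear (A q)" if "q \<in> U" for q by (rule lin[OF that])
    show "continuous_on U (\<lambda>p. A p x)" for x by (rule Ck_on_continuous[OF 0(1)])
    show "continuous_on U b" by (rule Ck_on_continuous[OF 0(2)])
    show "A q (F q) = b q" if "q \<in> U" for q by (rule 0(3)[OF that])
  qed
  then show ?case by (simp add: continuous_at_imp_continuous_on)
next
  case (Suc k)
  have cont: "isCont F p" if "p \<in> U" for p
  proof (rule linear_system_isCont[where U = U and A = A and b = b and F = F and p = p])
    show "open U" "p \<in> U" "inj (A p)" by (fact U that inj[OF that])+
    show "linear (A q)" if "q \<in> U" for q by (rule lin[OF that])
    show "continuous_on U (\<lambda>p. A p x)" for x by (rule Ck_on_continuous[OF Suc.prems(1)])
    show "continuous_on U b" by (rule Ck_on_continuous[OF Suc.prems(2)])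
    show "A q (F q) = b q" if "q \<in> U" for q by (rule Suc.prems(3)[OF that])
  qed
  have diff: "F differentiable (at p)" if p: "p \<in> U" for p
  proof -
    obtain B where B: "linear B" "B \<circ> A p = id"
      using linear_injective_left_inverse[OF lin inj, OF p p] by blast
    have bB: "bounded_linear B" using B(1) linear_conv_bounded_linear by blast
    \<comment> \<open>\<open>h e q\<close> measures how far \<open>B \<circ> A q\<close> is from the
      identity on \<open>e\<close>. Since \<open>F q\<close> equals \<open>B (b q)\<close> minus the
      sum of the terms \<open>(F q \<bullet> e) *\<^sub>R h e q\<close>, and
      \<open>h e p = 0\<close>, continuity of \<open>F\<close> at \<open>p\<close> already gives
      differentiability there.\<close>
    define h where "h e q = B (A q e) - e" for e q
    have "h e p = 0" for e using B(2) by (simp add: h_def fun_eq_iff)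
    moreover have "\<exists>h'. (h e has_derivative h') (at p)" for e
      unfolding h_def
      by (rule exI, rule has_derivative_diff[OF bounded_linear.has_derivative[OF bB] has_derivative_const],
          rule Ck_on_Suc_has_derivative[OF Suc.prems(1) p])
    then obtain h' where "\<And>e. (h e has_derivative h' e) (at p)" by metis
    ultimately have h: "((\<lambda>q. (F q \<bullet> e) *\<^sub>R h e q) has_derivative (\<lambda>v. (F p \<bullet> e) *\<^sub>R h' e v)) (at p)" for e
      using cont[OF p] by (intro has_derivative_scaleR_vanishing) (auto intro: continuous_intros)
    have "((\<lambda>q. B (b q) - (\<Sum>e\<in>Basis. (F q \<bullet> e) *\<^sub>R h e q)) has_derivative
        (\<lambda>v. B (frechet_derivative b (at p) v) - (\<Sum>e\<in>Basis. (F p \<bullet> e) *\<^sub>R h' e v))) (at p)"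
      by (intro has_derivative_diff has_derivative_sum h bounded_linear.has_derivative[OF bB]
          Ck_on_Suc_has_derivative[OF Suc.prems(2) p])
    moreover have "B (b q) - (\<Sum>e\<in>Basis. (F q \<bullet> e) *\<^sub>R h e q) = F q" if q: "q \<in> U" for q
    proof -
      have "linear (\<lambda>x. B (A q x))" using linear_compose[OF lin[OF q] B(1)] by (simp add: o_def)
      from linear_expand[OF this, of "F q"]
      have "B (b q) = (\<Sum>e\<in>Basis. (F q \<bullet> e) *\<^sub>R B (A q e))" using Suc.prems(3)[OF q] by simp
      then show ?thesis
        by (simp add: h_def scaleR_diff_right sum_subtractf euclidean_representation)
    qed
    ultimately show ?thesis
      using has_derivative_transform_within_open[OF _ U p] unfolding differentiable_def by blast
  qed
  define F' where "F' v q = frechet_derivative F (at q) v" for v q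
  define A' where "A' e v q = frechet_derivative (\<lambda>p. A p e) (at q) v" for e v q
  define b' where "b' v q = frechet_derivative b (at q) v" for v q
  have F': "(F has_derivative (\<lambda>v. F' v q)) (at q)" if "q \<in> U" for q
    using diff[OF that] unfolding F'_def frechet_derivative_works by simp
  have A': "((\<lambda>p. A p e) has_derivative (\<lambda>v. A' e v q)) (at q)" if "q \<in> U" for e q
    using Ck_on_Suc_has_derivative[OF Suc.prems(1) that, of e] unfolding A'_def by simp
  have b': "(b has_derivative (\<lambda>v. b' v q)) (at q)" if "q \<in> U" for q
    using Ck_on_Suc_has_derivative[OF Suc.prems(2) that] unfolding b'_def by simp
  have dsys: "A q (F' v q) = b' v q - (\<Sum>e\<in>Basis. (F q \<bullet> e) *\<^sub>R A' e v q)" if q: "q \<in> U" for q v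
  proof -
    have "((\<lambda>p. \<Sum>e\<in>Basis. (F p \<bullet> e) *\<^sub>R A p e) has_derivative
        (\<lambda>v. \<Sum>e\<in>Basis. (F q \<bullet> e) *\<^sub>R A' e v q + (F' v q \<bullet> e) *\<^sub>R A q e)) (at q)"
      by (intro has_derivative_sum has_derivative_scaleR has_derivative_inner_left F' A' q)
    then have "(b has_derivative
        (\<lambda>v. \<Sum>e\<in>Basis. (F q \<bullet> e) *\<^sub>R A' e v q + (F' v q \<bullet> e) *\<^sub>R A q e)) (at q)"
    proof (rule has_derivative_transform_within_open[OF _ U q])
      show "(\<Sum>e\<in>Basis. (F p \<bullet> e) *\<^sub>R A p e) = b p" if "p \<in> U" for p
        by (simp only: linear_expand[OF lin[OF that], of "F p", symmetric] Suc.prems(3)[OF that])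
    qed
    then have "b' v q = (\<Sum>e\<in>Basis. (F q \<bullet> e) *\<^sub>R A' e v q + (F' v q \<bullet> e) *\<^sub>R A q e)"
      by (rule fun_cong[OF has_derivative_unique[OF b'[OF q]]])
    then show ?thesis
      using linear_expand[OF lin[OF q], of "F' v q"] by (simp add: sum.distrib)
  qed
  have AC: "Ck_on k (\<lambda>p. A p x) U" for x using Ck_on_SucD[OF Suc.prems(1)] .
  \<comment> \<open>The induction hypothesis is used twice: for \<open>F\<close> itself, so that the
    right-hand side of the differentiated system is of class \<open>k\<close>, and then for every
    directional derivative \<open>F' v\<close>.\<close>
  have FC: "Ck_on k F U"
    using Suc.IH[OF AC Ck_on_SucD[OF Suc.prems(2)]] Suc.prems(3) by blast
  have "Ck_on k (\<lambda>q. b' v q - (\<Sum>e\<in>Basis. (F q \<bullet> e) *\<^sub>R A' e v q)) U" for v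
  proof (intro Ck_on_diff Ck_on_sum U)
    show "Ck_on k (b' v) U" using Suc.prems(2) unfolding b'_def by simp
    fix e
    have "Ck_on k (A' e v) U" using Suc.prems(1)[of e] unfolding A'_def by simp
    then show "Ck_on k (\<lambda>q. (F q \<bullet> e) *\<^sub>R A' e v q) U"
      by (intro Ck_on_bilinear[OF U bounded_bilinear_scaleR]
          Ck_on_linear[OF U FC bounded_linear_inner_left])
  qed
  then have "Ck_on k (F' v) U" for v
    using Suc.IH[OF AC, where F = "F' v"] dsys by blast
  then show ?case using F' by (intro Ck_on_SucI[OF _ _ U]) auto
qed

section \<open>Directional derivatives along lines\<close>

lemma smooth_on_Ck: "smooth_on U f \<Longrightarrow> Ck_on k f U"
  by (simp add: smooth_on_def)

lemma line_has_vector_derivative: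
  assumes "(f has_derivative f') (at p)"
  shows "((\<lambda>t::real. f (p + t *\<^sub>R u)) has_vector_derivative f' u) (at 0)"
proof -
  have "((\<lambda>t::real. p + t *\<^sub>R u) has_vector_derivative u) (at 0)"
    by (auto intro!: derivative_eq_intros)
  moreover have "(f has_derivative f') (at (p + (0::real) *\<^sub>R u))" using assms by simp
  ultimately show ?thesis
    using vector_derivative_diff_chain_within[of "\<lambda>t. p + t *\<^sub>R u" u 0 UNIV f f']
    by (simp add: o_def has_derivative_at_withinI)
qed

lemma dird_eq: "(f has_derivative f') (at p) \<Longrightarrow> dird f p u = f' u"
  unfolding dird_def by (rule vector_derivative_at[OF line_has_vector_derivative])

lemma smooth_on_dird:
  "smooth_on U f \<Longrightarrow> p \<in> U \<Longrightarrow> dird f p u = frechet_derivative f (at p) u"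
  using dird_eq Ck_on_Suc_has_derivative smooth_on_Ck by metis

section \<open>Gradients of coercive metrics\<close>

locale orthonormal_basis =
  fixes T B :: "'a::euclidean_space set"
  assumes finite_B: "finite B" and orth: "pairwise orthogonal B"
    and unit: "\<And>b. b \<in> B \<Longrightarrow> norm b = 1" and span_B: "span B = T"
begin

definition proj :: "'a \<Rightarrow> 'a" where "proj x = (\<Sum>b\<in>B. (x \<bullet> b) *\<^sub>R b)"

lemma subspace_T: "subspace T" using span_B subspace_span by blast

lemma proj_in: "proj x \<in> T"
  unfolding proj_def span_B[symmetric] by (intro span_sum span_scale span_base)

lemma B_in: "b \<in> B \<Longrightarrow> b \<in> T" using span_B span_base by blast

lemma proj_id: "x \<in> T \<Longrightarrow> proj x = x"
  unfolding proj_def using orthonormal_basis_expand[OF orth unit _ finite_B] span_B by blast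

lemma proj_linear: "bounded_linear proj"
  unfolding proj_def by (intro bounded_linear_intros)

lemma proj_inner: assumes "u \<in> T" shows "proj x \<bullet> u = x \<bullet> u"
proof -
  have "proj x \<bullet> u = x \<bullet> proj u"
    by (simp add: proj_def inner_sum_left inner_sum_right inner_commute mult.commute)
  then show ?thesis using proj_id[OF assms] by simp
qed

text \<open>\<open>h\<close> is linear only on \<open>T\<close>, so it is extended by the identity
  on the orthogonal complement. The extension is an injective linear self-map of the whole space,
  hence onto, and its preimages of vectors in \<open>T\<close> lie in \<open>T\<close>.\<close>

lemma linear_on_surj:
  assumes add: "\<And>u v. u \<in> T \<Longrightarrow> v \<in> T \<Longrightarrow> h (u + v) = h u + h v"
    and scale: "\<And>c u. u \<in> T \<Longrightarrow> h (c *\<^sub>R u) = c *\<^sub>R h u"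
    and into: "\<And>u. u \<in> T \<Longrightarrow> h u \<in> T" and ker: "\<And>u. u \<in> T \<Longrightarrow> h u = 0 \<Longrightarrow> u = 0"
    and y: "y \<in> T"
  shows "\<exists>x\<in>T. h x = y"
proof -
  let ?h = "\<lambda>x. h (proj x) + (x - proj x)"
  have pl: "linear proj" using proj_linear bounded_linear.linear by blast
  have "linear ?h"
    by (simp add: linear_iff linear_add[OF pl] linear_scale[OF pl] add scale proj_in algebra_simps)
  moreover have key: "x = proj x" if "?h x \<in> T" for x
  proof -
    have "x - proj x = ?h x - h (proj x)" by simp
    also have "\<dots> \<in> T" using that into[OF proj_in] subspace_diff[OF subspace_T] by blast
    finally have "x - proj x \<in> T" .
    then have "x \<in> T" using proj_in[of x] subspace_add[OF subspace_T] by fastforce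
    then show ?thesis using proj_id by simp
  qed
  have "inj ?h"
    unfolding linear_injective_0[OF \<open>linear ?h\<close>]
  proof (intro allI impI)
    fix x assume z: "?h x = 0"
    then have x: "x = proj x" using key subspace_0[OF subspace_T] by simp
    with z have "h (proj x) = 0" by simp
    with x ker[OF proj_in] show "x = 0" by metis
  qed
  then have "surj ?h" using linear_injective_imp_surjective[OF \<open>linear ?h\<close>] by blast
  from surjD[OF this, of y] obtain x where x: "y = ?h x" ..
  with y have "?h x \<in> T" by simp
  then have "x = proj x" by (rule key)
  then have "x \<in> T" "h x = y" using x proj_in[of x] by auto
  then show ?thesis by blast
qed

end

lemma orthonormal_basis_exists: "subspace T \<Longrightarrow> \<exists>B. orthonormal_basis T B"
  using orthonormal_basis_subspace[of T] unfolding orthonormal_basis_def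
  by (metis independent_imp_finite)

text \<open>\<open>a p\<close> is the Gram operator of the metric with respect to the Euclidean
  inner product. It is smooth and positive on an open set of the ambient space, so gradients are
  smooth fields on that open set although their values lie in \<open>T\<close>.\<close>

locale coercive_metric = orthonormal_basis +
  fixes S :: "'a set" and a :: "'a \<Rightarrow> 'a \<Rightarrow> 'a" and g :: "'a \<Rightarrow> 'a \<Rightarrow> 'a \<Rightarrow> real"
  assumes open_S: "open S" and a_linear: "\<And>p. p \<in> S \<Longrightarrow> linear (a p)"
    and a_pos: "\<And>p u. p \<in> S \<Longrightarrow> u \<noteq> 0 \<Longrightarrow> 0 < a p u \<bullet> u"
    and a_smooth: "\<And>x. smooth_on S (\<lambda>p. a p x)"
    and g_eq: "\<And>p u v. p \<in> S \<Longrightarrow> g p u v = a p u \<bullet> v"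
begin

text \<open>The equation for a gradient lives on \<open>T\<close>; adding the identity on the orthogonal complement
  turns it into an invertible system on the whole space, with a smooth matrix.\<close>

definition sys :: "'a \<Rightarrow> 'a \<Rightarrow> 'a" where "sys p x = proj (a p x) + (x - proj x)"

lemma tangent_eq_0: "p \<in> S \<Longrightarrow> x \<in> T \<Longrightarrow> (\<And>u. u \<in> T \<Longrightarrow> g p x u = 0) \<Longrightarrow> x = 0"
  using a_pos g_eq by fastforce

lemma sys_linear: "p \<in> S \<Longrightarrow> linear (sys p)"
  unfolding sys_def
  by (intro linear_compose_add linear_compose_sub linear_ident
      linear_compose[OF a_linear, unfolded o_def] bounded_linear.linear[OF proj_linear])

lemma proj_sys: "p \<in> S \<Longrightarrow> proj (sys p x) = proj (a p x)"
  unfolding sys_def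
  by (simp add: linear_add linear_diff bounded_linear.linear[OF proj_linear] proj_id proj_in)

lemma sys_in_T: "p \<in> S \<Longrightarrow> sys p x \<in> T \<Longrightarrow> x \<in> T"
proof -
  assume "p \<in> S" "sys p x \<in> T"
  then have "sys p x = proj (a p x)" using proj_sys proj_id by metis
  then have "x = proj x" by (simp add: sys_def)
  then show "x \<in> T" using proj_in by metis
qed

lemma sys_inj: assumes "p \<in> S" shows "inj (sys p)"
  unfolding linear_injective_0[OF sys_linear[OF assms]]
proof (intro allI impI)
  fix x assume z: "sys p x = 0"
  then have x: "x \<in> T" using sys_in_T[OF assms] subspace_0[OF subspace_T] by simp
  have "proj (a p x) = 0"
    using proj_sys[OF assms, of x] z by (simp add: linear_0 bounded_linear.linear[OF proj_linear])
  then have "g p x u = 0" if "u \<in> T" for u using proj_inner[OF that, of "a p x"] g_eq[OF assms] by simp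
  then show "x = 0" using tangent_eq_0[OF assms x] by blast
qed

lemma sys_smooth: "smooth_on S (\<lambda>p. sys p x)"
  unfolding sys_def smooth_on_def
  by (intro allI Ck_on_add Ck_on_const open_S Ck_on_linear[OF open_S _ proj_linear] smooth_on_Ck a_smooth)

context
  fixes f :: "'a \<Rightarrow> real"
  assumes f: "smooth_on S f"
begin

text \<open>\<open>riem_grad\<close> is a definite description. The solution of the extended system
  whose right-hand side is the projected Euclidean gradient lies in \<open>T\<close> and represents
  the differential there; positivity makes it the only such vector.\<close>

lemma riem_grad_sys:
  assumes p: "p \<in> S"
  shows "sys p (riem_grad T g f p) = proj (\<Sum>e\<in>Basis. frechet_derivative f (at p) e *\<^sub>R e)" (is "_ = proj ?d")
    and "riem_grad T g f p \<in> T"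
    and "\<And>u. u \<in> T \<Longrightarrow> g p (riem_grad T g f p) u = dird f p u"
proof -
  have lin: "linear (frechet_derivative f (at p))"
    using Ck_on_Suc_has_derivative[OF smooth_on_Ck[OF f] p] has_derivative_linear by blast
  have d: "?d \<bullet> u = dird f p u" for u
    unfolding smooth_on_dird[OF f p] linear_expand[OF lin, of u] inner_sum_left inner_scaleR_left
    by (simp add: inner_commute mult.commute)
  obtain x where x: "sys p x = proj ?d"
    using linear_injective_imp_surjective[OF sys_linear sys_inj, OF p p] by (metis surjD)
  have xT: "x \<in> T" using sys_in_T[OF p] x proj_in by metis
  have eq: "g p x u = dird f p u" if "u \<in> T" for u
  proof -
    have "g p x u = proj (sys p x) \<bullet> u" using g_eq[OF p] proj_sys[OF p] proj_inner[OF that] by simp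
    also have "\<dots> = dird f p u" unfolding x using d proj_inner[OF that] proj_id[OF proj_in] by simp
    finally show ?thesis .
  qed
  have "riem_grad T g f p = x"
    unfolding riem_grad_def
  proof (rule the_equality)
    fix y assume y: "y \<in> T \<and> (\<forall>u\<in>T. g p y u = dird f p u)"
    have "g p (y - x) u = 0" if "u \<in> T" for u
      using y eq that by (simp add: g_eq[OF p] linear_diff[OF a_linear[OF p]] inner_diff_left)
    then show "y = x"
      using tangent_eq_0[OF p, of "y - x"] subspace_diff[OF subspace_T] y xT by auto
  qed (use xT eq in blast)
  then show "sys p (riem_grad T g f p) = proj ?d" "riem_grad T g f p \<in> T"
    "\<And>u. u \<in> T \<Longrightarrow> g p (riem_grad T g f p) u = dird f p u" using x xT eq by auto
qed

lemma riem_grad_smooth: "smooth_on S (riem_grad T g f)"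
  unfolding smooth_on_def
proof
  fix k
  have "Ck_on k (\<lambda>p. frechet_derivative f (at p) e) S" for e
    using smooth_on_Ck[OF f, of "Suc k"] by simp
  then have rhs: "Ck_on k (\<lambda>p. proj (\<Sum>e\<in>Basis. frechet_derivative f (at p) e *\<^sub>R e)) S"
    by (intro Ck_on_linear[OF open_S _ proj_linear] Ck_on_sum open_S
        Ck_on_bilinear[OF open_S bounded_bilinear_scaleR] Ck_on_const)
  show "Ck_on k (riem_grad T g f) S"
  proof (rule Ck_on_linear_system[where A = sys and F = "riem_grad T g f"])
    show "Ck_on k (\<lambda>p. sys p x) S" for x by (rule smooth_on_Ck[OF sys_smooth])
  qed (use rhs in \<open>simp_all add: open_S sys_linear sys_inj riem_grad_sys(1)\<close>)
qed

text \<open>The gradient field is fixed by \<open>proj\<close> on the open set \<open>S\<close>;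
  differentiating this identity shows that its derivatives are tangent in every direction, including
  those that leave the constraint set.\<close>

lemma riem_grad_deriv_in: "p \<in> S \<Longrightarrow> frechet_derivative (riem_grad T g f) (at p) u \<in> T"
proof -
  assume p: "p \<in> S"
  let ?w = "riem_grad T g f" and ?w' = "frechet_derivative (riem_grad T g f) (at p)"
  have w: "(?w has_derivative ?w') (at p)"
    using Ck_on_Suc_has_derivative[OF smooth_on_Ck[OF riem_grad_smooth] p] .
  have "((\<lambda>q. proj (?w q)) has_derivative (\<lambda>v. proj (?w' v))) (at p)"
    by (rule bounded_linear.has_derivative[OF proj_linear w])
  then have "(?w has_derivative (\<lambda>v. proj (?w' v))) (at p)"
    by (rule has_derivative_transform_within_open[OF _ open_S p]) (simp add: proj_id riem_grad_sys(2))
  then have "?w' = (\<lambda>v. proj (?w' v))" using has_derivative_unique[OF w] by blast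
  then have "?w' u = proj (?w' u)" by (rule fun_cong)
  then show ?thesis using proj_in[of "?w' u"] by simp
qed

text \<open>The projection has nothing left to do, because the derivative of the gradient field is
  already tangent.\<close>

lemma eucl_hess_eq:
  assumes p: "p \<in> S"
  shows "eucl_hess T g f p u = frechet_derivative (riem_grad T g f) (at p) u"
  unfolding eucl_hess_def tangent_proj_def smooth_on_dird[OF riem_grad_smooth p]
proof (rule the_equality)
  let ?x = "frechet_derivative (riem_grad T g f) (at p) u"
  show "?x \<in> T \<and> (\<forall>v\<in>T. g p (?x - ?x) v = 0)"
    using riem_grad_deriv_in[OF p] by (simp add: g_eq[OF p] linear_0[OF a_linear[OF p]])
  fix y assume "y \<in> T \<and> (\<forall>v\<in>T. g p (?x - y) v = 0)"
  then show "y = ?x"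
    using tangent_eq_0[OF p, of "?x - y"] subspace_diff[OF subspace_T riem_grad_deriv_in[OF p]] by auto
qed

end

end

section \<open>Affine connections in a constant frame\<close>

lemma smooth_relI:
  assumes "open U" "M \<subseteq> U" "smooth_on U F" "\<And>x. x \<in> M \<Longrightarrow> F x = f x"
  shows "smooth_rel M f"
  unfolding smooth_rel_def using assms by (intro ballI exI[of _ U] exI[of _ F]) auto

lemma smooth_on_const: "open U \<Longrightarrow> smooth_on U (\<lambda>x. c)"
  by (simp add: smooth_on_def Ck_on_const)

lemma smooth_rel_add:
  fixes f g :: "'a::euclidean_space \<Rightarrow> 'b::real_normed_vector"
  assumes "smooth_rel M f" "smooth_rel M g" shows "smooth_rel M (\<lambda>x. f x + g x)"
  unfolding smooth_rel_def
proof
  fix x assume x: "x \<in> M"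
  obtain U F where U: "open U" "x \<in> U" "smooth_on U F" "\<forall>y\<in>M \<inter> U. F y = f y"
    using assms(1) x unfolding smooth_rel_def by blast
  obtain V G where V: "open V" "x \<in> V" "smooth_on V G" "\<forall>y\<in>M \<inter> V. G y = g y"
    using assms(2) x unfolding smooth_rel_def by blast
  have sub: "Ck_on k h W' \<Longrightarrow> W \<subseteq> W' \<Longrightarrow> Ck_on k h W" for k W W' and h :: "'a \<Rightarrow> 'b"
    by (induction k arbitrary: h) (auto intro: continuous_on_subset)
  have "smooth_on (U \<inter> V) (\<lambda>x. F x + G x)"
    using U V unfolding smooth_on_def
    by (intro allI Ck_on_add open_Int) (blast intro: sub)+
  then show "\<exists>U F. open U \<and> x \<in> U \<and> smooth_on U F \<and> (\<forall>y\<in>M \<inter> U. F y = f y + g y)"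
    using U V by (intro exI[of _ "U \<inter> V"] exI[of _ "\<lambda>x. F x + G x"]) auto
qed

lemma smooth_rel_scaleR_const:
  fixes \<phi> :: "'a::euclidean_space \<Rightarrow> real" and b :: "'b::real_normed_vector"
  assumes "smooth_rel M \<phi>" shows "smooth_rel M (\<lambda>x. \<phi> x *\<^sub>R b)"
  unfolding smooth_rel_def
proof
  fix x assume x: "x \<in> M"
  then obtain U F where U: "open U" "x \<in> U" "smooth_on U F" "\<forall>y\<in>M \<inter> U. F y = \<phi> y"
    using assms unfolding smooth_rel_def by blast
  have "smooth_on U (\<lambda>x. F x *\<^sub>R b)"
    using U(1,3) unfolding smooth_on_def
    by (intro allI Ck_on_linear[OF U(1) _ bounded_linear_scaleR_left]) blast
  then show "\<exists>U F. open U \<and> x \<in> U \<and> smooth_on U F \<and> (\<forall>y\<in>M \<inter> U. F y = \<phi> y *\<^sub>R b)"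
    using U by (intro exI[of _ U] exI[of _ "\<lambda>x. F x *\<^sub>R b"]) auto
qed

locale connection_on = orthonormal_basis +
  fixes M :: "'a set" and D
  assumes conn: "affine_connection M T D"
begin

lemma conn_field: "vector_field M T X \<Longrightarrow> vector_field M T Y \<Longrightarrow> vector_field M T (\<lambda>p. D Y p (X p))"
  using conn unfolding affine_connection_def by blast

lemma conn_lin:
  "vector_field M T Y \<Longrightarrow> p \<in> M \<Longrightarrow> u \<in> T \<Longrightarrow> v \<in> T \<Longrightarrow>
    D Y p (a *\<^sub>R u + b *\<^sub>R v) = a *\<^sub>R D Y p u + b *\<^sub>R D Y p v"
  using conn unfolding affine_connection_def by blast

lemma conn_add:
  "vector_field M T Y \<Longrightarrow> vector_field M T Z \<Longrightarrow> p \<in> M \<Longrightarrow> u \<in> T \<Longrightarrow>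
    D (\<lambda>q. Y q + Z q) p u = D Y p u + D Z p u"
  using conn unfolding affine_connection_def by blast

lemma conn_leibniz:
  "smooth_rel M \<phi> \<Longrightarrow> vector_field M T Y \<Longrightarrow> p \<in> M \<Longrightarrow> u \<in> T \<Longrightarrow>
    D (\<lambda>q. \<phi> q *\<^sub>R Y q) p u = dird \<phi> p u *\<^sub>R Y p + \<phi> p *\<^sub>R D Y p u"
  using conn unfolding affine_connection_def by blast

lemma vector_field_const: "b \<in> T \<Longrightarrow> vector_field M T (\<lambda>_. b)"
  by (auto simp: vector_field_def intro: smooth_relI[of UNIV] smooth_on_const)

text \<open>A field vanishing on \<open>M\<close> is its own multiple by a function that also vanishes on \<open>M\<close>, so
  the Leibniz rule kills its covariant derivative.\<close>

lemma conn_vanishing: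
  assumes Z: "\<And>q. q \<in> M \<Longrightarrow> Z q = 0" and p: "p \<in> M" "u \<in> T"
  shows "vector_field M T Z" "D Z p u = 0"
proof -
  show vZ: "vector_field M T Z"
    using Z subspace_0[OF subspace_T]
    by (auto simp: vector_field_def intro!: smooth_relI[of UNIV _ "\<lambda>_. 0"] smooth_on_const)
  define \<phi> :: "'a \<Rightarrow> real" where "\<phi> q = (if q \<in> M then 0 else 1)" for q
  have "smooth_rel M \<phi>"
    by (auto simp: \<phi>_def intro!: smooth_relI[of UNIV _ "\<lambda>_. 0"] smooth_on_const)
  moreover have "(\<lambda>q. \<phi> q *\<^sub>R Z q) = Z" using Z by (auto simp: \<phi>_def)
  ultimately show "D Z p u = 0" using conn_leibniz[OF _ vZ p, of \<phi>] Z p by (simp add: \<phi>_def)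
qed

text \<open>The binary axioms are iterated over a finite frame; the induction starts because the
  zero field has zero covariant derivative.\<close>

lemma conn_sum:
  assumes "finite C" "C \<subseteq> T" "\<And>b. b \<in> C \<Longrightarrow> smooth_rel M (\<phi> b)" and p: "p \<in> M" "u \<in> T"
  shows "vector_field M T (\<lambda>q. \<Sum>b\<in>C. \<phi> b q *\<^sub>R b) \<and>
    D (\<lambda>q. \<Sum>b\<in>C. \<phi> b q *\<^sub>R b) p u = (\<Sum>b\<in>C. dird (\<phi> b) p u *\<^sub>R b + \<phi> b p *\<^sub>R D (\<lambda>_. b) p u)"
  using assms(1-3)
proof (induction C rule: finite_induct)
  case empty
  then show ?case using conn_vanishing[of "\<lambda>_. 0", OF _ p] by simp
next
  case (insert b C)
  let ?s = "\<lambda>q. \<Sum>b\<in>C. \<phi> b q *\<^sub>R b"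
  have b: "b \<in> T" "smooth_rel M (\<phi> b)" using insert by auto
  have vb: "vector_field M T (\<lambda>q. \<phi> b q *\<^sub>R b)"
    using b smooth_rel_scaleR_const[OF b(2), of b] subspace_scale[OF subspace_T]
    by (simp add: vector_field_def)
  have IH: "vector_field M T ?s"
    "D ?s p u = (\<Sum>b\<in>C. dird (\<phi> b) p u *\<^sub>R b + \<phi> b p *\<^sub>R D (\<lambda>_. b) p u)"
    using insert by auto
  have "vector_field M T (\<lambda>q. \<phi> b q *\<^sub>R b + ?s q)"
    using vb IH(1) smooth_rel_add[of M "\<lambda>q. \<phi> b q *\<^sub>R b" ?s] subspace_add[OF subspace_T]
    by (simp add: vector_field_def)
  moreover have "D (\<lambda>q. \<phi> b q *\<^sub>R b + ?s q) p u = (dird (\<phi> b) p u *\<^sub>R b + \<phi> b p *\<^sub>R D (\<lambda>_. b) p u)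
      + (\<Sum>b\<in>C. dird (\<phi> b) p u *\<^sub>R b + \<phi> b p *\<^sub>R D (\<lambda>_. b) p u)"
    using conn_add[OF vb IH(1) p] conn_leibniz[OF b(2) vector_field_const[OF b(1)] p] IH(2) by simp
  ultimately show ?case using insert(1,2) by simp
qed

text \<open>The last sum is the Christoffel part in the constant frame \<open>B\<close>. The Leibniz
  rule is applied to the coefficients \<open>w q \<bullet> b\<close>, whose directional derivatives
  reassemble to \<open>w' u\<close> because that vector is tangent.\<close>

lemma conn_smooth_field:
  assumes S: "open S" "M \<subseteq> S" and w: "smooth_on S w" and wT: "\<And>q. q \<in> S \<Longrightarrow> w q \<in> T"
    and w': "(w has_derivative w') (at p)" and w'T: "w' u \<in> T" and p: "p \<in> M" "u \<in> T"
  shows "D w p u = w' u + (\<Sum>b\<in>B. (w p \<bullet> b) *\<^sub>R D (\<lambda>_. b) p u)"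
proof -
  define \<phi> where "\<phi> b q = w q \<bullet> b" for b q
  have "smooth_on S (\<phi> b)" for b
    unfolding smooth_on_def \<phi>_def
    by (intro allI Ck_on_linear[OF S(1) _ bounded_linear_inner_left] smooth_on_Ck w)
  then have \<phi>: "smooth_rel M (\<phi> b)" for b by (intro smooth_relI[OF S]) auto
  have sum: "vector_field M T (\<lambda>q. \<Sum>b\<in>B. \<phi> b q *\<^sub>R b)"
    "D (\<lambda>q. \<Sum>b\<in>B. \<phi> b q *\<^sub>R b) p u = (\<Sum>b\<in>B. dird (\<phi> b) p u *\<^sub>R b + \<phi> b p *\<^sub>R D (\<lambda>_. b) p u)"
    using conn_sum[where C = B and \<phi> = \<phi>, OF finite_B _ \<phi> p] B_in by blast+
  have Z: "w q - (\<Sum>b\<in>B. \<phi> b q *\<^sub>R b) = 0" if "q \<in> M" for q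
    using proj_id[OF wT] that S(2) by (auto simp: proj_def \<phi>_def)
  \<comment> \<open>\<open>w\<close> and its frame expansion may differ off \<open>S\<close>, so
    they need not be equal as arguments of \<open>D\<close>. Their difference vanishes on
    \<open>M\<close> and contributes nothing.\<close>
  have "D w p u = D (\<lambda>q. (\<Sum>b\<in>B. \<phi> b q *\<^sub>R b) + (w q - (\<Sum>b\<in>B. \<phi> b q *\<^sub>R b))) p u" by simp
  also have "\<dots> = D (\<lambda>q. \<Sum>b\<in>B. \<phi> b q *\<^sub>R b) p u + D (\<lambda>q. w q - (\<Sum>b\<in>B. \<phi> b q *\<^sub>R b)) p u"
    by (rule conn_add[OF sum(1) conn_vanishing(1) p]) (use Z p in auto)
  also have "D (\<lambda>q. w q - (\<Sum>b\<in>B. \<phi> b q *\<^sub>R b)) p u = 0"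
    by (rule conn_vanishing(2)[OF _ p]) (use Z in auto)
  finally have "D w p u = D (\<lambda>q. \<Sum>b\<in>B. \<phi> b q *\<^sub>R b) p u" by simp
  then have "D w p u = (\<Sum>b\<in>B. dird (\<phi> b) p u *\<^sub>R b) + (\<Sum>b\<in>B. \<phi> b p *\<^sub>R D (\<lambda>_. b) p u)"
    using sum(2) by (simp add: sum.distrib)
  moreover have "dird (\<phi> b) p u = w' u \<bullet> b" for b
    unfolding \<phi>_def by (rule dird_eq[OF has_derivative_inner_left[OF w']])
  ultimately show ?thesis using proj_id[OF w'T] by (simp add: proj_def \<phi>_def)
qed

text \<open>For a frame vector \<open>e\<close> the field
  \<open>\<lambda>p. D (\<lambda>_. b) p e\<close> is smooth by the connection axioms, hence near
  \<open>z\<close> the restriction of a continuous function. Finiteness of the frame and linearity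
  in \<open>u\<close> do the rest.\<close>

lemma conn_const_bounded:
  assumes z: "z \<in> M" and b: "b \<in> T"
  shows "\<exists>C. \<forall>\<^sub>F p in nhds z. p \<in> M \<longrightarrow> (\<forall>u\<in>T. norm (D (\<lambda>_. b) p u) \<le> C * norm u)"
proof -
  have "\<exists>C. \<forall>\<^sub>F p in nhds z. p \<in> M \<longrightarrow> norm (D (\<lambda>_. b) p e) \<le> C" if e: "e \<in> B" for e
  proof -
    have "vector_field M T (\<lambda>p. D (\<lambda>_. b) p e)"
      using conn_field[OF vector_field_const vector_field_const] B_in[OF e] b by blast
    then obtain U F where U: "open U" "z \<in> U" "smooth_on U F" "\<forall>y\<in>M \<inter> U. F y = D (\<lambda>_. b) y e"
      using z unfolding vector_field_def smooth_rel_def by blast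
    then have "isCont F z"
      using Ck_on_continuous[OF smooth_on_Ck[OF U(3)]] continuous_on_eq_continuous_at by blast
    then have "(F \<longlongrightarrow> F z) (nhds z)" by (simp add: isCont_def tendsto_at_iff_tendsto_nhds)
    then have "\<forall>\<^sub>F p in nhds z. norm (F p) < norm (F z) + 1"
      by (intro order_tendstoD(2)[OF tendsto_norm]) auto
    moreover have "\<forall>\<^sub>F p in nhds z. p \<in> U" using U(1,2) by (rule eventually_nhds_in_open)
    ultimately have "\<forall>\<^sub>F p in nhds z. p \<in> M \<longrightarrow> norm (D (\<lambda>_. b) p e) \<le> norm (F z) + 1"
      by eventually_elim (use U(4) in force)
    then show ?thesis by blast
  qed
  then obtain C where C: "\<And>e. e \<in> B \<Longrightarrow> \<forall>\<^sub>F p in nhds z. p \<in> M \<longrightarrow> norm (D (\<lambda>_. b) p e) \<le> C e"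
    by metis
  have "\<forall>\<^sub>F p in nhds z. \<forall>e\<in>B. p \<in> M \<longrightarrow> norm (D (\<lambda>_. b) p e) \<le> C e"
    by (intro eventually_ball_finite finite_B ballI C)
  then have "\<forall>\<^sub>F p in nhds z. p \<in> M \<longrightarrow> (\<forall>u\<in>T. norm (D (\<lambda>_. b) p u) \<le> (\<Sum>e\<in>B. C e) * norm u)"
  proof eventually_elim
    case (elim p)
    show ?case
    proof (intro impI ballI)
      fix u assume p: "p \<in> M" and u: "u \<in> T"
      note vb = vector_field_const[OF b]
      \<comment> \<open>Linearity in the direction is given for two vectors of \<open>T\<close> at a
        time, hence the induction over subsets of the frame.\<close>
      have "D (\<lambda>_. b) p (\<Sum>e\<in>E. (u \<bullet> e) *\<^sub>R e) = (\<Sum>e\<in>E. (u \<bullet> e) *\<^sub>R D (\<lambda>_. b) p e)" if "E \<subseteq> B" for E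
        using finite_subset[OF that finite_B] that
      proof (induction E rule: finite_induct)
        case empty
        then show ?case
          using conn_lin[OF vb p subspace_0 subspace_0, OF subspace_T subspace_T, of 0 0] by simp
      next
        case (insert e E)
        have "(\<Sum>e\<in>E. (u \<bullet> e) *\<^sub>R e) \<in> T"
          using insert B_in by (intro subspace_sum[OF subspace_T] subspace_scale[OF subspace_T]) auto
        then show ?case
          using insert conn_lin[OF vb p, of e "\<Sum>e\<in>E. (u \<bullet> e) *\<^sub>R e" "u \<bullet> e" 1] B_in[of e] by simp
      qed
      from this[of B] have "D (\<lambda>_. b) p u = (\<Sum>e\<in>B. (u \<bullet> e) *\<^sub>R D (\<lambda>_. b) p e)"
        using proj_id[OF u] by (simp add: proj_def)
      also have "norm \<dots> \<le> (\<Sum>e\<in>B. C e * norm u)"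
      proof (rule sum_norm_le)
        fix e assume e: "e \<in> B"
        have "\<bar>u \<bullet> e\<bar> \<le> norm u" using Cauchy_Schwarz_ineq2[of u e] unit[OF e] by simp
        moreover have "norm (D (\<lambda>_. b) p e) \<le> C e" using elim e p by blast
        ultimately have "\<bar>u \<bullet> e\<bar> * norm (D (\<lambda>_. b) p e) \<le> norm u * C e"
          by (intro mult_mono) auto
        then show "norm ((u \<bullet> e) *\<^sub>R D (\<lambda>_. b) p e) \<le> C e * norm u" by (simp add: mult.commute)
      qed
      finally show "norm (D (\<lambda>_. b) p u) \<le> (\<Sum>e\<in>B. C e) * norm u" by (simp add: sum_distrib_right)
    qed
  qed
  then show ?thesis by blast
qed

end

section \<open>Newton steps\<close>

lemma has_derivative_lipschitz_at:
  assumes "(f has_derivative f') (at z)"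
  shows "\<exists>C. \<forall>\<^sub>F p in nhds z. norm (f p - f z) \<le> C * norm (p - z)"
proof -
  have bl: "bounded_linear f'" using assms has_derivative_bounded_linear by blast
  obtain d where d: "d > 0" "\<And>y. norm (y - z) < d \<Longrightarrow> norm (f y - f z - f' (y - z)) \<le> 1 * norm (y - z)"
    using assms unfolding has_derivative_at_alt by (metis zero_less_one)
  have "\<forall>\<^sub>F p in nhds z. norm (p - z) < d"
    using d(1) unfolding eventually_nhds_metric by (auto simp: dist_norm)
  then have "\<forall>\<^sub>F p in nhds z. norm (f p - f z) \<le> (1 + onorm f') * norm (p - z)"
  proof eventually_elim
    case (elim p)
    have "norm (f p - f z) \<le> norm (f p - f z - f' (p - z)) + norm (f' (p - z))"
      by (metis norm_triangle_sub add.commute)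
    then show ?case using d(2)[OF elim] onorm[OF bl, of "p - z"] by (simp add: algebra_simps)
  qed
  then show ?thesis by blast
qed

text \<open>Each directional derivative is itself differentiable at \<open>z\<close>, which yields a
  Lipschitz bound centred at \<open>z\<close>; the finitely many basis directions are then
  summed.\<close>

lemma smooth_on_derivative_lipschitz_at:
  fixes w :: "'a::euclidean_space \<Rightarrow> 'b::real_normed_vector"
  assumes S: "open S" "z \<in> S" and w: "smooth_on S w"
  shows "\<exists>C\<ge>0. \<forall>\<^sub>F p in nhds z. \<forall>u.
    norm (frechet_derivative w (at p) u - frechet_derivative w (at z) u) \<le> C * norm (p - z) * norm u"
proof -
  let ?w' = "\<lambda>p. frechet_derivative w (at p)"
  have "\<exists>C. \<forall>\<^sub>F p in nhds z. norm (?w' p e - ?w' z e) \<le> C * norm (p - z)" for e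
  proof -
    have "Ck_on (Suc 0) (\<lambda>p. ?w' p e) S" using smooth_on_Ck[OF w, of "Suc (Suc 0)"] by simp
    then show ?thesis using Ck_on_Suc_has_derivative[OF _ S(2)] has_derivative_lipschitz_at by blast
  qed
  then obtain C where C: "\<And>e. \<forall>\<^sub>F p in nhds z. norm (?w' p e - ?w' z e) \<le> C e * norm (p - z)"
    by metis
  have "\<forall>\<^sub>F p in nhds z. p \<in> S" using S by (rule eventually_nhds_in_open)
  moreover have "\<forall>\<^sub>F p in nhds z. \<forall>e\<in>Basis. norm (?w' p e - ?w' z e) \<le> C e * norm (p - z)"
    by (intro eventually_ball_finite finite_Basis ballI C)
  ultimately have "\<forall>\<^sub>F p in nhds z. \<forall>u.
      norm (?w' p u - ?w' z u) \<le> (\<Sum>e\<in>Basis. \<bar>C e\<bar>) * norm (p - z) * norm u"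
  proof eventually_elim
    case (elim p)
    show ?case
    proof
      fix u
      have lin: "linear (?w' q)" if "q \<in> S" for q
        using Ck_on_Suc_has_derivative[OF smooth_on_Ck[OF w] that] has_derivative_linear by blast
      have "?w' p u - ?w' z u = (\<Sum>e\<in>Basis. (u \<bullet> e) *\<^sub>R (?w' p e - ?w' z e))"
        by (simp add: linear_expand[OF lin[OF elim(1)], of u] linear_expand[OF lin[OF S(2)], of u]
            scaleR_diff_right sum_subtractf)
      also have "norm \<dots> \<le> (\<Sum>e\<in>Basis. norm u * (\<bar>C e\<bar> * norm (p - z)))"
      proof (rule sum_norm_le)
        fix e :: 'a assume e: "e \<in> Basis"
        have "norm (?w' p e - ?w' z e) \<le> \<bar>C e\<bar> * norm (p - z)"
          using elim(2) e by (meson abs_ge_self mult_right_mono norm_ge_zero order_trans)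
        then show "norm ((u \<bullet> e) *\<^sub>R (?w' p e - ?w' z e)) \<le> norm u * (\<bar>C e\<bar> * norm (p - z))"
          using Basis_le_norm[OF e, of u] by (simp add: mult_mono)
      qed
      finally show "norm (?w' p u - ?w' z u) \<le> (\<Sum>e\<in>Basis. \<bar>C e\<bar>) * norm (p - z) * norm u"
        by (simp add: sum_distrib_left[symmetric] sum_distrib_right[symmetric] ac_simps)
    qed
  qed
  then show ?thesis by (intro exI[of _ "\<Sum>e\<in>Basis. \<bar>C e\<bar>"] conjI sum_nonneg) auto
qed

text \<open>The mean value inequality is applied to \<open>w\<close> minus its linear part at
  \<open>z\<close>, whose derivative is at most \<open>C * norm (p - z)\<close> on the ball of
  radius \<open>norm (p - z)\<close>.\<close>

lemma smooth_on_second_order: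
  fixes w :: "'a::euclidean_space \<Rightarrow> 'b::real_normed_vector"
  assumes S: "open S" "z \<in> S" and w: "smooth_on S w"
  shows "\<exists>C\<ge>0. \<forall>\<^sub>F p in nhds z.
    norm (w p - w z - frechet_derivative w (at z) (p - z)) \<le> C * (norm (p - z))\<^sup>2"
proof -
  let ?w' = "\<lambda>p. frechet_derivative w (at p)"
  have w': "(w has_derivative ?w' q) (at q)" if "q \<in> S" for q
    using Ck_on_Suc_has_derivative[OF smooth_on_Ck[OF w] that] .
  obtain C where C: "C \<ge> 0" "\<forall>\<^sub>F p in nhds z. \<forall>u. norm (?w' p u - ?w' z u) \<le> C * norm (p - z) * norm u"
    using smooth_on_derivative_lipschitz_at[OF S w] by blast
  have "\<forall>\<^sub>F p in nhds z. p \<in> S" using S by (rule eventually_nhds_in_open)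
  with C(2) have "\<forall>\<^sub>F p in nhds z. p \<in> S \<and> (\<forall>u. norm (?w' p u - ?w' z u) \<le> C * norm (p - z) * norm u)"
    by eventually_elim auto
  then obtain d where d: "d > 0"
    "\<And>q. dist q z < d \<Longrightarrow> q \<in> S \<and> (\<forall>u. norm (?w' q u - ?w' z u) \<le> C * norm (q - z) * norm u)"
    unfolding eventually_nhds_metric by blast
  have "norm (w p - w z - ?w' z (p - z)) \<le> C * (norm (p - z))\<^sup>2" if p: "dist p z < d" for p
  proof -
    have "norm ((w p - ?w' z p) - (w z - ?w' z z)) \<le> (C * norm (p - z)) * norm (p - z)"
    proof (rule differentiable_bound[where S = "cball z (norm (p - z))" and f' = "\<lambda>q u. ?w' q u - ?w' z u"])
      fix q assume "q \<in> cball z (norm (p - z))"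
      then have q: "norm (q - z) \<le> norm (p - z)" by (simp add: dist_norm norm_minus_commute)
      then have qd: "dist q z < d" using p by (simp add: dist_norm)
      show "((\<lambda>q. w q - ?w' z q) has_derivative (\<lambda>u. ?w' q u - ?w' z u)) (at q within cball z (norm (p - z)))"
        using d(2)[OF qd]
        by (intro has_derivative_diff has_derivative_at_withinI[OF w']
            bounded_linear.has_derivative[OF has_derivative_bounded_linear[OF w'[OF S(2)]]] has_derivative_ident) auto
      show "onorm (\<lambda>u. ?w' q u - ?w' z u) \<le> C * norm (p - z)"
      proof (rule onorm_le)
        fix u :: 'a
        have "C * norm (q - z) * norm u \<le> C * norm (p - z) * norm u"
          using C(1) q by (intro mult_right_mono mult_left_mono) auto
        then show "norm (?w' q u - ?w' z u) \<le> C * norm (p - z) * norm u"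
          using d(2)[OF qd] order_trans by blast
      qed
    qed (auto simp: dist_norm norm_minus_commute)
    then show ?thesis
      using linear_diff[OF has_derivative_linear[OF w'[OF S(2)]], of p z]
      by (simp add: power2_eq_square diff_diff_eq2 diff_diff_eq add.commute add_diff_eq diff_add_eq)
  qed
  then show ?thesis
    using C(1) d(1) unfolding eventually_nhds_metric by (intro exI[of _ C]) blast
qed

text \<open>The error identity is \<open>H p ((p - z) + G) = (H p (p - z) - W (p - z)) - (w p - W (p
  - z))\<close>. Both differences are quadratic in \<open>p - z\<close>, and \<open>H p\<close> is
  bounded below on \<open>T\<close> as a small perturbation of \<open>W\<close>.\<close>

lemma (in orthonormal_basis) newton_step_quadratic:
  fixes w :: "'a \<Rightarrow> 'a" and H :: "'a \<Rightarrow> 'a \<Rightarrow> 'a"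
  assumes W: "bounded_linear W" and W_inj: "\<And>u. u \<in> T \<Longrightarrow> W u = 0 \<Longrightarrow> u = 0"
    and w: "\<forall>\<^sub>F p in nhds z. norm (w p - W (p - z)) \<le> C1 * (norm (p - z))\<^sup>2"
    and HW: "\<forall>\<^sub>F p in nhds z. p \<in> M \<longrightarrow> (\<forall>u\<in>T. norm (H p u - W u) \<le> C2 * norm (p - z) * norm u)"
    and H_add: "\<And>p u v. p \<in> M \<Longrightarrow> u \<in> T \<Longrightarrow> v \<in> T \<Longrightarrow> H p (u + v) = H p u + H p v"
    and H_scale: "\<And>p c u. p \<in> M \<Longrightarrow> u \<in> T \<Longrightarrow> H p (c *\<^sub>R u) = c *\<^sub>R H p u"
    and H_in: "\<And>p u. p \<in> M \<Longrightarrow> u \<in> T \<Longrightarrow> H p u \<in> T"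
    and w_in: "\<And>p. p \<in> M \<Longrightarrow> w p \<in> T" and M: "\<And>p. p \<in> M \<Longrightarrow> p - z \<in> T"
    and C: "C1 \<ge> 0" "C2 \<ge> 0"
  shows "\<exists>C>0. \<forall>\<^sub>F p in nhds z. p \<in> M \<longrightarrow> (\<exists>!G. newton_direction T w H p G) \<and>
    (\<forall>G. newton_direction T w H p G \<longrightarrow> norm (p + G - z) \<le> C * (norm (p - z))\<^sup>2)"
proof -
  obtain c where c: "c > 0" "\<And>u. u \<in> T \<Longrightarrow> c * norm u \<le> norm (W u)"
    using injective_imp_isometric[OF closed_subspace[OF subspace_T] subspace_T W] W_inj by blast
  \<comment> \<open>The factor \<open>2 / c\<close> inverts the lower bound \<open>c / 2\<close> of
    \<open>H p\<close>; the summand \<open>1\<close> keeps \<open>C\<close> positive when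
    \<open>C1\<close> and \<open>C2\<close> vanish.\<close>
  define C where "C = 2 * (C1 + C2) / c + 1"
  have "\<forall>\<^sub>F p in nhds z. C2 * norm (p - z) < c / 2"
  proof (rule order_tendstoD(2))
    show "((\<lambda>p. C2 * norm (p - z)) \<longlongrightarrow> C2 * norm (z - z)) (nhds z)"
      by (intro tendsto_intros filterlim_ident)
  qed (use c in simp)
  with w HW have "\<forall>\<^sub>F p in nhds z. p \<in> M \<longrightarrow> (\<exists>!G. newton_direction T w H p G) \<and>
    (\<forall>G. newton_direction T w H p G \<longrightarrow> norm (p + G - z) \<le> C * (norm (p - z))\<^sup>2)"
  proof eventually_elim
    case (elim p)
    show ?case
    proof
      assume p: "p \<in> M"
      have HW': "norm (H p u - W u) \<le> C2 * norm (p - z) * norm u" if "u \<in> T" for u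
        using elim(2) p that by blast
      have low: "(c / 2) * norm u \<le> norm (H p u)" if u: "u \<in> T" for u
      proof -
        have "norm (H p u - W u) \<le> (c / 2) * norm u"
          using HW'[OF u] mult_right_mono[OF less_imp_le[OF elim(3)] norm_ge_zero[of u]] by linarith
        moreover have "norm (W u) \<le> norm (H p u) + norm (H p u - W u)"
          by (metis norm_minus_commute norm_triangle_sub)
        ultimately show ?thesis using c(2)[OF u] by (simp add: field_simps)
      qed
      have ker: "u = 0" if "u \<in> T" "H p u = 0" for u using low[OF that(1)] that(2) c(1)
        by (simp add: mult_le_0_iff)
      have H_diff: "H p (u - v) = H p u - H p v" if "u \<in> T" "v \<in> T" for u v
        using H_add[OF p that(1), of "(- 1) *\<^sub>R v"] H_scale[OF p that(2), of "- 1"]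
          subspace_scale[OF subspace_T that(2), of "- 1"] by simp
      have wT: "- w p \<in> T" using w_in[OF p] subspace_neg[OF subspace_T] by blast
      have "\<exists>G\<in>T. H p G = - w p"
        by (rule linear_on_surj[OF H_add[OF p] H_scale[OF p] H_in[OF p] ker wT])
      moreover have "G = G'" if "newton_direction T w H p G" "newton_direction T w H p G'" for G G'
        using ker[of "G - G'"] H_diff[of G G'] that subspace_diff[OF subspace_T]
        by (auto simp: newton_direction_def)
      ultimately have "\<exists>!G. newton_direction T w H p G" by (auto simp: newton_direction_def)
      moreover have "norm (p + G - z) \<le> C * (norm (p - z))\<^sup>2" if G: "newton_direction T w H p G" for G
      proof -
        have GT: "G \<in> T" "H p G = - w p" using G by (auto simp: newton_direction_def)
        have e: "(p - z) + G \<in> T" using M[OF p] GT subspace_add[OF subspace_T] by blast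
        have "(c / 2) * norm ((p - z) + G) \<le> norm (H p ((p - z) + G))" by (rule low[OF e])
        also have "H p ((p - z) + G) = (H p (p - z) - W (p - z)) - (w p - W (p - z))"
          using H_add[OF p M[OF p] GT(1)] GT(2) by simp
        also have "norm \<dots> \<le> C2 * norm (p - z) * norm (p - z) + C1 * (norm (p - z))\<^sup>2"
          using norm_triangle_ineq4 HW'[OF M[OF p]] elim(1) add_mono order_trans by blast
        also have "\<dots> = (C1 + C2) * (norm (p - z))\<^sup>2" by (simp add: power2_eq_square algebra_simps)
        finally have "norm ((p - z) + G) \<le> (2 * (C1 + C2) / c) * (norm (p - z))\<^sup>2"
          using c(1) by (simp add: field_simps)
        also have "\<dots> \<le> C * (norm (p - z))\<^sup>2" unfolding C_def by (intro mult_right_mono) auto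
        finally show ?thesis by (simp add: algebra_simps)
      qed
      ultimately show "(\<exists>!G. newton_direction T w H p G) \<and>
        (\<forall>G. newton_direction T w H p G \<longrightarrow> norm (p + G - z) \<le> C * (norm (p - z))\<^sup>2)" by blast
    qed
  qed
  moreover have "C > 0" unfolding C_def using c(1) C
    by (intro add_nonneg_pos divide_nonneg_pos) auto
  ultimately show ?thesis by blast
qed

section \<open>Spectral radius and powers of a matrix\<close>

abbreviation cmat :: "real^'n^'m \<Rightarrow> complex^'n^'m" where
  "cmat M \<equiv> \<chi> i j. complex_of_real (M $ i $ j)"

text \<open>The vector \<open>p(M) v\<close> by Horner's scheme on the coefficients: the polynomial
  acts on vectors, and the matrix \<open>p(M)\<close> is never formed.\<close>

definition peval :: "complex^'n^'n \<Rightarrow> complex poly \<Rightarrow> complex^'n \<Rightarrow> complex^'n" where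
  "peval M p v = fold_coeffs (\<lambda>a x. a *s v + M *v x) p 0"

lemma matrix_vector_mult_vec: "M *v (c *s v) = c *s (M *v v)" for c :: "'a::comm_semiring_1"
  by (simp add: matrix_vector_mult_def vec_eq_iff sum_distrib_left ac_simps)

lemma peval_0 [simp]: "peval M 0 v = 0"
  by (simp add: peval_def)

lemma peval_pCons [simp]: "peval M (pCons a p) v = a *s v + M *v peval M p v"
proof (cases "p = 0")
  case True
  then show ?thesis by (cases "a = 0") (simp_all add: peval_def)
qed (simp add: peval_def)

lemma peval_add: "peval M (p + q) v = peval M p v + peval M q v"
proof (induction p arbitrary: q)
  case (pCons a p)
  then show ?case
    by (cases q) (simp add: vector_sadd_rdistrib matrix_vector_right_distrib)
qed simp

lemma peval_smult: "peval M (smult c p) v = c *s peval M p v"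
  by (induction p) (simp_all add: vector_add_ldistrib matrix_vector_mult_vec vector_smult_assoc)

lemma peval_linear_factor: "peval M ([:- c, 1:] * q) v = M *v peval M q v - c *s peval M q v"
proof -
  have "[:- c, 1:] * q = pCons 0 q + smult (- c) q" by simp
  then show ?thesis by (simp only: peval_add peval_smult peval_pCons) simp
qed

lemma peval_vec_add: "peval M p (u + v) = peval M p u + peval M p v"
  by (induction p) (simp_all add: vector_add_ldistrib matrix_vector_right_distrib)

lemma peval_vec_scale: "peval M p (c *s v) = c *s peval M p v"
  by (induction p) (simp_all add: vector_add_ldistrib matrix_vector_mult_vec vector_smult_assoc mult.commute)

lemma peval_commute: "peval M p (M *v v) = M *v peval M p v"
  by (induction p) (simp_all add: matrix_vector_right_distrib matrix_vector_mult_vec)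

lemma peval_eigenvector: "M *v v = c *s v \<Longrightarrow> peval M p v = poly p c *s v"
  by (induction p) (simp_all add: matrix_vector_mult_vec vector_smult_assoc vector_sadd_rdistrib mult.commute)

lemma dim_image_lessThan:
  fixes x :: "nat \<Rightarrow> 'a::euclidean_space"
  assumes "\<And>n. x n \<notin> span (x ` {..<n})"
  shows "dim (x ` {..<n}) = n"
  by (induction n) (simp_all add: lessThan_Suc dim_insert assms)

lemma peval_monom: "((\<lambda>X. M ** X) ^^ i) (mat 1) *v v = peval M (monom 1 i) v"
  by (induction i) (simp_all add: monom_Suc matrix_vector_mul_assoc[symmetric] monom_0)

text \<open>The span is over the reals, complex matrices being treated as a real Euclidean space;
  its coefficients become complex ones in \<open>p\<close>. The vanishing of
  \<open>coeff p i\<close> for \<open>i \<ge> n\<close> ensures that a leading term of degree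
  \<open>n\<close> cannot cancel against \<open>p\<close>.\<close>

lemma span_powers_peval:
  fixes M :: "complex^'n^'n"
  assumes "y \<in> span ((\<lambda>i. ((\<lambda>X. M ** X) ^^ i) (mat 1)) ` {..<n})"
  shows "\<exists>p. (\<forall>i\<ge>n. coeff p i = 0) \<and> (\<forall>v. y *v v = peval M p v)"
  using assms
proof (induction rule: span_induct_alt)
  case base
  then show ?case by (intro exI[of _ 0]) simp
next
  case (step c x y)
  then obtain i p where i: "i < n" "x = ((\<lambda>X. M ** X) ^^ i) (mat 1)"
    and p: "\<forall>i\<ge>n. coeff p i = 0" "\<forall>v. y *v v = peval M p v" by auto
  have "(c *\<^sub>R x + y) *v v = peval M (smult (of_real c) (monom 1 i) + p) v" for v
  proof -
    have "(c *\<^sub>R x) *v v = complex_of_real c *s (x *v v)"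
      by (simp add: matrix_vector_mult_def vec_eq_iff sum_distrib_left scaleR_conv_of_real[where 'a = complex] ac_simps)
    then show ?thesis
      by (simp add: peval_add peval_smult peval_monom[symmetric] i(2) p(2)[rule_format, symmetric]
          matrix_vector_mult_add_rdistrib)
  qed
  moreover have "\<forall>j\<ge>n. coeff (smult (of_real c) (monom 1 i) + p) j = 0"
    using p(1) i(1) by simp
  ultimately show ?case by blast
qed

text \<open>The powers of \<open>M\<close> live in a finite-dimensional space, so some power depends
  linearly on the earlier ones; this relation is a polynomial with leading coefficient 1.\<close>

lemma annihilating_poly_exists:
  fixes M :: "complex^'n^'n"
  shows "\<exists>p. p \<noteq> 0 \<and> (\<forall>v. peval M p v = 0)"
proof -
  define x where "x i = ((\<lambda>X. M ** X) ^^ i) (mat 1)" for i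
  have xe: "x i *v v = peval M (monom 1 i) v" for v i
    unfolding x_def by (rule peval_monom)
  obtain n where "x n \<in> span (x ` {..<n})"
    using dim_image_lessThan[of x "Suc DIM(complex^'n^'n)"] dim_subset_UNIV[of "x ` {..<Suc DIM(complex^'n^'n)}"]
    by fastforce
  then obtain p where p: "\<forall>i\<ge>n. coeff p i = 0" "\<forall>v. x n *v v = peval M p v"
    using span_powers_peval[of "x n" M n] unfolding x_def by auto
  have "peval M (monom 1 n + smult (- 1) p) v = 0" for v
    by (simp add: peval_add peval_smult xe[symmetric] p(2)[rule_format, symmetric] del: smult_minus_left)
  moreover have "coeff (monom 1 n + smult (- 1) p) n = 1" using p(1) by simp
  then have "monom 1 n + smult (- 1) p \<noteq> 0" by (metis coeff_0 zero_neq_one)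
  ultimately show ?thesis by blast
qed

text \<open>Every eigenvalue is a root of an annihilating polynomial. Together with nonemptiness
  this makes the \<open>Max\<close> in \<open>spec_radius\<close> a genuine maximum.\<close>

lemma finite_eigvals_complex: "finite (eigvals (M :: complex^'n^'n))"
proof -
  obtain p where p: "p \<noteq> 0" "\<forall>v. peval M p v = 0" using annihilating_poly_exists by blast
  have "eigvals M \<subseteq> {c. poly p c = 0}"
  proof
    fix c assume "c \<in> eigvals M"
    then obtain v where "v \<noteq> 0" "M *v v = c *s v" by (auto simp: eigvals_def)
    then show "c \<in> {c. poly p c = 0}" using p(2) peval_eigenvector[of M v c p] by (auto simp: vector_mul_eq_0)
  qed
  then show ?thesis using poly_roots_finite[OF p(1)] finite_subset by blast
qed

lemma poly_root_factor:
  fixes p :: "complex poly"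
  assumes "degree p > 0"
  obtains c q where "p = [:- c, 1:] * q" "degree p = Suc (degree q)" "q \<noteq> 0"
proof -
  obtain c where "poly p c = 0"
    using fundamental_theorem_of_algebra[of p] assms constant_degree[of p] by auto
  then obtain q where q: "p = [:- c, 1:] * q" by (auto simp: poly_eq_0_iff_dvd)
  then have "q \<noteq> 0" using assms by auto
  then show ?thesis using q that[of c q] degree_mult_eq[of "[:- c, 1:]" q] by simp
qed

text \<open>Linear factors are peeled off until the vector \<open>q(M) v\<close> left by the
  remaining factor \<open>q\<close> is nonzero while \<open>M - c\<close> kills it; that vector is
  an eigenvector.\<close>

lemma eigvals_of_annihilated:
  assumes "p \<noteq> 0" "peval M p v = 0" "v \<noteq> 0"
  shows "eigvals M \<noteq> {}"
  using assms
proof (induction "degree p" arbitrary: p)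
  case 0
  then obtain a where "p = [:a:]" using degree_eq_zeroE by metis
  with 0 show ?case by (simp add: vector_mul_eq_0)
next
  case (Suc d)
  then obtain c q where q: "p = [:- c, 1:] * q" "degree p = Suc (degree q)" "q \<noteq> 0"
    using poly_root_factor[of p] Suc(2) by (metis zero_less_Suc)
  show ?case
  proof (cases "peval M q v = 0")
    case True
    with Suc q show ?thesis by auto
  next
    case False
    have "M *v peval M q v = c *s peval M q v"
      using Suc.prems(2) unfolding q(1) peval_linear_factor by simp
    with False show ?thesis by (auto simp: eigvals_def)
  qed
qed

lemma eigvals_complex_nonempty: "eigvals (M :: complex^'n^'n) \<noteq> {}"
  using annihilating_poly_exists[of M] eigvals_of_annihilated[of _ M "1"] by (metis one_neq_zero)

lemma contraction_recursion_tendsto_0: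
  fixes x y :: "nat \<Rightarrow> real"
  assumes rec: "\<And>k. x (Suc k) \<le> r * x k + y k" and y: "y \<longlonglongrightarrow> 0"
    and r: "0 \<le> r" "r < 1" and nonneg: "\<And>k. 0 \<le> x k"
  shows "x \<longlonglongrightarrow> 0"
proof (rule LIMSEQ_I)
  fix e :: real assume e: "e > 0"
  \<comment> \<open>The threshold makes \<open>e / 2\<close> the fixed point of
    \<open>x \<mapsto> r x + (e / 2) (1 - r)\<close>, so that only the geometric part
    \<open>r ^ k * x N\<close> remains above it.\<close>
  then have "\<forall>\<^sub>F k in sequentially. y k < (e / 2) * (1 - r)"
    using r by (intro order_tendstoD(2)[OF y]) simp
  then obtain N where N: "\<And>k. k \<ge> N \<Longrightarrow> y k < (e / 2) * (1 - r)"
    by (auto simp: eventually_sequentially)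
  have bd: "x (N + k) \<le> r ^ k * x N + e / 2" for k
  proof (induction k)
    case (Suc k)
    have "x (N + Suc k) \<le> r * x (N + k) + (e / 2) * (1 - r)"
      using rec[of "N + k"] N[of "N + k"] by simp
    also have "\<dots> \<le> r * (r ^ k * x N + e / 2) + (e / 2) * (1 - r)"
      using Suc r by (intro add_right_mono mult_left_mono) auto
    also have "\<dots> = r ^ Suc k * x N + e / 2" by (simp add: field_simps)
    finally show ?case .
  qed (use e in simp)
  have "(\<lambda>k. r ^ k * x N) \<longlonglongrightarrow> 0"
    using LIMSEQ_power_zero[of r] r by (intro tendsto_mult_left_zero) auto
  then have "\<forall>\<^sub>F k in sequentially. r ^ k * x N < e / 2" using e by (intro order_tendstoD(2)) auto
  then obtain M where M: "\<And>k. k \<ge> M \<Longrightarrow> r ^ k * x N < e / 2" by (auto simp: eventually_sequentially)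
  show "\<exists>no. \<forall>n\<ge>no. norm (x n - 0) < e"
  proof (intro exI[of _ "N + M"] allI impI)
    fix n assume "N + M \<le> n"
    then have "n = N + (n - N)" "n - N \<ge> M" by auto
    then show "norm (x n - 0) < e" using bd[of "n - N"] M[of "n - N"] nonneg[of n] by simp
  qed
qed

lemma funpow_matrix_diff:
  "((*v) M ^^ k) (u - v) = ((*v) M ^^ k) u - ((*v) M ^^ k) v" for M :: "'a::comm_ring_1^'n^'n"
  by (induction k) (simp_all add: matrix_vector_mult_diff_distrib)

lemma funpow_matrix_scale:
  "((*v) M ^^ k) (c *s v) = c *s ((*v) M ^^ k) v" for M :: "'a::comm_ring_1^'n^'n"
  by (induction k) (simp_all add: matrix_vector_mult_vec)

lemma funpow_tendsto_0_of_annihilated: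
  fixes M :: "complex^'n^'n"
  assumes "p \<noteq> 0" "peval M p v = 0" and ev: "\<And>c. c \<in> eigvals M \<Longrightarrow> cmod c < 1"
  shows "(\<lambda>k. ((*v) M ^^ k) v) \<longlonglongrightarrow> 0"
  using assms(1,2)
proof (induction "degree p" arbitrary: p v)
  case 0
  then obtain a where "p = [:a:]" using degree_eq_zeroE by metis
  with 0 have "v = 0" by (simp add: vector_mul_eq_0)
  moreover have "((*v) M ^^ k) 0 = 0" for k by (induction k) simp_all
  ultimately show ?case by simp
next
  case (Suc d)
  then obtain c q where q: "p = [:- c, 1:] * q" "degree p = Suc (degree q)" "q \<noteq> 0"
    using poly_root_factor[of p] Suc(2) by (metis zero_less_Suc)
  have fac: "M *v peval M q v = c *s peval M q v"
    using Suc.prems(2) unfolding q(1) peval_linear_factor by simp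
  show ?case
  proof (cases "c \<in> eigvals M")
    case False
    then have "peval M q v = 0" using fac by (auto simp: eigvals_def)
    then show ?thesis using Suc q by auto
  next
    case True
    define w where "w = M *v v - c *s v"
    have "peval M q w = 0"
    proof -
      have "w + c *s v = M *v v" by (simp add: w_def)
      from arg_cong[OF this, of "peval M q"] show ?thesis
        using fac by (simp add: peval_vec_add peval_vec_scale peval_commute)
    qed
    then have w: "(\<lambda>k. ((*v) M ^^ k) w) \<longlonglongrightarrow> 0" using Suc q by auto
    show ?thesis
    proof (rule vec_tendstoI)
      fix i
      have rec: "((*v) M ^^ Suc k) v $ i = c * ((*v) M ^^ k) v $ i + ((*v) M ^^ k) w $ i" for k
        unfolding w_def funpow_matrix_diff funpow_matrix_scale by (simp add: funpow_swap1)
      have "(\<lambda>k. cmod (((*v) M ^^ k) v $ i)) \<longlonglongrightarrow> 0"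
      proof (rule contraction_recursion_tendsto_0)
        show "cmod (((*v) M ^^ Suc k) v $ i)
          \<le> cmod c * cmod (((*v) M ^^ k) v $ i) + cmod (((*v) M ^^ k) w $ i)" for k
          unfolding rec by (metis norm_mult norm_triangle_ineq)
        show "(\<lambda>k. cmod (((*v) M ^^ k) w $ i)) \<longlonglongrightarrow> 0"
          using tendsto_norm[OF tendsto_vec_nth[OF w, of i]] by simp
      qed (use ev[OF True] in auto)
      then show "(\<lambda>k. ((*v) M ^^ k) v $ i) \<longlonglongrightarrow> 0 $ i"
        by (simp add: tendsto_norm_zero_iff)
    qed
  qed
qed

lemma spec_radius_less_iff:
  "spec_radius M < r \<longleftrightarrow> (\<forall>c\<in>eigvals (cmat M). cmod c < r)"
  unfolding spec_radius_def using finite_eigvals_complex eigvals_complex_nonempty by (subst Max_less_iff) auto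

lemma spec_radius_funpow_tendsto_0:
  fixes M :: "real^'n^'n"
  assumes "spec_radius M < 1"
  shows "(\<lambda>k. ((*v) M ^^ k) v) \<longlonglongrightarrow> 0"
proof (rule vec_tendstoI)
  fix i
  define cv where "cv v = (\<chi> i. complex_of_real (v $ i))" for v :: "real^'n"
  obtain p where "p \<noteq> 0" "peval (cmat M) p (cv v) = 0" using annihilating_poly_exists by blast
  then have "(\<lambda>k. ((*v) (cmat M) ^^ k) (cv v)) \<longlonglongrightarrow> 0"
    using assms by (intro funpow_tendsto_0_of_annihilated) (auto simp: spec_radius_less_iff)
  moreover have "((*v) (cmat M) ^^ k) (cv v) = cv (((*v) M ^^ k) v)" for k
    by (induction k) (simp_all add: cv_def matrix_vector_mult_def vec_eq_iff)
  ultimately have "(\<lambda>k. complex_of_real (((*v) M ^^ k) v $ i)) \<longlonglongrightarrow> of_real 0"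
    using tendsto_vec_nth[of "\<lambda>k. cv (((*v) M ^^ k) v)" 0 sequentially i] by (simp add: cv_def)
  then show "(\<lambda>k. ((*v) M ^^ k) v $ i) \<longlonglongrightarrow> 0 $ i"
    by (simp only: tendsto_of_real_iff zero_index)
qed

text \<open>Real and imaginary parts of a complex eigenvector; in this form real quadratic forms can
  be tested against complex eigenvalues.\<close>

lemma eigvals_cmatE:
  fixes M :: "real^'n^'n"
  assumes "c \<in> eigvals (cmat M)"
  obtains a b where "a \<noteq> 0 \<or> b \<noteq> 0" "M *v a = Re c *\<^sub>R a - Im c *\<^sub>R b"
    "M *v b = Im c *\<^sub>R a + Re c *\<^sub>R b"
proof -
  obtain v where v: "v \<noteq> 0" "cmat M *v v = c *s v" using assms by (auto simp: eigvals_def)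
  define a b where "a = (\<chi> i. Re (v $ i))" and "b = (\<chi> i. Im (v $ i))"
  have "a \<noteq> 0 \<or> b \<noteq> 0" using v(1) by (auto simp: a_def b_def vec_eq_iff complex_eq_iff)
  moreover have "(\<Sum>j\<in>UNIV. complex_of_real (M $ i $ j) * v $ j) = c * v $ i" for i
    using v(2) by (simp add: vec_eq_iff matrix_vector_mult_def)
  note e = this[THEN arg_cong[where f = Re]] this[THEN arg_cong[where f = Im]]
  have "M *v a = Re c *\<^sub>R a - Im c *\<^sub>R b" "M *v b = Im c *\<^sub>R a + Re c *\<^sub>R b"
    using e by (simp_all add: a_def b_def vec_eq_iff matrix_vector_mult_def algebra_simps)
  ultimately show ?thesis using that by blast
qed

lemma finite_eigvals_real: "finite (eigvals (M :: real^'n^'n))"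
proof -
  have "complex_of_real c \<in> eigvals (cmat M)" if "c \<in> eigvals M" for c
  proof -
    obtain v where v: "v \<noteq> 0" "M *v v = c *s v" using \<open>c \<in> eigvals M\<close> by (auto simp: eigvals_def)
    have "(\<Sum>j\<in>UNIV. M $ i $ j * v $ j) = c * v $ i" for i
      using v(2) by (simp add: vec_eq_iff matrix_vector_mult_def)
    from this[THEN arg_cong[where f = complex_of_real]]
    have "cmat M *v (\<chi> i. of_real (v $ i)) = of_real c *s (\<chi> i. of_real (v $ i))"
      by (simp add: vec_eq_iff matrix_vector_mult_def)
    moreover have "(\<chi> i. complex_of_real (v $ i)) \<noteq> 0" using v(1) by (simp add: vec_eq_iff)
    ultimately show ?thesis by (auto simp: eigvals_def)
  qed
  then have "complex_of_real ` eigvals M \<subseteq> eigvals (cmat M)" by blast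
  then have "finite (complex_of_real ` eigvals M)" using finite_eigvals_complex finite_subset by blast
  then show ?thesis by (rule finite_imageD) (simp add: inj_on_def)
qed

lemma inner_symmetric_matrix:
  fixes M :: "real^'n^'n"
  assumes "transpose M = M" shows "u \<bullet> (M *v v) = v \<bullet> (M *v u)"
  by (metis assms dot_lmul_matrix inner_commute transpose_matrix_vector)

text \<open>For the real and imaginary parts \<open>a\<close>, \<open>b\<close> of a complex
  eigenvector, symmetry gives \<open>Im c * (a \<bullet> a + b \<bullet> b) = 0\<close>, so
  \<open>c\<close> is real. With finiteness, the extremal eigenvalues in the stability certificate
  are therefore attained.\<close>

lemma eigvals_symmetric_nonempty:
  fixes M :: "real^'n^'n"
  assumes "transpose M = M"
  shows "eigvals M \<noteq> {}"
proof -
  obtain c where "c \<in> eigvals (cmat M)" using eigvals_complex_nonempty by blast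
  then obtain a b where ab: "a \<noteq> 0 \<or> b \<noteq> 0" "M *v a = Re c *\<^sub>R a - Im c *\<^sub>R b"
    "M *v b = Im c *\<^sub>R a + Re c *\<^sub>R b" by (rule eigvals_cmatE)
  have "Im c * (a \<bullet> a + b \<bullet> b) = 0"
    using inner_symmetric_matrix[OF assms, of a b] unfolding ab(2,3)
    by (simp add: algebra_simps inner_commute)
  moreover have "a \<bullet> a + b \<bullet> b > 0"
    using ab(1) by (metis add_pos_nonneg add_nonneg_pos inner_ge_zero inner_gt_zero_iff)
  ultimately have "Im c = 0" by simp
  then have "M *v a = Re c *s a" "M *v b = Re c *s b"
    using ab(2,3) by (simp_all add: scalar_mult_eq_scaleR)
  then show ?thesis using ab(1) by (auto simp: eigvals_def)
qed

lemma eigval_quadratic_form: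
  fixes M :: "real^'n^'n"
  assumes "c \<in> eigvals M"
  obtains v where "v \<noteq> 0" "v \<bullet> (M *v v) = c * (norm v)\<^sup>2"
  using assms by (auto simp: eigvals_def scalar_mult_eq_scaleR power2_norm_eq_inner)

section \<open>The discrete Lyapunov equation\<close>

lemma inner_transpose_matrix: "u \<bullet> (M *v v) = (transpose M *v u) \<bullet> v" for M :: "real^'n^'m"
  by (metis dot_lmul_matrix transpose_matrix_vector)

lemma inner_funpow_transpose:
  "u \<bullet> ((*v) M ^^ k) v = ((*v) (transpose M) ^^ k) u \<bullet> v" for M :: "real^'n^'n"
proof (induction k arbitrary: v)
  case (Suc k)
  have "((*v) M ^^ Suc k) v = ((*v) M ^^ k) (M *v v)" by (simp only: funpow_Suc_right o_apply)
  then show ?case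
    by (simp only: Suc inner_transpose_matrix funpow.simps o_apply)
qed simp

text \<open>The coordinates of the \<open>k\<close>-th transposed power applied to \<open>v\<close>
  are inner products of \<open>v\<close> with \<open>M^k\<close> applied to unit vectors.\<close>

lemma spec_radius_transpose_funpow_tendsto_0:
  fixes M :: "real^'n^'n"
  assumes "spec_radius M < 1"
  shows "(\<lambda>k. ((*v) (transpose M) ^^ k) v) \<longlonglongrightarrow> 0"
proof (rule vec_tendstoI)
  fix i
  have "(\<lambda>k. v \<bullet> ((*v) M ^^ k) (axis i 1)) \<longlonglongrightarrow> v \<bullet> 0"
    by (intro tendsto_inner tendsto_const spec_radius_funpow_tendsto_0 assms)
  then show "(\<lambda>k. ((*v) (transpose M) ^^ k) v $ i) \<longlonglongrightarrow> 0 $ i"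
    by (simp add: inner_funpow_transpose inner_axis)
qed

text \<open>The Stein operator: \<open>X\<close> solves the discrete Lyapunov equation with data
  \<open>Z\<close> iff \<open>stein M X = Z\<close>. It is linear in \<open>X\<close>, which turns
  solvability into injectivity.\<close>

definition stein :: "real^'n^'n \<Rightarrow> real^'n^'n \<Rightarrow> real^'n^'n" where
  "stein M X = X - M ** X ** transpose M"

lemma matrix_add_rdistrib: "(A + B) ** C = A ** C + B ** C"
  by (simp add: matrix_matrix_mult_def vec_eq_iff sum.distrib algebra_simps)

lemma matrix_bilinear:
  "bounded_bilinear ((**) :: real^'n^'m \<Rightarrow> real^'k^'n \<Rightarrow> real^'k^'m)"
proof -
  have "bilinear ((**) :: real^'n^'m \<Rightarrow> real^'k^'n \<Rightarrow> real^'k^'m)"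
    by (auto simp: bilinear_def linear_iff matrix_add_ldistrib matrix_add_rdistrib
        scalar_matrix_assoc[symmetric] matrix_scalar_ac)
  then show ?thesis by (simp add: bilinear_conv_bounded_bilinear)
qed

lemma matrix_vector_bilinear:
  "bounded_bilinear ((*v) :: real^'n^'m \<Rightarrow> real^'n \<Rightarrow> real^'m)"
proof -
  have "bilinear ((*v) :: real^'n^'m \<Rightarrow> real^'n \<Rightarrow> real^'m)"
    by (auto simp: bilinear_def linear_iff matrix_vector_right_distrib matrix_vector_mult_add_rdistrib
        scaleR_matrix_vector_assoc[symmetric] matrix_vector_mult_scaleR)
  then show ?thesis by (simp add: bilinear_conv_bounded_bilinear)
qed

lemma transpose_bounded_linear: "bounded_linear (transpose :: real^'n^'m \<Rightarrow> real^'m^'n)"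
  by (simp add: linear_conv_bounded_linear[symmetric] linear_iff transpose_def vec_eq_iff)

lemma stein_linear: "linear (stein M)"
  unfolding stein_def
  by (intro bounded_linear.linear bounded_linear_sub bounded_linear_ident
      bounded_linear_compose[OF bounded_bilinear.bounded_linear_left[OF matrix_bilinear]
        bounded_bilinear.bounded_linear_right[OF matrix_bilinear]])

text \<open>The Lyapunov equation is substituted into itself \<open>k\<close> times: the sum is a
  partial sum of the Gramian, the other term is the remainder.\<close>

lemma stein_quadratic_form:
  assumes "stein M X = Z"
  shows "u \<bullet> (X *v v) = ((*v) (transpose M) ^^ k) u \<bullet> (X *v ((*v) (transpose M) ^^ k) v)
    + (\<Sum>i<k. ((*v) (transpose M) ^^ i) u \<bullet> (Z *v ((*v) (transpose M) ^^ i) v))"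
proof (induction k)
  case (Suc k)
  define u' v' where "u' = ((*v) (transpose M) ^^ k) u" and "v' = ((*v) (transpose M) ^^ k) v"
  have "X = M ** X ** transpose M + Z" using assms by (simp add: stein_def algebra_simps)
  from arg_cong[OF this, of "\<lambda>X. X *v v'"]
  have "X *v v' = M *v (X *v (transpose M *v v')) + Z *v v'"
    by (simp only: matrix_vector_mul_assoc matrix_vector_mult_add_rdistrib matrix_mul_assoc)
  then have "u' \<bullet> (X *v v') = (transpose M *v u') \<bullet> (X *v (transpose M *v v')) + u' \<bullet> (Z *v v')"
    by (simp only: inner_add_right inner_transpose_matrix[of u' M])
  with Suc have "u \<bullet> (X *v v) = (transpose M *v u') \<bullet> (X *v (transpose M *v v')) + u' \<bullet> (Z *v v')
      + (\<Sum>i<k. ((*v) (transpose M) ^^ i) u \<bullet> (Z *v ((*v) (transpose M) ^^ i) v))"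
    by (simp only: u'_def v'_def)
  also have "\<dots> = (transpose M *v u') \<bullet> (X *v (transpose M *v v'))
      + (\<Sum>i<Suc k. ((*v) (transpose M) ^^ i) u \<bullet> (Z *v ((*v) (transpose M) ^^ i) v))"
    unfolding sum.lessThan_Suc u'_def v'_def by linarith
  finally show ?case by (simp only: u'_def v'_def funpow.simps o_apply)
qed simp

text \<open>Stability is recorded as decay of the transposed powers, which is what the unrolled
  Lyapunov equation contains. When \<open>spec_radius M < 1\<close>, both \<open>M\<close> and
  \<open>transpose M\<close> are instances.\<close>

locale schur_stable =
  fixes M :: "real^'n^'n"
  assumes transpose_powers: "\<And>v. (\<lambda>k. ((*v) (transpose M) ^^ k) v) \<longlonglongrightarrow> 0"
begin

lemma remainder_tendsto_0:
  "(\<lambda>k. ((*v) (transpose M) ^^ k) u \<bullet> (X *v ((*v) (transpose M) ^^ k) v)) \<longlonglongrightarrow> 0"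
proof -
  have "(\<lambda>k. ((*v) (transpose M) ^^ k) u \<bullet> (X *v ((*v) (transpose M) ^^ k) v)) \<longlonglongrightarrow> 0 \<bullet> (X *v 0)"
    by (intro tendsto_inner transpose_powers bounded_bilinear.tendsto[OF matrix_vector_bilinear] tendsto_const)
  then show ?thesis by simp
qed

text \<open>With \<open>Z = 0\<close> the unrolled equation leaves only the remainder, which is
  constant in \<open>k\<close> and tends to 0.\<close>

lemma stein_inj: "inj (stein M)"
proof -
  have "X = 0" if "stein M X = 0" for X
  proof -
    have "(\<lambda>k. u \<bullet> (X *v v)) \<longlonglongrightarrow> 0" for u v
      using remainder_tendsto_0[of u X v] stein_quadratic_form[OF that, of u v] by simp
    then have "u \<bullet> (X *v v) = 0" for u v by (simp add: LIMSEQ_const_iff)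
    then have "X *v v = 0 *v v" for v by (metis inner_eq_zero_iff matrix_vector_mult_0)
    then show "X = 0" by (metis matrix_eq)
  qed
  then show ?thesis using linear_injective_0[OF stein_linear] by blast
qed

text \<open>In finite dimension, injectivity of the Stein operator gives existence as well as
  uniqueness, so the description in \<open>lyap\<close> denotes.\<close>

lemma stein_lyap: "stein M (lyap M Z) = Z"
proof -
  obtain X where X: "stein M X = Z"
    using linear_injective_imp_surjective[OF stein_linear stein_inj] by (metis surjD)
  have eq: "Y = M ** Y ** transpose M + Z \<longleftrightarrow> stein M Y = Z" for Y
    by (auto simp: stein_def algebra_simps)
  have "\<exists>!Y. Y = M ** Y ** transpose M + Z"
    unfolding eq using X injD[OF stein_inj] by blast
  from theI'[OF this] show ?thesis unfolding lyap_def eq .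
qed

lemma lyap_symmetric:
  assumes "transpose Z = Z" shows "transpose (lyap M Z) = lyap M Z"
proof -
  have "stein M (transpose X) = transpose (stein M X)" for X
    by (simp add: stein_def matrix_transpose_mul matrix_mul_assoc
        linear_diff[OF bounded_linear.linear[OF transpose_bounded_linear]])
  then show ?thesis using assms stein_lyap by (metis injD[OF stein_inj])
qed

text \<open>The partial sums of the Gramian increase, since the form of \<open>Z\<close> is
  nonnegative, and they converge to the form of the Lyapunov solution.\<close>

lemma lyap_lower_bound:
  assumes "\<And>v. 0 \<le> v \<bullet> (Z *v v)"
  shows "(\<Sum>i<N. ((*v) (transpose M) ^^ i) v \<bullet> (Z *v ((*v) (transpose M) ^^ i) v)) \<le> v \<bullet> (lyap M Z *v v)"
proof -
  define q where "q i = ((*v) (transpose M) ^^ i) v \<bullet> (Z *v ((*v) (transpose M) ^^ i) v)" for i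
  have "v \<bullet> (lyap M Z *v v) - (\<Sum>i<k. q i)
      = ((*v) (transpose M) ^^ k) v \<bullet> (lyap M Z *v ((*v) (transpose M) ^^ k) v)" for k
    using stein_quadratic_form[OF stein_lyap, of v Z v k] by (simp add: q_def)
  then have "(\<lambda>k. v \<bullet> (lyap M Z *v v) - (\<Sum>i<k. q i)) \<longlonglongrightarrow> 0"
    using remainder_tendsto_0[of v "lyap M Z" v] by simp
  then have "(\<lambda>k. \<Sum>i<k. q i) \<longlonglongrightarrow> v \<bullet> (lyap M Z *v v)"
    using tendsto_diff[OF tendsto_const, of _ 0 sequentially "v \<bullet> (lyap M Z *v v)"] by fastforce
  moreover have "\<forall>k\<ge>N. (\<Sum>i<N. q i) \<le> (\<Sum>i<k. q i)"
    using assms by (auto intro!: sum_mono2 simp: q_def)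
  ultimately show ?thesis unfolding q_def[symmetric] by (metis LIMSEQ_le_const)
qed

lemma lyap_pos_def:
  assumes "pos_def Z" shows "pos_def (lyap M Z)"
proof -
  have Z: "0 \<le> v \<bullet> (Z *v v)" for v using assms by (cases "v = 0") (auto simp: pos_def_def less_imp_le)
  \<comment> \<open>\<open>N = 1\<close> keeps only the term \<open>i = 0\<close>, which is the form
    of \<open>Z\<close> itself.\<close>
  have "v \<bullet> (Z *v v) \<le> v \<bullet> (lyap M Z *v v)" for v using lyap_lower_bound[OF Z, where N = 1] by simp
  then have "0 < v \<bullet> (lyap M Z *v v)" if "v \<noteq> 0" for v
    using assms that unfolding pos_def_def by (meson less_le_trans)
  then show ?thesis using lyap_symmetric assms unfolding pos_def_def by blast
qed

text \<open>A null vector of the Gramian is orthogonal to every \<open>M\<^sup>i R u\<close> with \<open>i < n\<close>, hence to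
  the whole controllable subspace.\<close>

lemma lyap_pos_def_of_controllable:
  assumes R: "is_psd_sqrt R Z" and "controllable M R"
  shows "pos_def (lyap M Z)"
proof -
  have Rs: "transpose R = R" and RR: "R ** R = Z" using R by (auto simp: is_psd_sqrt_def pos_semidef_def)
  have Zs: "transpose Z = Z" using Rs unfolding RR[symmetric] by (simp add: matrix_transpose_mul)
  have Zq: "v \<bullet> (Z *v v) = (norm (R *v v))\<^sup>2" for v
    unfolding RR[symmetric] matrix_vector_mul_assoc[symmetric] inner_transpose_matrix[of v R] Rs
    by (rule power2_norm_eq_inner[symmetric])
  have lb: "(\<Sum>i<CARD('n). ((*v) (transpose M) ^^ i) v \<bullet> (Z *v ((*v) (transpose M) ^^ i) v))
      \<le> v \<bullet> (lyap M Z *v v)" for v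
    by (rule lyap_lower_bound) (simp add: Zq)
  have "0 < v \<bullet> (lyap M Z *v v)" if v: "v \<noteq> 0" for v
  proof (rule ccontr)
    assume "\<not> 0 < v \<bullet> (lyap M Z *v v)"
    with lb[of v] have "(\<Sum>i<CARD('n). (norm (R *v ((*v) (transpose M) ^^ i) v))\<^sup>2) \<le> 0"
      by (simp add: Zq)
    then have "(\<Sum>i<CARD('n). (norm (R *v ((*v) (transpose M) ^^ i) v))\<^sup>2) = 0"
      by (intro antisym sum_nonneg) auto
    then have z: "R *v ((*v) (transpose M) ^^ i) v = 0" if "i < CARD('n)" for i
      using that by (subst (asm) sum_nonneg_eq_0_iff) auto
    have "orthogonal v x" if "x \<in> {((\<lambda>x. M *v x) ^^ i) (R *v u) |i u. i < CARD('n)}" for x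
    proof -
      obtain i u where i: "x = ((*v) M ^^ i) (R *v u)" "i < CARD('n)" using \<open>x \<in> _\<close> by auto
      have "v \<bullet> x = (R *v ((*v) (transpose M) ^^ i) v) \<bullet> u"
        unfolding i(1) inner_funpow_transpose by (simp add: inner_transpose_matrix Rs)
      then show ?thesis using z[OF i(2)] by (simp add: orthogonal_def)
    qed
    then have "orthogonal v x" if "x \<in> span {((\<lambda>x. M *v x) ^^ i) (R *v u) |i u. i < CARD('n)}" for x
      using that orthogonal_to_span by blast
    then have "orthogonal v v" using assms(2) unfolding controllable_def by blast
    then show False using v by (simp add: orthogonal_self)
  qed
  then show ?thesis using lyap_symmetric[OF Zs] by (simp add: pos_def_def)
qed

end

lemma schur_stable_of_spec_radius: "spec_radius M < 1 \<Longrightarrow> schur_stable M"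
  by unfold_locales (rule spec_radius_transpose_funpow_tendsto_0)

lemma schur_stable_transpose: "spec_radius M < 1 \<Longrightarrow> schur_stable (transpose M)"
  by unfold_locales (simp add: spec_radius_funpow_tendsto_0)

section \<open>Lyapunov functions and openness of the stabilizing set\<close>

lemma matrix_vector_norm_bound:
  obtains C where "C > 0" "\<And>(M :: real^'n^'m) v. norm (M *v v) \<le> C * norm M * norm v"
proof -
  obtain K where "K > 0" "\<And>(M :: real^'n^'m) v. norm (M *v v) \<le> norm M * norm v * K"
    using bounded_bilinear.pos_bounded[OF matrix_vector_bilinear[where 'n = 'n and 'm = 'm]] by blast
  then show ?thesis by (intro that[of K]) (simp_all add: ac_simps)
qed

text \<open>On the compact unit sphere the form of \<open>Y\<close> has a positive minimum
  \<open>c\<close>, which homogeneity spreads to all vectors; replacing \<open>Y\<close> by a nearby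
  matrix costs half of it.\<close>

lemma pos_def_eventually_coercive:
  fixes X :: "'a::topological_space \<Rightarrow> real^'n^'n"
  assumes pd: "\<And>v. v \<noteq> 0 \<Longrightarrow> 0 < v \<bullet> (Y *v v)" and lim: "(X \<longlongrightarrow> Y) F"
  shows "\<exists>c>0. \<forall>\<^sub>F p in F. \<forall>v. c * (norm v)\<^sup>2 \<le> v \<bullet> (X p *v v)"
proof -
  have "continuous_on (sphere 0 1) (\<lambda>v. v \<bullet> (Y *v v))"
    by (intro continuous_intros bounded_bilinear.continuous_on[OF matrix_vector_bilinear])
  moreover have "sphere (0 :: real^'n) 1 \<noteq> {}" by simp
  ultimately obtain v0 where v0: "v0 \<in> sphere 0 1"
    "\<And>v. v \<in> sphere 0 1 \<Longrightarrow> v0 \<bullet> (Y *v v0) \<le> v \<bullet> (Y *v v)"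
    using continuous_attains_inf[OF compact_sphere, of 0 1 "\<lambda>v. v \<bullet> (Y *v v)"] by blast
  define c where "c = v0 \<bullet> (Y *v v0)"
  have "v0 \<noteq> 0" using v0(1) by auto
  then have c: "c > 0" unfolding c_def by (rule pd)
  have Yb: "c * (norm v)\<^sup>2 \<le> v \<bullet> (Y *v v)" for v
  proof (cases "v = 0")
    case False
    have "v /\<^sub>R norm v \<in> sphere 0 1" using False by simp
    from v0(2)[OF this] show ?thesis
      using False by (simp add: c_def matrix_vector_mult_scaleR field_simps power2_eq_square)
  qed simp
  obtain C where C: "C > 0" "\<And>(M :: real^'n^'n) v. norm (M *v v) \<le> C * norm M * norm v"
    using matrix_vector_norm_bound by blast
  have "((\<lambda>p. C * norm (X p - Y)) \<longlongrightarrow> C * norm (Y - Y)) F" by (intro tendsto_intros lim)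
  then have "\<forall>\<^sub>F p in F. C * norm (X p - Y) < c / 2" using c by (intro order_tendstoD(2)) auto
  then have "\<forall>\<^sub>F p in F. \<forall>v. (c / 2) * (norm v)\<^sup>2 \<le> v \<bullet> (X p *v v)"
  proof eventually_elim
    case (elim p)
    show ?case
    proof
      fix v
      have "\<bar>v \<bullet> ((X p - Y) *v v)\<bar> \<le> norm v * norm ((X p - Y) *v v)" by (rule Cauchy_Schwarz_ineq2)
      also have "\<dots> \<le> norm v * ((c / 2) * norm v)"
        using order_trans[OF C(2)[of "X p - Y" v] mult_right_mono[OF less_imp_le[OF elim] norm_ge_zero]]
        by (intro mult_left_mono) auto
      finally have "\<bar>v \<bullet> ((X p - Y) *v v)\<bar> \<le> (c / 2) * (norm v)\<^sup>2" by (simp add: power2_eq_square ac_simps)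
      moreover have "v \<bullet> (X p *v v) = v \<bullet> (Y *v v) + v \<bullet> ((X p - Y) *v v)"
        by (simp add: matrix_vector_mult_diff_rdistrib inner_diff_right)
      ultimately show "(c / 2) * (norm v)\<^sup>2 \<le> v \<bullet> (X p *v v)" using Yb[of v] by simp
    qed
  qed
  then show ?thesis using c by (intro exI[of _ "c / 2"]) simp
qed

text \<open>Let \<open>q\<close> be the form of \<open>P\<close> and \<open>a\<close>,
  \<open>b\<close> the real and imaginary parts of an eigenvector for \<open>c\<close>. Then
  \<open>q (M a) + q (M b) = |c|^2 (q a + q b)\<close>, and the strict decrease of \<open>q\<close>
  forces \<open>|c| < 1\<close>.\<close>

lemma spec_radius_less_1_of_lyapunov:
  fixes M P :: "real^'n^'n"
  assumes P: "pos_def P"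
    and dec: "\<And>v. v \<noteq> 0 \<Longrightarrow> (M *v v) \<bullet> (P *v (M *v v)) < v \<bullet> (P *v v)"
  shows "spec_radius M < 1"
  unfolding spec_radius_less_iff
proof
  fix c assume "c \<in> eigvals (cmat M)"
  then obtain a b where ab: "a \<noteq> 0 \<or> b \<noteq> 0" "M *v a = Re c *\<^sub>R a - Im c *\<^sub>R b"
    "M *v b = Im c *\<^sub>R a + Re c *\<^sub>R b" by (rule eigvals_cmatE)
  define q where "q v = v \<bullet> (P *v v)" for v
  have sym: "b \<bullet> (P *v a) = a \<bullet> (P *v b)" using P inner_symmetric_matrix by (auto simp: pos_def_def)
  have q0: "q v \<ge> 0" for v using P by (cases "v = 0") (auto simp: pos_def_def q_def less_imp_le)
  have qp: "q a + q b > 0"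
    using ab(1) P q0[of a] q0[of b] unfolding pos_def_def q_def by (auto intro: add_pos_nonneg add_nonneg_pos)
  have "q (M *v a) + q (M *v b) = ((Re c)\<^sup>2 + (Im c)\<^sup>2) * (q a + q b)"
    unfolding q_def ab
    by (simp add: matrix_vector_right_distrib matrix_vector_mult_diff_distrib matrix_vector_mult_scaleR
        inner_add_left inner_add_right inner_diff_left inner_diff_right sym algebra_simps power2_eq_square)
  moreover have "q (M *v a) + q (M *v b) < q a + q b"
  proof -
    have "q (M *v v) \<le> q v" for v using dec[of v] by (cases "v = 0") (auto simp: q_def)
    moreover have "q (M *v a) < q a \<or> q (M *v b) < q b" using ab(1) dec by (auto simp: q_def)
    ultimately show ?thesis by (auto intro: add_le_less_mono add_less_le_mono)
  qed
  ultimately have "(cmod c)\<^sup>2 * (q a + q b) < 1 * (q a + q b)" by (simp add: cmod_power2)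
  then have "(cmod c)\<^sup>2 < 1" using qp by (metis mult_less_cancel_right_pos)
  then show "cmod c < 1" by (simp add: power_less_one_iff)
qed

text \<open>The Lyapunov matrix \<open>P\<close> found at \<open>K\<close> is kept while
  \<open>K'\<close> varies. Its residual \<open>W K'\<close> is the identity at
  \<open>K' = K\<close> and depends continuously on \<open>K'\<close>, so it stays positive definite
  and \<open>P\<close> certifies stability of all nearby \<open>K'\<close>.\<close>

lemma open_stabilizing: "open (stabilizing A B)" for A :: "real^'n^'n" and B :: "real^'m^'n"
proof -
  have "\<forall>\<^sub>F K' in nhds K. K' \<in> stabilizing A B" if "K \<in> stabilizing A B" for K
  proof -
    let ?M = "\<lambda>K. A + B ** K"
    interpret schur_stable "transpose (?M K)"
      using that by (intro schur_stable_transpose) (simp add: stabilizing_def)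
    define P where "P = lyap (transpose (?M K)) (mat 1)"
    have P: "pos_def P" unfolding P_def by (rule lyap_pos_def) (simp add: pos_def_def)
    define W where "W K' = stein (transpose (?M K')) P" for K'
    have "W K = mat 1" unfolding W_def P_def by (rule stein_lyap)
    have Wq: "v \<bullet> (W K' *v v) = v \<bullet> (P *v v) - (?M K' *v v) \<bullet> (P *v (?M K' *v v))" for K' v
      unfolding W_def stein_def
      by (simp only: matrix_vector_mult_diff_rdistrib inner_diff_right matrix_vector_mul_assoc[symmetric]
          inner_transpose_matrix[of v "transpose _"] transpose_transpose)
    have "(W \<longlongrightarrow> W K) (nhds K)"
      unfolding W_def stein_def
      by (intro tendsto_intros bounded_bilinear.tendsto[OF matrix_bilinear]
          bounded_linear.tendsto[OF transpose_bounded_linear] filterlim_ident)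
    moreover have "v \<noteq> 0 \<Longrightarrow> 0 < v \<bullet> (W K *v v)" for v by (simp add: \<open>W K = mat 1\<close>)
    ultimately obtain c where c: "c > 0" "\<forall>\<^sub>F K' in nhds K. \<forall>v. c * (norm v)\<^sup>2 \<le> v \<bullet> (W K' *v v)"
      using pos_def_eventually_coercive by blast
    from c(2) show ?thesis
    proof eventually_elim
      case (elim K')
      have "(?M K' *v v) \<bullet> (P *v (?M K' *v v)) < v \<bullet> (P *v v)" if "v \<noteq> 0" for v
      proof -
        have "0 < c * (norm v)\<^sup>2" using c(1) that by simp
        then show ?thesis using elim[rule_format, of v] unfolding Wq by linarith
      qed
      from spec_radius_less_1_of_lyapunov[OF P this] show ?case by (simp add: stabilizing_def)
    qed
  qed
  note near = this
  show ?thesis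
  proof (rule Topological_Spaces.openI)
    fix K assume "K \<in> stabilizing A B"
    from near[OF this] obtain N where "open N" "K \<in> N" "\<forall>K'\<in>N. K' \<in> stabilizing A B"
      unfolding eventually_nhds by blast
    then show "\<exists>N. open N \<and> K \<in> N \<and> N \<subseteq> stabilizing A B" by (intro exI[of _ N]) auto
  qed
qed

section \<open>Riemannian and Euclidean distance\<close>

lemma norm_increment_le_length:
  fixes \<gamma> :: "real \<Rightarrow> 'a::euclidean_space"
  assumes ab: "a \<le> b" and s: "finite s" and cont: "continuous_on {a..b} \<gamma>"
    and C1: "\<gamma> C1_differentiable_on {a..b} - s" and c: "c \<ge> 0"
  shows "ennreal (c * norm (\<gamma> b - \<gamma> a))
    \<le> (\<integral>\<^sup>+t\<in>{a..b}. ennreal (c * norm (vector_derivative \<gamma> (at t))) \<partial>lborel)"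
proof -
  obtain D where D: "\<forall>t \<in> {a..b} - s. (\<gamma> has_vector_derivative D t) (at t)"
    "continuous_on ({a..b} - s) D" using C1 unfolding C1_differentiable_on_def by blast
  \<comment> \<open>\<open>E\<close> is the continuous derivative of the smooth pieces, set to 0
    elsewhere. It is visibly Borel measurable, and on \<open>{a..b}\<close> it can differ from
    \<open>vector_derivative \<gamma>\<close> only at break points.\<close>
  define E where "E t = indicator ({a..b} - s) t *\<^sub>R D t" for t
  have "{a..b} - s \<in> sets borel" using s by (auto intro: finite_imp_closed borel_closed)
  then have meas: "E \<in> borel_measurable borel"
    unfolding E_def using D(2) by (rule borel_measurable_continuous_on_indicator)
  \<comment> \<open>An infinite length makes the bound trivial. A finite one makes \<open>E\<close>
    Lebesgue integrable, and its integral then agrees with the gauge integral supplied by the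
    fundamental theorem of calculus.\<close>
  have "ennreal (norm (\<gamma> b - \<gamma> a)) \<le> (\<integral>\<^sup>+t. ennreal (norm (E t)) \<partial>lborel)"
  proof (cases "(\<integral>\<^sup>+t. ennreal (norm (E t)) \<partial>lborel) < \<infinity>")
    case True
    then have int: "integrable lborel E"
      using meas by (intro integrableI_bounded) auto
    have "(E has_integral (\<gamma> b - \<gamma> a)) {a..b}"
      by (rule fundamental_theorem_of_calculus_interior_strong[OF s ab _ cont])
        (use D(1) in \<open>auto simp: E_def\<close>)
    then have "(E has_integral (\<gamma> b - \<gamma> a)) UNIV"
      by (rule has_integral_on_superset) (auto simp: E_def)
    then have "\<gamma> b - \<gamma> a = integral\<^sup>L lborel E"
      using has_integral_integral_lborel[OF int] has_integral_unique by blast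
    then show ?thesis using integral_norm_bound_ennreal[OF int] by simp
  next
    case False
    then show ?thesis by (metis infinity_ennreal_def less_top top_greatest)
  qed
  then have "ennreal (c * norm (\<gamma> b - \<gamma> a)) \<le> ennreal c * (\<integral>\<^sup>+t. ennreal (norm (E t)) \<partial>lborel)"
    using c by (simp add: ennreal_mult mult_left_mono)
  also have "\<dots> = (\<integral>\<^sup>+t. ennreal c * ennreal (norm (E t)) \<partial>lborel)"
    using meas by (intro nn_integral_cmult[symmetric]) simp
  also have "\<dots> \<le> (\<integral>\<^sup>+t\<in>{a..b}. ennreal (c * norm (vector_derivative \<gamma> (at t))) \<partial>lborel)"
  proof (rule nn_integral_mono)
    fix t
    show "ennreal c * ennreal (norm (E t))
        \<le> ennreal (c * norm (vector_derivative \<gamma> (at t))) * indicator {a..b} t"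
    proof (cases "t \<in> {a..b} - s")
      case True
      then have "vector_derivative \<gamma> (at t) = D t" using D(1) by (intro vector_derivative_at) blast
      then show ?thesis using True c by (simp add: E_def ennreal_mult)
    qed (simp add: E_def)
  qed
  finally show ?thesis .
qed

text \<open>Only the last piece of a curve, after its final visit to the sphere through \<open>p\<close> around
  \<open>l\<close>, is needed; it stays in the region where \<open>g\<close> is bounded below.\<close>

lemma riem_dist_lower_bound:
  fixes g :: "'a::euclidean_space \<Rightarrow> 'a \<Rightarrow> 'a \<Rightarrow> real"
  assumes c: "c \<ge> 0" and p: "p \<in> ball l \<epsilon>"
    and g: "\<And>q u. q \<in> M \<inter> ball l \<epsilon> \<Longrightarrow> c\<^sup>2 * (norm u)\<^sup>2 \<le> g q u u"
  shows "ennreal (c * norm (p - l)) \<le> riem_dist M g p l"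
  unfolding riem_dist_def
proof (rule Inf_greatest, clarify)
  fix \<gamma> assume \<gamma>: "\<gamma> piecewise_C1_differentiable_on {0..1}" "\<gamma> ` {0..1} \<subseteq> M"
    and p_def: "p = \<gamma> 0" and l_def: "l = \<gamma> 1"
  obtain s where s: "finite s" "\<gamma> C1_differentiable_on {0..1} - s" and cont: "continuous_on {0..1} \<gamma>"
    using \<gamma>(1) by (auto simp: piecewise_C1_differentiable_on_def)
  define N where "N = {t \<in> {0..1}. norm (\<gamma> t - \<gamma> 1) \<ge> norm (\<gamma> 0 - \<gamma> 1)}"
  have "compact N"
  proof -
    have "N = {0..1} \<inter> (\<lambda>t. norm (\<gamma> t - \<gamma> 1)) -` {norm (\<gamma> 0 - \<gamma> 1)..}" by (auto simp: N_def)
    also have "closed \<dots>" by (intro continuous_closed_preimage continuous_intros cont)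
    finally have "closed N" .
    moreover have "bounded N" by (rule bounded_subset[of "{0..1}"]) (auto simp: N_def)
    ultimately show ?thesis by (simp add: compact_eq_bounded_closed)
  qed
  moreover have "0 \<in> N" by (simp add: N_def)
  ultimately obtain \<tau> where \<tau>: "\<tau> \<in> N" "\<And>t. t \<in> N \<Longrightarrow> t \<le> \<tau>"
    using compact_attains_sup[of N] by blast
  have \<tau>01: "0 \<le> \<tau>" "\<tau> \<le> 1" "norm (\<gamma> 0 - \<gamma> 1) \<le> norm (\<gamma> \<tau> - \<gamma> 1)" using \<tau>(1) by (auto simp: N_def)
  have "ennreal (c * norm (\<gamma> 0 - \<gamma> 1)) \<le> ennreal (c * norm (\<gamma> 1 - \<gamma> \<tau>))"
    using c \<tau>01(3) by (intro ennreal_leI mult_left_mono) (auto simp: norm_minus_commute)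
  also have "\<dots> \<le> (\<integral>\<^sup>+t\<in>{\<tau>..1}. ennreal (c * norm (vector_derivative \<gamma> (at t))) \<partial>lborel)"
  proof (rule norm_increment_le_length[OF \<tau>01(2) s(1) _ _ c])
    show "continuous_on {\<tau>..1} \<gamma>" using cont \<tau>01(1) by (auto elim: continuous_on_subset)
    show "\<gamma> C1_differentiable_on {\<tau>..1} - s"
      using s(2) \<tau>01(1) by (auto elim: C1_differentiable_on_subset)
  qed
  also have "\<dots> \<le> riem_length g \<gamma>"
    unfolding riem_length_def
  proof (rule nn_integral_mono_AE)
    \<comment> \<open>The time \<open>\<tau>\<close> itself belongs to \<open>N\<close>, where the
      strict distance bound fails; a single time is a null set.\<close>
    show "AE t in lborel. ennreal (c * norm (vector_derivative \<gamma> (at t))) * indicator {\<tau>..1} t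
      \<le> ennreal (sqrt (g (\<gamma> t) (vector_derivative \<gamma> (at t)) (vector_derivative \<gamma> (at t)))) * indicator {0..1} t"
      using AE_lborel_singleton[of \<tau>]
    proof eventually_elim
      case (elim t)
      show ?case
      proof (cases "t \<in> {\<tau>..1}")
        case True
        with elim \<tau>01 have t: "t \<in> {0..1}" "t > \<tau>" by auto
        then have "t \<notin> N" using \<tau>(2) by force
        then have "norm (\<gamma> t - \<gamma> 1) < norm (\<gamma> 0 - \<gamma> 1)" using t by (auto simp: N_def)
        then have "\<gamma> t \<in> M \<inter> ball l \<epsilon>"
          using p t \<gamma>(2) by (auto simp: p_def l_def dist_norm norm_minus_commute)
        from g[OF this] have "c * norm u \<le> sqrt (g (\<gamma> t) u u)" for u
          by (intro real_le_rsqrt) (simp add: power_mult_distrib)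
        then show ?thesis using True t by (simp add: ennreal_leI)
      qed simp
    qed
  qed
  finally show "ennreal (c * norm (\<gamma> 0 - \<gamma> 1)) \<le> riem_length g \<gamma>" .
qed

text \<open>The straight segment is an admissible curve with constant velocity
  \<open>l - p\<close>.\<close>

lemma riem_dist_upper_bound:
  fixes g :: "'a::euclidean_space \<Rightarrow> 'a \<Rightarrow> 'a \<Rightarrow> real"
  assumes C: "C \<ge> 0" and seg: "closed_segment p l \<subseteq> M"
    and g: "\<And>q u. q \<in> closed_segment p l \<Longrightarrow> g q u u \<le> C\<^sup>2 * (norm u)\<^sup>2"
  shows "riem_dist M g p l \<le> ennreal (C * norm (p - l))"
proof -
  define \<gamma> where "\<gamma> t = p + t *\<^sub>R (l - p)" for t
  have d: "(\<gamma> has_vector_derivative (l - p)) (at t)" for t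
    unfolding \<gamma>_def by (auto intro!: derivative_eq_intros)
  have "\<gamma> C1_differentiable_on {0..1}"
    unfolding C1_differentiable_on_def using d by (intro exI[of _ "\<lambda>t. l - p"]) auto
  then have "\<gamma> piecewise_C1_differentiable_on {0..1}" by (rule C1_differentiable_imp_piecewise)
  moreover have im: "\<gamma> t \<in> closed_segment p l" if "t \<in> {0..1}" for t
    using that by (auto simp: \<gamma>_def closed_segment_def algebra_simps intro!: exI[of _ t])
  ultimately have "riem_dist M g p l \<le> riem_length g \<gamma>"
    unfolding riem_dist_def using seg
    by (intro Inf_lower CollectI exI[of _ \<gamma>] conjI refl) (auto simp: \<gamma>_def)
  also have "\<dots> \<le> (\<integral>\<^sup>+t. ennreal (C * norm (p - l)) * indicator {0..1::real} t \<partial>lborel)"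
    unfolding riem_length_def
  proof (rule nn_integral_mono)
    fix t :: real
    have "sqrt (g (\<gamma> t) (l - p) (l - p)) \<le> C * norm (p - l)" if "t \<in> {0..1}"
      using g[OF im[OF that], of "l - p"] C
      by (intro real_le_lsqrt) (auto simp: power_mult_distrib norm_minus_commute)
    then show "ennreal (sqrt (g (\<gamma> t) (vector_derivative \<gamma> (at t)) (vector_derivative \<gamma> (at t))))
        * indicator {0..1} t \<le> ennreal (C * norm (p - l)) * indicator {0..1} t"
      by (auto simp: vector_derivative_at[OF d] indicator_def intro: ennreal_leI)
  qed
  also have "\<dots> = ennreal (C * norm (p - l))" by (simp add: nn_integral_cmult_indicator)
  finally show ?thesis .
qed

section \<open>The iteration\<close>

lemma trace_transpose_mult: "trace (transpose U ** W) = U \<bullet> W" for U W :: "real^'n^'m"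
  unfolding trace_def transpose_def matrix_matrix_mult_def inner_vec_def
  by (simp add: inner_real_def) (rule sum.swap)

text \<open>Right multiplication acts on each row separately, so forms on matrices reduce to forms
  on vectors.\<close>

lemma inner_matrix_mul_right:
  "(U ** Y) \<bullet> W = (\<Sum>i\<in>UNIV. (transpose Y *v (U $ i)) \<bullet> (W $ i))" for U W :: "real^'n^'m"
proof -
  have "(U ** Y) $ i = transpose Y *v (U $ i)" for i
    by (simp add: matrix_matrix_mult_def matrix_vector_mult_def transpose_def vec_eq_iff mult.commute)
  then show ?thesis by (simp add: inner_vec_def[of "U ** Y"])
qed

lemma Ck_on_closed_loop:
  fixes B :: "real^'m^'n"
  assumes "open S" shows "Ck_on k (\<lambda>K. A + B ** K) S"
  by (intro Ck_on_add[OF assms] Ck_on_const assms Ck_on_ident Ck_on_bilinear[OF assms matrix_bilinear])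

text \<open>The Stein operator is the coefficient of a linear system whose solution is the Lyapunov
  solution.\<close>

lemma Ck_on_lyap:
  assumes S: "open S" and M: "Ck_on k M S" and Z: "Ck_on k Z S"
    and stable: "\<And>p. p \<in> S \<Longrightarrow> schur_stable (M p)"
  shows "Ck_on k (\<lambda>p. lyap (M p) (Z p)) S"
proof (rule Ck_on_linear_system[where A = "\<lambda>p. stein (M p)" and b = Z])
  show "Ck_on k (\<lambda>p. stein (M p) X) S" for X
    unfolding stein_def
    by (intro Ck_on_diff[OF S] Ck_on_const S Ck_on_bilinear[OF S matrix_bilinear] M
        Ck_on_linear[OF S _ transpose_bounded_linear])
qed (use assms in \<open>simp_all add: stein_linear schur_stable.stein_inj schur_stable.stein_lyap\<close>)

lemma Ck_on_tendsto_nhds: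
  "open S \<Longrightarrow> z \<in> S \<Longrightarrow> Ck_on k f S \<Longrightarrow> (f \<longlongrightarrow> f z) (nhds z)"
  using Ck_on_continuous[of k f S]
  by (simp add: continuous_on_eq_continuous_at isCont_def tendsto_at_iff_tendsto_nhds)

lemma eventually_nhds_norm_less:
  fixes f :: "'a::topological_space \<Rightarrow> 'b::real_normed_vector"
  assumes "(f \<longlongrightarrow> f z) (nhds z)" shows "\<forall>\<^sub>F p in nhds z. norm (f p) < norm (f z) + 1"
  by (rule order_tendstoD(2)[OF tendsto_norm[OF assms]]) simp

text \<open>When \<open>B ** G\<close> is nonzero, the certificate near \<open>z\<close> is at least
  \<open>q0 / (2 l C Cs norm G)\<close>: coercivity of \<open>Q\<close> bounds its smallest
  eigenvalue below, continuity of the Lyapunov solution bounds its largest one above. Small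
  directions thus allow a full step.\<close>

lemma qrnpo_step_size_eq_1:
  fixes A :: "real^'n^'n" and B :: "real^'m^'n"
  assumes z: "z \<in> stabilizing A B" and Q: "smooth_on (stabilizing A B) Q"
    and Qpos: "\<And>K. K \<in> stabilizing A B \<Longrightarrow> pos_def (Q K)"
  shows "\<exists>e>0. \<forall>\<^sub>F p in nhds z. \<forall>G. norm G < e \<longrightarrow> qrnpo_step_size A B Q p G = 1"
proof -
  let ?S = "stabilizing A B"
  define X where "X K = lyap (transpose (A + B ** K)) (Q K)" for K
  have stable: "schur_stable (transpose (A + B ** K))" if "K \<in> ?S" for K
    using that by (intro schur_stable_transpose) (simp add: stabilizing_def)
  have "Ck_on 0 X ?S"
    unfolding X_def
    by (rule Ck_on_lyap[OF open_stabilizing Ck_on_linear[OF open_stabilizing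
          Ck_on_closed_loop[OF open_stabilizing] transpose_bounded_linear] smooth_on_Ck[OF Q] stable])
  then have Xb: "\<forall>\<^sub>F p in nhds z. norm (X p) < norm (X z) + 1"
    by (intro eventually_nhds_norm_less Ck_on_tendsto_nhds[OF open_stabilizing z])
  have "(Q \<longlongrightarrow> Q z) (nhds z)" by (rule Ck_on_tendsto_nhds[OF open_stabilizing z smooth_on_Ck[OF Q, of 0]])
  then obtain q0 where q0: "q0 > 0" "\<forall>\<^sub>F p in nhds z. \<forall>v. q0 * (norm v)\<^sup>2 \<le> v \<bullet> (Q p *v v)"
    using pos_def_eventually_coercive[of "Q z" Q] Qpos[OF z] unfolding pos_def_def by blast
  obtain C where C: "C > 0" "\<And>(M :: real^'n^'n) v. norm (M *v v) \<le> C * norm M * norm v"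
    using matrix_vector_norm_bound by blast
  obtain Cs where Cs: "Cs > 0" "\<And>G :: real^'n^'m. norm (B ** G) \<le> norm G * Cs"
    using bounded_linear.pos_bounded[OF bounded_bilinear.bounded_linear_right[OF matrix_bilinear, of B]] by blast
  define l where "l = C * (norm (X z) + 1)"
  have l: "l > 0" unfolding l_def using C(1) by (intro mult_pos_pos) (auto intro: add_nonneg_pos)
  \<comment> \<open>\<open>e\<close> is the size of \<open>G\<close> at which the lower bound of the
    certificate equals 1.\<close>
  define e where "e = q0 / (2 * l * (C * Cs))"
  have e: "e > 0" using q0(1) l C(1) Cs(1) by (simp add: e_def)
  have "\<forall>\<^sub>F p in nhds z. p \<in> ?S" using open_stabilizing z by (rule eventually_nhds_in_open)
  with q0(2) Xb have "\<forall>\<^sub>F p in nhds z. \<forall>G. norm G < e \<longrightarrow> qrnpo_step_size A B Q p G = 1"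
  proof eventually_elim
    case (elim p)
    have Qp: "pos_def (Q p)" by (rule Qpos[OF elim(3)])
    have Xp: "pos_def (X p)"
      unfolding X_def by (rule schur_stable.lyap_pos_def[OF stable[OF elim(3)] Qp])
    \<comment> \<open>An attained eigenvalue has an eigenvector, and evaluating the quadratic form
      there turns coercivity into a bound on the eigenvalue.\<close>
    have "min_eigval (Q p) \<in> eigvals (Q p)"
      unfolding min_eigval_def using Qp
      by (intro Min_in finite_eigvals_real eigvals_symmetric_nonempty) (simp add: pos_def_def)
    then obtain v where v: "v \<noteq> 0" "v \<bullet> (Q p *v v) = min_eigval (Q p) * (norm v)\<^sup>2"
      by (rule eigval_quadratic_form)
    have "q0 * (norm v)\<^sup>2 \<le> min_eigval (Q p) * (norm v)\<^sup>2"
      using elim(1)[rule_format, of v] unfolding v(2) .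
    then have q: "q0 \<le> min_eigval (Q p)" using v(1) by simp
    have "max_eigval (X p) \<in> eigvals (X p)"
      unfolding max_eigval_def using Xp
      by (intro Max_in finite_eigvals_real eigvals_symmetric_nonempty) (simp add: pos_def_def)
    then obtain u where u: "u \<noteq> 0" "u \<bullet> (X p *v u) = max_eigval (X p) * (norm u)\<^sup>2"
      by (rule eigval_quadratic_form)
    have "0 < max_eigval (X p) * (norm u)\<^sup>2" using Xp u by (simp add: pos_def_def flip: u(2))
    then have m0: "0 < max_eigval (X p)" using u(1) by (simp add: zero_less_mult_iff)
    have "u \<bullet> (X p *v u) \<le> norm u * norm (X p *v u)" by (rule norm_cauchy_schwarz)
    also have "\<dots> \<le> norm u * (C * norm (X p) * norm u)" by (intro mult_left_mono C(2)) simp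
    also have "\<dots> \<le> norm u * (l * norm u)"
      using elim(2) C(1) unfolding l_def by (intro mult_left_mono mult_right_mono) auto
    finally have "max_eigval (X p) * (norm u)\<^sup>2 \<le> l * (norm u)\<^sup>2"
      unfolding u(2) by (simp add: power2_eq_square ac_simps)
    then have m1: "max_eigval (X p) \<le> l" using u(1) by simp
    show ?case
    proof (intro allI impI)
      fix G :: "real^'n^'m" assume G: "norm G < e"
      show "qrnpo_step_size A B Q p G = 1"
      proof (cases "B ** G = 0")
        case True
        then show ?thesis by (simp add: qrnpo_step_size_def stability_certificate_def)
      next
        case False
        have bl: "bounded_linear (\<lambda>v. (B ** G) *v v)" by (rule matrix_vector_mul_bounded_linear)
        have "\<not> (\<forall>v. (B ** G) *v v = 0)" using False matrix_eq[of "B ** G" 0] by simp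
        then have n0: "0 < spec_norm (B ** G)" unfolding spec_norm_def onorm_pos_lt[OF bl] .
        have "spec_norm (B ** G) \<le> C * norm (B ** G)"
          unfolding spec_norm_def by (rule onorm_le) (rule C(2))
        also have "\<dots> \<le> C * (norm G * Cs)" by (intro mult_left_mono Cs(2)) (use C in simp)
        finally have n1: "spec_norm (B ** G) \<le> C * Cs * norm G" by (simp add: ac_simps)
        have "2 * max_eigval (X p) * spec_norm (B ** G) \<le> 2 * l * (C * Cs * norm G)"
          using m0 m1 n0 n1 by (intro mult_mono) auto
        also have "\<dots> \<le> 2 * l * (C * Cs) * e"
          using G l C(1) Cs(1) by simp
        also have "\<dots> = q0" using l C(1) Cs(1) by (simp add: e_def)
        finally have "2 * max_eigval (X p) * spec_norm (B ** G) \<le> min_eigval (Q p)" using q by simp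
        then have "1 \<le> min_eigval (Q p) / (2 * max_eigval (X p) * spec_norm (B ** G))"
          using m0 n0 by simp
        then have "1 \<le> stability_certificate A B Q p G"
          using False by (simp add: stability_certificate_def X_def)
        then show ?thesis by (simp add: qrnpo_step_size_def min_absorb2)
      qed
    qed
  qed
  with e show ?thesis by blast
qed

text \<open>The Christoffel part is built from locally bounded operators weighted by the
  coefficients of \<open>w p\<close>, and these are of order \<open>norm (p - z)\<close> because
  \<open>w z = 0\<close>.\<close>

lemma (in connection_on) conn_smooth_field_near_zero:
  assumes S: "open S" "M \<subseteq> S" and w: "smooth_on S w" and wT: "\<And>q. q \<in> S \<Longrightarrow> w q \<in> T"
    and w'T: "\<And>q u. q \<in> S \<Longrightarrow> u \<in> T \<Longrightarrow> frechet_derivative w (at q) u \<in> T"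
    and z: "z \<in> M" "w z = 0"
  shows "\<exists>C\<ge>0. \<forall>\<^sub>F p in nhds z. p \<in> M \<longrightarrow>
    (\<forall>u\<in>T. norm (D w p u - frechet_derivative w (at p) u) \<le> C * norm (p - z) * norm u)"
proof -
  have w': "(w has_derivative frechet_derivative w (at q)) (at q)" if "q \<in> S" for q
    using Ck_on_Suc_has_derivative[OF smooth_on_Ck[OF w] that] .
  obtain K where K: "\<forall>\<^sub>F p in nhds z. norm (w p) \<le> K * norm (p - z)"
    using has_derivative_lipschitz_at[OF w'] z S(2) by force
  have "\<forall>b\<in>B. \<exists>C. \<forall>\<^sub>F p in nhds z. p \<in> M \<longrightarrow> (\<forall>u\<in>T. norm (D (\<lambda>_. b) p u) \<le> C * norm u)"
    using conn_const_bounded[OF z(1) B_in] by blast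
  from bchoice[OF this] obtain C where C: "\<And>b. b \<in> B \<Longrightarrow>
      \<forall>\<^sub>F p in nhds z. p \<in> M \<longrightarrow> (\<forall>u\<in>T. norm (D (\<lambda>_. b) p u) \<le> C b * norm u)" by blast
  have "\<forall>\<^sub>F p in nhds z. \<forall>b\<in>B. p \<in> M \<longrightarrow> (\<forall>u\<in>T. norm (D (\<lambda>_. b) p u) \<le> C b * norm u)"
    by (intro eventually_ball_finite finite_B ballI C)
  with K have "\<forall>\<^sub>F p in nhds z. p \<in> M \<longrightarrow> (\<forall>u\<in>T. norm (D w p u - frechet_derivative w (at p) u)
      \<le> (\<Sum>b\<in>B. \<bar>K\<bar> * \<bar>C b\<bar>) * norm (p - z) * norm u)"
  proof eventually_elim
    case (elim p)
    show ?case
    proof (intro impI ballI)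
      fix u assume p: "p \<in> M" and u: "u \<in> T"
      have pS: "p \<in> S" using p S(2) by blast
      have "D w p u - frechet_derivative w (at p) u = (\<Sum>b\<in>B. (w p \<bullet> b) *\<^sub>R D (\<lambda>_. b) p u)"
        using conn_smooth_field[OF S w wT w'[OF pS] w'T[OF pS u] p u] by simp
      also have "norm \<dots> \<le> (\<Sum>b\<in>B. (\<bar>K\<bar> * norm (p - z)) * (\<bar>C b\<bar> * norm u))"
      proof (rule sum_norm_le)
        fix b assume b: "b \<in> B"
        have "\<bar>w p \<bullet> b\<bar> \<le> norm (w p)" using Cauchy_Schwarz_ineq2[of "w p" b] unit[OF b] by simp
        also have "\<dots> \<le> \<bar>K\<bar> * norm (p - z)"
          using elim(1) by (meson abs_ge_self mult_right_mono norm_ge_zero order_trans)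
        finally have 1: "\<bar>w p \<bullet> b\<bar> \<le> \<bar>K\<bar> * norm (p - z)" .
        have "norm (D (\<lambda>_. b) p u) \<le> C b * norm u" using elim(2) b p u by blast
        then have 2: "norm (D (\<lambda>_. b) p u) \<le> \<bar>C b\<bar> * norm u"
          by (meson abs_ge_self mult_right_mono norm_ge_zero order_trans)
        show "norm ((w p \<bullet> b) *\<^sub>R D (\<lambda>_. b) p u) \<le> (\<bar>K\<bar> * norm (p - z)) * (\<bar>C b\<bar> * norm u)"
          using mult_mono[OF 1 2] by simp
      qed
      also have "\<dots> = (\<Sum>b\<in>B. \<bar>K\<bar> * \<bar>C b\<bar>) * norm (p - z) * norm u"
        unfolding sum_distrib_right by (rule sum.cong) (simp_all add: ac_simps)
      finally show "norm (D w p u - frechet_derivative w (at p) u)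
        \<le> (\<Sum>b\<in>B. \<bar>K\<bar> * \<bar>C b\<bar>) * norm (p - z) * norm u" .
    qed
  qed
  then show ?thesis by (intro exI[of _ "\<Sum>b\<in>B. \<bar>K\<bar> * \<bar>C b\<bar>"] conjI sum_nonneg) auto
qed

text \<open>The two smallness conditions serve different purposes:
  \<open>C * \<epsilon> \<le> 1 / 2\<close> contracts the norm, while the other absorbs the factor
  \<open>c2 / c1\<close> lost between the norm and \<open>d\<close>, which keeps the rate
  \<open>1 / 2\<close> in \<open>d\<close> at every step.\<close>

lemma quadratic_recursion_rates:
  fixes K :: "nat \<Rightarrow> 'a::real_normed_vector" and d :: "'a \<Rightarrow> 'a \<Rightarrow> ennreal"
  assumes c: "c1 > 0" "c2 > 0" "C > 0"
    and near: "\<And>t. norm (K t - z) < \<epsilon>"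
    and step: "\<And>t. norm (K (Suc t) - z) \<le> C * (norm (K t - z))\<^sup>2"
    and low: "\<And>t. ennreal (c1 * norm (K t - z)) \<le> d (K t) z"
    and up: "\<And>t. d (K t) z \<le> ennreal (c2 * norm (K t - z))"
    and small: "C * \<epsilon> \<le> 1 / 2" "c2 * (C * \<epsilon>) \<le> c1 / 2"
  shows "K \<longlonglongrightarrow> z" "linear_rate d K z" "eventual_quadratic_rate d K z"
proof -
  have lin: "norm (K (Suc t) - z) \<le> C * \<epsilon> * norm (K t - z)" for t
  proof -
    have "norm (K (Suc t) - z) \<le> C * (norm (K t - z) * norm (K t - z))"
      using step[of t] by (simp add: power2_eq_square)
    also have "\<dots> \<le> C * (\<epsilon> * norm (K t - z))"
      using near[of t] c by (intro mult_left_mono mult_right_mono) auto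
    finally show ?thesis by (simp add: ac_simps)
  qed
  have half: "norm (K (Suc t) - z) \<le> 1 / 2 * norm (K t - z)" for t
    using lin[of t] mult_right_mono[OF small(1) norm_ge_zero[of "K t - z"]] by linarith
  have "(\<lambda>t. norm (K t - z)) \<longlonglongrightarrow> 0"
    by (rule contraction_recursion_tendsto_0[where r = "1/2" and y = "\<lambda>_. 0"]) (use half in auto)
  then show "K \<longlonglongrightarrow> z" by (simp add: tendsto_norm_zero_iff LIM_zero_iff)
  have "d (K (Suc t)) z \<le> ennreal (1 / 2) * d (K t) z" for t
  proof -
    have "d (K (Suc t)) z \<le> ennreal (c2 * norm (K (Suc t) - z))" by (rule up)
    also have "c2 * norm (K (Suc t) - z) \<le> c2 * (C * \<epsilon>) * norm (K t - z)"
      using mult_left_mono[OF lin[of t], of c2] c by (simp add: ac_simps)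
    also have "\<dots> \<le> 1 / 2 * (c1 * norm (K t - z))"
      using mult_right_mono[OF small(2) norm_ge_zero[of "K t - z"]] by simp
    finally have "d (K (Suc t)) z \<le> ennreal (1 / 2 * (c1 * norm (K t - z)))" by (simp add: ennreal_leI)
    also have "\<dots> = ennreal (1 / 2) * ennreal (c1 * norm (K t - z))" using c by (intro ennreal_mult) auto
    also have "\<dots> \<le> ennreal (1 / 2) * d (K t) z" by (intro mult_left_mono low) simp
    finally show ?thesis .
  qed
  moreover have "d (K t) z < \<infinity>" for t using up[of t] by (simp add: le_less_trans)
  ultimately show "linear_rate d K z" unfolding linear_rate_def by (intro conjI allI exI[of _ "1/2"]) auto
  \<comment> \<open>The square of \<open>c1\<close> enters because the norm is replaced by at most
    \<open>d / c1\<close> before squaring.\<close>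
  have "d (K (Suc t)) z \<le> ennreal (c2 * C / c1\<^sup>2) * (d (K t) z)\<^sup>2" for t
  proof -
    have "d (K (Suc t)) z \<le> ennreal (c2 * norm (K (Suc t) - z))" by (rule up)
    also have "\<dots> \<le> ennreal (c2 * C / c1\<^sup>2 * (c1 * norm (K t - z))\<^sup>2)"
      using mult_left_mono[OF step[of t], of c2] c by (intro ennreal_leI) (simp add: power_mult_distrib)
    also have "\<dots> = ennreal (c2 * C / c1\<^sup>2) * (ennreal (c1 * norm (K t - z)))\<^sup>2"
    proof -
      have "(ennreal (c1 * norm (K t - z)))\<^sup>2 = ennreal ((c1 * norm (K t - z))\<^sup>2)"
        using c by (intro ennreal_power) simp
      then show ?thesis using c ennreal_mult[of "c2 * C / c1\<^sup>2" "(c1 * norm (K t - z))\<^sup>2"] by simp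
    qed
    also have "\<dots> \<le> ennreal (c2 * C / c1\<^sup>2) * (d (K t) z)\<^sup>2"
      by (intro mult_left_mono power_mono low) auto
    finally show ?thesis .
  qed
  then show "eventual_quadratic_rate d K z"
    unfolding eventual_quadratic_rate_def using c
    by (intro exI[of _ "c2 * C / c1\<^sup>2"]) auto
qed

lemma subspace_direction_space:
  assumes "affine L" "L \<noteq> {}" shows "subspace (direction_space L)"
  unfolding subspace_def
proof (intro conjI ballI allI)
  show "0 \<in> direction_space L" using assms(2) by (force simp: direction_space_def)
next
  fix u v assume "u \<in> direction_space L" "v \<in> direction_space L"
  then obtain x y x' y' where *: "u = x - y" "v = x' - y'" "x \<in> L" "y \<in> L" "x' \<in> L" "y' \<in> L"
    by (auto simp: direction_space_def)
  have "x + 1 *\<^sub>R (x' - y') \<in> L" using assms(1) * by (intro mem_affine_3_minus)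
  then show "u + v \<in> direction_space L" unfolding direction_space_def * using *(4) by force
next
  fix c and u assume "u \<in> direction_space L"
  then obtain x y where *: "u = x - y" "x \<in> L" "y \<in> L" by (auto simp: direction_space_def)
  have "y + c *\<^sub>R (x - y) \<in> L" using assms(1) * by (intro mem_affine_3_minus)
  then show "c *\<^sub>R u \<in> direction_space L" unfolding direction_space_def * using *(3) by force
qed

lemma affine_add_direction_space:
  "affine L \<Longrightarrow> x \<in> L \<Longrightarrow> u \<in> direction_space L \<Longrightarrow> x + u \<in> L"
  using mem_affine_3_minus[of L x _ _ 1] by (auto simp: direction_space_def)

text \<open>Fermat's rule on the line through \<open>z\<close> in direction \<open>u\<close>, which
  lies in the affine set and, for small times, in \<open>S\<close>.\<close>

lemma dird_local_min_eq_0: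
  assumes S: "open S" "z \<in> S" and f: "(f has_derivative f') (at z)" and L: "affine L"
    and min: "local_min_on (S \<inter> L) f z" and u: "u \<in> direction_space L"
  shows "dird f z u = 0"
proof -
  obtain N where N: "open N" "z \<in> N" "\<forall>q\<in>S \<inter> L \<inter> N. f z \<le> f q" "z \<in> L"
    using min by (auto simp: local_min_on_def)
  have d: "DERIV (\<lambda>t. f (z + t *\<^sub>R u)) 0 :> f' u"
    using line_has_vector_derivative[OF f, of u] by (simp add: has_real_derivative_iff_has_vector_derivative)
  have "((\<lambda>t::real. z + t *\<^sub>R u) \<longlongrightarrow> z + 0 *\<^sub>R u) (nhds 0)"
    by (intro tendsto_intros filterlim_ident)
  then have "\<forall>\<^sub>F t in nhds (0::real). z + t *\<^sub>R u \<in> S \<inter> N"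
    using S N by (intro topological_tendstoD[where S = "S \<inter> N"]) auto
  then obtain e where e: "e > 0" "\<And>t. dist t 0 < e \<Longrightarrow> z + t *\<^sub>R u \<in> S \<inter> N"
    unfolding eventually_nhds_metric by blast
  have uL: "z + t *\<^sub>R u \<in> L" for t
    using affine_add_direction_space[OF L N(4)] subspace_scale[OF subspace_direction_space[OF L] u] N(4)
    by blast
  have "f' u = 0"
    using e uL N(3) by (intro DERIV_local_min[OF d e(1)]) (auto simp: dist_real_def)
  then show ?thesis using dird_eq[OF f] by metis
qed

lemma power2_norm_rows: "(norm u)\<^sup>2 = (\<Sum>i\<in>UNIV. (norm (u $ i))\<^sup>2)" for u :: "real^'n^'m"
  by (simp add: power2_norm_eq_inner inner_vec_def[of u])

text \<open>Coercivity of \<open>Y p\<close> on each row gives the lower bound, boundedness of the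
  matrix product the upper one. The constants appear as squares because their roots are the factors
  in the comparison of distances.\<close>

lemma row_form_bounds:
  fixes Y :: "'a::topological_space \<Rightarrow> real^'n^'n"
  assumes Y: "(Y \<longlongrightarrow> Y z) (nhds z)" and pd: "pos_def (Y z)" and sym: "\<forall>\<^sub>F p in nhds z. transpose (Y p) = Y p"
  shows "\<exists>c1>0. \<exists>c2>0. \<forall>\<^sub>F p in nhds z. \<forall>u :: real^'n^'m.
    c1\<^sup>2 * (norm u)\<^sup>2 \<le> (u ** Y p) \<bullet> u \<and> (u ** Y p) \<bullet> u \<le> c2\<^sup>2 * (norm u)\<^sup>2"
proof -
  obtain c where c: "c > 0" "\<forall>\<^sub>F p in nhds z. \<forall>v. c * (norm v)\<^sup>2 \<le> v \<bullet> (Y p *v v)"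
    using pos_def_eventually_coercive[OF _ Y] pd unfolding pos_def_def by blast
  obtain K where K: "K > 0" "\<And>(u :: real^'n^'m) (M :: real^'n^'n). norm (u ** M) \<le> norm u * norm M * K"
    using bounded_bilinear.pos_bounded[OF matrix_bilinear] by blast
  define C where "C = (norm (Y z) + 1) * K"
  have C: "C > 0" unfolding C_def using K(1) by (intro mult_pos_pos) (auto intro: add_nonneg_pos)
  have "\<forall>\<^sub>F p in nhds z. \<forall>u :: real^'n^'m.
      (sqrt c)\<^sup>2 * (norm u)\<^sup>2 \<le> (u ** Y p) \<bullet> u \<and> (u ** Y p) \<bullet> u \<le> (sqrt C)\<^sup>2 * (norm u)\<^sup>2"
    using c(2) eventually_nhds_norm_less[OF Y] sym
  proof eventually_elim
    case (elim p)
    show ?case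
    proof (intro allI conjI)
      fix u :: "real^'n^'m"
      have "c * (norm u)\<^sup>2 = (\<Sum>i\<in>UNIV. c * (norm (u $ i))\<^sup>2)"
        by (simp add: power2_norm_rows sum_distrib_left)
      also have "\<dots> \<le> (\<Sum>i\<in>UNIV. (Y p *v (u $ i)) \<bullet> (u $ i))"
        using elim(1) by (intro sum_mono) (simp add: inner_commute)
      also have "\<dots> = (u ** Y p) \<bullet> u" by (simp only: inner_matrix_mul_right elim(3))
      finally show "(sqrt c)\<^sup>2 * (norm u)\<^sup>2 \<le> (u ** Y p) \<bullet> u" using c(1) by simp
      have "(u ** Y p) \<bullet> u \<le> norm (u ** Y p) * norm u" by (rule norm_cauchy_schwarz)
      also have "\<dots> \<le> (norm u * norm (Y p) * K) * norm u" by (intro mult_right_mono K(2)) simp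
      also have "\<dots> \<le> (norm u * (norm (Y z) + 1) * K) * norm u"
        using elim(2) K(1) by (intro mult_right_mono mult_left_mono) auto
      finally show "(u ** Y p) \<bullet> u \<le> (sqrt C)\<^sup>2 * (norm u)\<^sup>2"
        using C by (simp add: C_def power2_eq_square ac_simps)
    qed
  qed
  moreover have "sqrt c > 0" "sqrt C > 0" using c C by auto
  ultimately show ?thesis by blast
qed

theorem mainTheorem1:
  fixes A :: "real^'n^'n" and B :: "real^'m^'n"
    and \<Sigma>1 :: "real^'n^'n" and \<Sigma>2 :: "real^'m^'m"
    and Q :: "real^'n^'m \<Rightarrow> real^'n^'n"
    and f :: "real^'n^'m \<Rightarrow> real"
    and L S S' T :: "(real^'n^'m) set"
    and g :: "real^'n^'m \<Rightarrow> real^'n^'m \<Rightarrow> real^'n^'m \<Rightarrow> real"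
    and D :: "(real^'n^'m \<Rightarrow> real^'n^'m) \<Rightarrow> real^'n^'m \<Rightarrow> real^'n^'m \<Rightarrow> real^'n^'m"
    and H :: "real^'n^'m \<Rightarrow> real^'n^'m \<Rightarrow> real^'n^'m"
    and Kstar :: "real^'n^'m"
  defines "S \<equiv> stabilizing A B"
    and "S' \<equiv> S \<inter> L"
    and "T \<equiv> direction_space L"
    and "g \<equiv> lyap_metric A B \<Sigma>1 \<Sigma>2"
  assumes "stabilizable A B"
    and "pos_semidef \<Sigma>1" and "pos_semidef \<Sigma>2"
    and "\<And>K. K \<in> S \<Longrightarrow> \<exists>R. is_psd_sqrt R (cost_weight \<Sigma>1 \<Sigma>2 K) \<and> controllable (A + B ** K) R"
    and "affine L"
    and "smooth_on S f"
    and "smooth_on S Q" and "\<And>K. K \<in> S \<Longrightarrow> pos_def (Q K)"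
    and "levi_civita S' T g D"
    and "local_min_on S' f Kstar"
    and "nondegenerate T g (riem_hess D T g f) Kstar"
    and "H = riem_hess D T g f \<or> H = eucl_hess T g f"
  shows "\<exists>U. openin (top_of_set S') U \<and> Kstar \<in> U \<and>
    (\<forall>K0\<in>U.
       (\<exists>!K. qrnpo_sequence A B Q T (riem_grad T g f) H K0 K) \<and>
       (\<forall>K. qrnpo_sequence A B Q T (riem_grad T g f) H K0 K \<longrightarrow>
          (\<forall>t. K t \<in> U) \<and>
          K \<longlonglongrightarrow> Kstar \<and>
          linear_rate (riem_dist S' g) K Kstar \<and>
          eventual_quadratic_rate (riem_dist S' g) K Kstar))"
proof -

  \<comment> \<open>The trace metric, its gradient field and the connection\<close>
  define M where "M K = A + B ** K" for K
  define Z where "Z = cost_weight \<Sigma>1 \<Sigma>2"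
  define Y where "Y K = lyap (M K) (Z K)" for K
  define w where "w = riem_grad T g f"
  have S: "open S" unfolding S_def by (rule open_stabilizing)
  have z: "Kstar \<in> S" "Kstar \<in> L" "Kstar \<in> S'"
    using \<open>local_min_on S' f Kstar\<close> by (auto simp: local_min_on_def S'_def)
  have T: "subspace T" unfolding T_def using \<open>affine L\<close> z(2) by (intro subspace_direction_space) auto
  have LT: "p + u \<in> L" if "p \<in> L" "u \<in> T" for p u
    using affine_add_direction_space[OF \<open>affine L\<close>] that unfolding T_def by blast
  have stable: "schur_stable (M K)" if "K \<in> S" for K
    using that by (intro schur_stable_of_spec_radius) (simp add: S_def stabilizing_def M_def)
  \<comment> \<open>Controllability enters here: it makes the Gramian \<open>Y K\<close> definite
    and thereby the trace form an inner product.\<close>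
  have Ypd: "pos_def (Y K)" if "K \<in> S" for K
    using schur_stable.lyap_pos_def_of_controllable[OF stable[OF that]] assms(8)[OF that]
    unfolding Y_def M_def Z_def by blast
  then have Ysym: "transpose (Y K) = Y K" if "K \<in> S" for K using that unfolding pos_def_def by blast
  have Zs: "Ck_on k Z S" for k
    unfolding Z_def cost_weight_def
    by (intro Ck_on_add[OF S] Ck_on_const S Ck_on_bilinear[OF S matrix_bilinear] Ck_on_ident
        Ck_on_linear[OF S _ transpose_bounded_linear])
  have Ys: "Ck_on k Y S" for k
    unfolding Y_def
    by (rule Ck_on_lyap[OF S _ Zs stable]) (simp_all add: M_def Ck_on_closed_loop[OF S])
  obtain Bs where "orthonormal_basis T Bs" using orthonormal_basis_exists[OF T] by blast
  then interpret orthonormal_basis T Bs .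
  \<comment> \<open>The trace form is the entrywise inner product of \<open>u\<close> with
    \<open>v ** Y K\<close>; symmetry of \<open>Y K\<close> moves this factor to \<open>u\<close>,
    so right multiplication by \<open>Y K\<close> is the Gram operator.\<close>
  interpret coercive_metric T Bs S "\<lambda>K u. u ** Y K" g
  proof (intro coercive_metric.intro coercive_metric_axioms.intro)
    show "orthonormal_basis T Bs" by (rule orthonormal_basis_axioms)
    show "linear (\<lambda>u :: real^'n^'m. u ** Y K)" for K
      by (rule bounded_linear.linear[OF bounded_bilinear.bounded_linear_left[OF matrix_bilinear]])
    show "0 < (u ** Y K) \<bullet> u" if "K \<in> S" "u \<noteq> 0" for K and u :: "real^'n^'m"
    proof -
      obtain i where i: "u $ i \<noteq> 0" using \<open>u \<noteq> 0\<close> by (auto simp: vec_eq_iff)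
      have nn: "0 \<le> (Y K *v v) \<bullet> v" for v
        using Ypd[OF that(1)] by (cases "v = 0") (auto simp: pos_def_def inner_commute less_imp_le)
      have "0 < (Y K *v (u $ i)) \<bullet> (u $ i)"
        using Ypd[OF that(1)] i by (simp add: pos_def_def inner_commute)
      also have "\<dots> \<le> (\<Sum>i\<in>UNIV. (Y K *v (u $ i)) \<bullet> (u $ i))" by (rule member_le_sum) (auto simp: nn)
      finally show ?thesis by (simp only: inner_matrix_mul_right Ysym[OF that(1)])
    qed
    show "smooth_on S (\<lambda>K. u ** Y K)" for u :: "real^'n^'m"
      unfolding smooth_on_def
      by (intro allI Ck_on_linear[OF S Ys] bounded_bilinear.bounded_linear_right[OF matrix_bilinear])
    show "g K u v = (u ** Y K) \<bullet> v" if "K \<in> S" for K and u v :: "real^'n^'m"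
    proof -
      have "g K u v = u \<bullet> (v ** Y K)"
        unfolding g_def lyap_metric_def Y_def M_def Z_def matrix_mul_assoc[symmetric]
        by (rule trace_transpose_mult)
      also have "\<dots> = (u ** Y K) \<bullet> v"
        unfolding inner_commute[of u] inner_matrix_mul_right Ysym[OF that]
        using inner_symmetric_matrix[OF Ysym[OF that]] by (simp add: inner_commute)
      finally show ?thesis .
    qed
  qed (rule S)
  have f: "smooth_on S f" by fact
  note w_smooth = riem_grad_smooth[OF f, folded w_def]
  note w_in = riem_grad_sys(2)[OF f, folded w_def]
  note dw_in = riem_grad_deriv_in[OF f, folded w_def]
  define w' where "w' p = frechet_derivative w (at p)" for p
  have w': "(w has_derivative w' p) (at p)" if "p \<in> S" for p
    unfolding w'_def using Ck_on_Suc_has_derivative[OF smooth_on_Ck[OF w_smooth] that] .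
  have w'_in: "w' p u \<in> T" if "p \<in> S" for p u unfolding w'_def by (rule dw_in[OF that])
  have fz: "(f has_derivative frechet_derivative f (at Kstar)) (at Kstar)"
    using Ck_on_Suc_has_derivative[OF smooth_on_Ck[OF f] z(1)] .
  \<comment> \<open>At the minimum the differential vanishes on \<open>T\<close>, so the gradient is
    a tangent vector orthogonal to all of \<open>T\<close>.\<close>
  have wz: "w Kstar = 0"
  proof (rule tangent_eq_0[OF z(1) w_in[OF z(1)]])
    fix u assume "u \<in> T"
    then show "g Kstar (w Kstar) u = 0"
      using riem_grad_sys(3)[OF f z(1), folded w_def] dird_local_min_eq_0[OF S z(1) fz \<open>affine L\<close>]
        \<open>local_min_on S' f Kstar\<close> by (simp add: S'_def T_def)
  qed
  interpret connection_on T Bs S' D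
    using \<open>levi_civita S' T g D\<close> by unfold_locales (simp add: levi_civita_def)
  have S'S: "S' \<subseteq> S" by (simp add: S'_def)
  have w_field: "vector_field S' T w"
    using w_in S'S by (auto simp: vector_field_def intro!: smooth_relI[OF S S'S w_smooth])

  \<comment> \<open>Both Hessians near the minimum\<close>
  have Heq: "H = (\<lambda>p u. D w p u) \<or> H = eucl_hess T g f"
    using \<open>H = riem_hess D T g f \<or> H = eucl_hess T g f\<close>
    by (auto simp: riem_hess_def w_def fun_eq_iff)
  have eucl: "eucl_hess T g f p u = w' p u" if "p \<in> S" for p u
    unfolding w'_def w_def by (rule eucl_hess_eq[OF f that])
  have H_add: "H p (u + v) = H p u + H p v" if "p \<in> S'" "u \<in> T" "v \<in> T" for p u v
    using Heq
  proof
    assume "H = (\<lambda>p u. D w p u)"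
    then show ?thesis using conn_lin[OF w_field that, of 1 1] by simp
  next
    assume "H = eucl_hess T g f"
    then show ?thesis using eucl linear_add[OF has_derivative_linear[OF w']] that(1) S'S by auto
  qed
  have H_scale: "H p (c *\<^sub>R u) = c *\<^sub>R H p u" if "p \<in> S'" "u \<in> T" for p c u
    using Heq
  proof
    assume "H = (\<lambda>p u. D w p u)"
    then show ?thesis using conn_lin[OF w_field that(1,2,2), of c 0] by simp
  next
    assume "H = eucl_hess T g f"
    then show ?thesis using eucl linear_scale[OF has_derivative_linear[OF w']] that(1) S'S by auto
  qed
  have H_in: "H p u \<in> T" if "p \<in> S'" "u \<in> T" for p u
    using Heq
  proof
    assume "H = (\<lambda>p u. D w p u)"
    \<comment> \<open>The closure axiom, used with the constant field \<open>u\<close> as direction,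
      says that covariant derivatives of \<open>w\<close> are tangent.\<close>
    then show ?thesis
      using conn_field[OF vector_field_const[OF that(2)] w_field] that(1) by (simp add: vector_field_def)
  next
    assume "H = eucl_hess T g f"
    then show ?thesis using eucl w'_in that(1) S'S by auto
  qed
  obtain C0 where C0: "C0 \<ge> 0" "\<forall>\<^sub>F p in nhds Kstar. p \<in> S' \<longrightarrow>
      (\<forall>u\<in>T. norm (D w p u - w' p u) \<le> C0 * norm (p - Kstar) * norm u)"
    using conn_smooth_field_near_zero[OF S S'S w_smooth w_in dw_in z(3) wz] unfolding w'_def by blast
  obtain C1 where C1: "C1 \<ge> 0" "\<forall>\<^sub>F p in nhds Kstar.
      \<forall>u. norm (w' p u - w' Kstar u) \<le> C1 * norm (p - Kstar) * norm u"
    using smooth_on_derivative_lipschitz_at[OF S z(1) w_smooth] unfolding w'_def by blast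
  obtain C2 where C2: "C2 \<ge> 0" "\<forall>\<^sub>F p in nhds Kstar.
      norm (w p - w Kstar - w' Kstar (p - Kstar)) \<le> C2 * (norm (p - Kstar))\<^sup>2"
    using smooth_on_second_order[OF S z(1) w_smooth] unfolding w'_def by blast
  \<comment> \<open>\<open>C0\<close> pays for the Christoffel term, which is absent in the
    Euclidean case, and \<open>C1\<close> for moving the base point of the derivative to
    \<open>Kstar\<close>.\<close>
  have HW: "\<forall>\<^sub>F p in nhds Kstar. p \<in> S' \<longrightarrow>
      (\<forall>u\<in>T. norm (H p u - w' Kstar u) \<le> (C0 + C1) * norm (p - Kstar) * norm u)"
    using C0(2) C1(2)
  proof eventually_elim
    case (elim p)
    show ?case
    proof (intro impI ballI)
      fix u assume p: "p \<in> S'" and u: "u \<in> T"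
      have "norm (H p u - w' p u) \<le> C0 * norm (p - Kstar) * norm u"
        using Heq elim(1) p u eucl S'S C0(1) by auto
      moreover have "norm (w' p u - w' Kstar u) \<le> C1 * norm (p - Kstar) * norm u" using elim(2) by blast
      moreover have "norm (H p u - w' Kstar u) \<le> norm (H p u - w' p u) + norm (w' p u - w' Kstar u)"
        using norm_triangle_ineq[of "H p u - w' p u" "w' p u - w' Kstar u"] by simp
      ultimately show "norm (H p u - w' Kstar u) \<le> (C0 + C1) * norm (p - Kstar) * norm u"
        by (simp add: algebra_simps)
    qed
  qed
  \<comment> \<open>The Christoffel term vanishes at \<open>Kstar\<close> because
    \<open>w Kstar = 0\<close>, so Riemannian nondegeneracy is a statement about
    \<open>w' Kstar\<close> and serves the Euclidean variant too.\<close>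
  have W_inj: "u = 0" if u: "u \<in> T" "w' Kstar u = 0" for u
  proof -
    have "D w Kstar u = 0"
      using conn_smooth_field[OF S S'S w_smooth w_in w'[OF z(1)] w'_in[OF z(1)] z(3) u(1)] u(2) wz by simp
    then have "riem_hess D T g f Kstar u = 0" by (simp add: riem_hess_def w_def)
    then show ?thesis
      using \<open>nondegenerate T g (riem_hess D T g f) Kstar\<close> u(1) z(1)
      by (auto simp: nondegenerate_def g_eq linear_0[OF a_linear])
  qed
  have "p - Kstar \<in> T" if "p \<in> S'" for p
    using that z(2) by (auto simp: T_def direction_space_def S'_def)
  then obtain C where C: "C > 0" "\<forall>\<^sub>F p in nhds Kstar. p \<in> S' \<longrightarrow>
      (\<exists>!G. newton_direction T w H p G) \<and>
      (\<forall>G. newton_direction T w H p G \<longrightarrow> norm (p + G - Kstar) \<le> C * (norm (p - Kstar))\<^sup>2)"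
    using newton_step_quadratic[where W = "w' Kstar" and H = H and w = w and M = S' and z = Kstar
        and ?C1.0 = C2 and ?C2.0 = "C0 + C1"]
      has_derivative_bounded_linear[OF w'[OF z(1)]] W_inj C2 HW H_add H_scale H_in w_in C0(1) C1(1) S'S
    by (simp add: wz subset_iff) blast
  obtain e where e: "e > 0" "\<forall>\<^sub>F p in nhds Kstar. \<forall>G. norm G < e \<longrightarrow> qrnpo_step_size A B Q p G = 1"
    using qrnpo_step_size_eq_1[of Kstar A B Q] z(1) assms(11,12) unfolding S_def by blast
  have evS: "\<forall>\<^sub>F p in nhds Kstar. p \<in> S" using S z(1) by (rule eventually_nhds_in_open)
  then have "\<forall>\<^sub>F p in nhds Kstar. transpose (Y p) = Y p" by eventually_elim (rule Ysym)
  from row_form_bounds[where ?'m = 'm, OF Ck_on_tendsto_nhds[OF S z(1) Ys[of 0]] Ypd[OF z(1)] this]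
  obtain c1 c2 where c: "c1 > 0" "c2 > 0" "\<forall>\<^sub>F p in nhds Kstar. \<forall>u :: real^'n^'m.
      c1\<^sup>2 * (norm u)\<^sup>2 \<le> (u ** Y p) \<bullet> u \<and> (u ** Y p) \<bullet> u \<le> c2\<^sup>2 * (norm u)\<^sup>2" by blast
  \<comment> \<open>All estimates valid near \<open>Kstar\<close> are bundled so that a single
    radius \<open>d\<close> covers them.\<close>
  define good where "good p \<longleftrightarrow> p \<in> S \<and> (\<forall>u :: real^'n^'m.
      c1\<^sup>2 * (norm u)\<^sup>2 \<le> g p u u \<and> g p u u \<le> c2\<^sup>2 * (norm u)\<^sup>2) \<and>
      (p \<in> S' \<longrightarrow> (\<exists>!G. newton_direction T w H p G) \<and>
        (\<forall>G. newton_direction T w H p G \<longrightarrow> norm (p + G - Kstar) \<le> C * (norm (p - Kstar))\<^sup>2)) \<and>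
      (\<forall>G. norm G < e \<longrightarrow> qrnpo_step_size A B Q p G = 1)" for p
  from evS c(3) C(2) e(2) have "\<forall>\<^sub>F p in nhds Kstar. good p"
    unfolding good_def by eventually_elim (simp add: g_eq)
  then obtain d where d: "d > 0" and good: "\<And>p. dist p Kstar < d \<Longrightarrow> good p"
    unfolding eventually_nhds_metric by blast
  have near: "p \<in> S" "c1\<^sup>2 * (norm u)\<^sup>2 \<le> g p u u" "g p u u \<le> c2\<^sup>2 * (norm u)\<^sup>2"
    "p \<in> S' \<Longrightarrow> \<exists>!G. newton_direction T w H p G"
    "p \<in> S' \<Longrightarrow> newton_direction T w H p G \<Longrightarrow> norm (p + G - Kstar) \<le> C * (norm (p - Kstar))\<^sup>2"
    "norm G < e \<Longrightarrow> qrnpo_step_size A B Q p G = 1" if "dist p Kstar < d" for p u G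
    using good[OF that] unfolding good_def by blast+
  \<comment> \<open>\<open>d\<close> secures the local estimates, \<open>e / 2\<close> pushes the
    Newton direction below the threshold \<open>e\<close> for full steps, and the last two bounds
    are the smallness conditions for the rates.\<close>
  define \<epsilon> where "\<epsilon> = min (min d (e / 2)) (min (1 / (2 * C)) (c1 / (2 * c2 * C)))"
  have \<epsilon>: "\<epsilon> > 0" "\<epsilon> \<le> d" "\<epsilon> \<le> e / 2" "C * \<epsilon> \<le> 1 / 2" "c2 * (C * \<epsilon>) \<le> c1 / 2"
  proof -
    have "\<epsilon> \<le> 1 / (2 * C)" "\<epsilon> \<le> c1 / (2 * c2 * C)" by (auto simp: \<epsilon>_def)
    then show "C * \<epsilon> \<le> 1 / 2" "c2 * (C * \<epsilon>) \<le> c1 / 2"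
      using C(1) c by (auto simp: field_simps)
  qed (use d e C(1) c in \<open>auto simp: \<epsilon>_def\<close>)

  \<comment> \<open>The iteration inside the neighbourhood\<close>
  define U where "U = S' \<inter> ball Kstar \<epsilon>"
  have U: "p \<in> S'" "norm (p - Kstar) < \<epsilon>" "dist p Kstar < d" if "p \<in> U" for p
    using that \<epsilon>(2) by (auto simp: U_def dist_norm norm_minus_commute)
  \<comment> \<open>A full step does not increase the error, so \<open>G\<close>, a difference of
    two error vectors, has norm below \<open>2 * \<epsilon> \<le> e\<close> and the step size is 1.
    The new point stays in \<open>L\<close> since \<open>G\<close> is a direction of
    \<open>L\<close>, and in \<open>S\<close> since the ball of radius \<open>d\<close> lies
    there.\<close>
  have step: "p + qrnpo_step_size A B Q p G *\<^sub>R G = p + G"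
      "norm (p + G - Kstar) \<le> C * (norm (p - Kstar))\<^sup>2" "p + G \<in> U"
    if p: "p \<in> U" and G: "newton_direction T w H p G" for p G
  proof -
    show q: "norm (p + G - Kstar) \<le> C * (norm (p - Kstar))\<^sup>2" by (rule near(5)[OF U(3,1) G, OF p p])
    also have "\<dots> \<le> C * \<epsilon> * norm (p - Kstar)"
      using U(2)[OF p] C(1) by (simp add: power2_eq_square mult_right_mono)
    also have "\<dots> \<le> 1 / 2 * norm (p - Kstar)" using \<epsilon>(4) by (rule mult_right_mono) simp
    finally have le: "norm (p + G - Kstar) \<le> norm (p - Kstar)"
      using norm_ge_zero[of "p - Kstar"] by linarith
    have "norm G \<le> norm (p + G - Kstar) + norm (p - Kstar)"
      using norm_triangle_ineq4[of "p + G - Kstar" "p - Kstar"] by simp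
    also have "\<dots> < e" using le U(2)[OF p] \<epsilon>(3) by simp
    finally show "p + qrnpo_step_size A B Q p G *\<^sub>R G = p + G" using near(6)[OF U(3)[OF p]] by simp
    have "dist (p + G) Kstar < \<epsilon>" using le U(2)[OF p] by (simp add: dist_norm)
    moreover have "p + G \<in> L" using LT U(1)[OF p] G by (auto simp: S'_def newton_direction_def)
    ultimately show "p + G \<in> U" using near(1)[of "p + G"] \<epsilon>(2) by (auto simp: U_def S'_def dist_commute)
  qed
  have low: "ennreal (c1 * norm (p - Kstar)) \<le> riem_dist S' g p Kstar" if "p \<in> U" for p
    using U(3)[OF that] near(2) c(1)
    by (intro riem_dist_lower_bound[where \<epsilon> = d]) (auto simp: dist_commute)
  \<comment> \<open>Convexity of the affine set and of the ball keeps the segment to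
    \<open>Kstar\<close> inside \<open>S'\<close>.\<close>
  have up: "riem_dist S' g p Kstar \<le> ennreal (c2 * norm (p - Kstar))" if "p \<in> U" for p
  proof (rule riem_dist_upper_bound)
    have "closed_segment p Kstar \<subseteq> ball Kstar d"
      using U(3)[OF that] d by (intro closed_segment_subset convex_ball) (auto simp: dist_commute)
    then have b: "dist q Kstar < d" if "q \<in> closed_segment p Kstar" for q
      using that by (auto simp: dist_commute)
    have "closed_segment p Kstar \<subseteq> L"
      using U(1)[OF that] z(2) affine_imp_convex[OF \<open>affine L\<close>]
      by (intro closed_segment_subset) (auto simp: S'_def)
    then show "closed_segment p Kstar \<subseteq> S'" using near(1) b by (auto simp: S'_def)
    show "g q u u \<le> c2\<^sup>2 * (norm u)\<^sup>2" if "q \<in> closed_segment p Kstar" for q u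
      by (rule near(3)[OF b[OF that]])
  qed (use c in simp)
  \<comment> \<open>The full-step Newton map. Its description denotes on \<open>U\<close>, so every
    sequence started there is forced to be the orbit of \<open>N\<close>.\<close>
  define N where "N p = p + (THE G. newton_direction T w H p G)" for p
  have N: "newton_direction T w H p (N p - p)"
      "newton_direction T w H p G \<Longrightarrow> p + G = N p" if "p \<in> U" for p G
    using theI'[OF near(4)[OF U(3)[OF that] U(1)[OF that]]] near(4)[OF U(3)[OF that] U(1)[OF that]]
    unfolding N_def by (simp, metis)
  have seq_step: "K (Suc t) = N (K t)" "K (Suc t) \<in> U"
      "norm (K (Suc t) - Kstar) \<le> C * (norm (K t - Kstar))\<^sup>2"
    if K: "qrnpo_sequence A B Q T w H K0 K" and t: "K t \<in> U" for K K0 t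
  proof -
    obtain G where G: "newton_direction T w H (K t) G"
      "K (Suc t) = K t + qrnpo_step_size A B Q (K t) G *\<^sub>R G"
      using K unfolding qrnpo_sequence_def by blast
    then show "K (Suc t) = N (K t)" "K (Suc t) \<in> U"
      "norm (K (Suc t) - Kstar) \<le> C * (norm (K t - Kstar))\<^sup>2"
      using step[OF t G(1)] N(2)[OF t G(1)] by auto
  qed
  have seq_in: "K t \<in> U" if "qrnpo_sequence A B Q T w H K0 K" "K0 \<in> U" for K K0 t
    using that by (induction t) (auto simp: qrnpo_sequence_def intro: seq_step(2))
  have ex1: "\<exists>!K. qrnpo_sequence A B Q T w H K0 K" if K0: "K0 \<in> U" for K0
  proof (rule ex1I)
    have inU: "(N ^^ t) K0 \<in> U" for t
    proof (induction t)
      case (Suc t)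
      then show ?case using step(3)[OF Suc N(1)[OF Suc]] by simp
    qed (use K0 in simp)
    have "\<exists>G. newton_direction T w H ((N ^^ t) K0) G \<and>
        (N ^^ Suc t) K0 = (N ^^ t) K0 + qrnpo_step_size A B Q ((N ^^ t) K0) G *\<^sub>R G" for t
      using N(1)[OF inU[of t]] step(1)[OF inU[of t] N(1)[OF inU[of t]]] by auto
    then show "qrnpo_sequence A B Q T w H K0 (\<lambda>t. (N ^^ t) K0)" unfolding qrnpo_sequence_def by simp
    fix K assume K: "qrnpo_sequence A B Q T w H K0 K"
    have "K t = (N ^^ t) K0" for t
    proof (induction t)
      case 0
      then show ?case using K by (simp add: qrnpo_sequence_def)
    next
      case (Suc t)
      then show ?case using seq_step(1)[OF K seq_in[OF K K0]] by simp
    qed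
    then show "K = (\<lambda>t. (N ^^ t) K0)" by auto
  qed
  have rates: "K \<longlonglongrightarrow> Kstar \<and> linear_rate (riem_dist S' g) K Kstar \<and>
      eventual_quadratic_rate (riem_dist S' g) K Kstar"
    if K: "qrnpo_sequence A B Q T w H K0 K" and K0: "K0 \<in> U" for K K0
  proof -
    note inU = seq_in[OF K K0]
    note rates = quadratic_recursion_rates[where K = K and z = Kstar and d = "riem_dist S' g" and \<epsilon> = \<epsilon>,
        OF c(1,2) C(1) U(2)[OF inU] seq_step(3)[OF K inU] low[OF inU] up[OF inU] \<epsilon>(4,5)]
    show ?thesis by (intro conjI rates)
  qed
  show ?thesis
    unfolding w_def[symmetric]
  proof (intro exI[of _ U] conjI ballI allI impI)
    show "openin (top_of_set S') U" unfolding U_def by (rule openin_open_Int) simp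
    show "Kstar \<in> U" using z(3) \<epsilon>(1) by (simp add: U_def)
  qed (use ex1 seq_in rates in blast)+
qed

end
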